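(* Assume (A1), and assume further that $p\mapsto H(x,p)$ is convex for each $x\in\mathbb{T}^n$. Let $L=L(x,v)$ be the Legendre transform of $H$, that is, $L(x,v)=\sup_{p\in\mathbb{R}^n}(v\cdot p-H(x,p))$. Fix $(z,T)\in\mathbb{T}^n\times(0,\infty)$. Let $\sigma^z$ and $\mu^z$ be the measures obtained as follows: $\{\varepsilon_k\}$ is a sequence converging to $0$ such that $\sigma^{\varepsilon_k,z}(x,0)\,dx$ converges to $d\sigma^z(x)$ and $\mu^{\varepsilon_k,z}$ converges to $\mu^z$ weakly in the sense of measures. Let $\gamma^z\in\mathcal{R}^+(\mathbb{T}^n\times\overline B(0,C)\times[0,T])$ be such that $$\int_{\mathbb{T}^n\times\mathbb{R}^n\times[0,T]}\psi(x,D_pH(x,p))\,d\mu^z(x,p,t)=\int_{\mathbb{T}^n\times\mathbb{R}^n\times[0,T]}\psi(x,v)\,d\gamma^z(x,v,t)$$ for all $\psi\in C(\mathbb{T}^n\times\mathbb{R}^n)$. Then $$u(z,T)=\int_{\mathbb{T}^n}g(x)\,d\sigma^z(x)+\int_{\mathbb{T}^n\times\mathbb{R}^n\times[0,T]}L(x,v)\,d\gamma^z(x,v,t).$$ Furthermore, $\gamma^z\in\mathcal{H}(\sigma^z,\delta_z;0,T)$, and $$u(z,T)=\inf_{\gamma\in\mathcal{H}(\delta_z;0,T)}\left(\int_{\mathbb{T}^n}g(x)\,d\sigma^\gamma(x)+\int_{\mathbb{T}^n\times\mathbb{R}^n\times[0,T]}L(x,v)\,d\gamma(x,v,t)\right).$$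 In other words, $\gamma^z$ is a minimizer of this minimizing problem.
   Context: $\mathbb{T}^n=\mathbb{R}^n/\mathbb{Z}^n$ is the flat torus; $H\in C^2(\mathbb{T}^n\times\mathbb{R}^n)$ and $g\in C^2(\mathbb{T}^n)$ are given. (A1): $\displaystyle\lim_{|p|\to\infty}\min_{x\in\mathbb{T}^n}\Big(\tfrac12 H(x,p)^2+D_xH(x,p)\cdot p\Big)=+\infty.$ $u$ is the viscosity solution of $u_t+H(x,Du)=0$ in $\mathbb{T}^n\times(0,\infty)$, $u(x,0)=g(x)$ on $\mathbb{T}^n$. For $\varepsilon\in(0,1)$, $u^\varepsilon$ is the solution of $u^\varepsilon_t+H(x,Du^\varepsilon)=\varepsilon\Delta u^\varepsilon$ in $\mathbb{T}^n\times(0,\infty)$, $u^\varepsilon(x,0)=g(x)$ on $\mathbb{T}^n$. Under (A1) there is a constant $C>0$, depending only on $\|g\|_{C^2(\mathbb{T}^n)}$, $H$ and $n$, such that $\|u^\varepsilon_t\|_{L^\infty}+\|Du^\varepsilon\|_{L^\infty}\le C$ and $\|u_t\|_{L^\infty}+\|Du\|_{L^\infty}\le C$ on $\mathbb{T}^n\times[0,\infty)$ for all $\varepsilon\in(0,1)$, and $u^\varepsilon\to u$ locally uniformly on $\mathbb{T}^n\times[0,\infty)$ as $\varepsilon\to0$. This $C$ is the one used in the balls $\overline B(0,C)$ below and in the claim. $\sigma^{\varepsilon,z}$ (depending also on $T$) is the solution of the adjoint problem $-\sigma_t-\operatorname{div}(D_pH(x,Du^\varepsilon)\sigma)=\varepsilon\Delta\sigma$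 in $\mathbb{T}^n\times(0,T)$, $\sigma(\cdot,T)=\delta_z$ (the Dirac mass at $z$); it is nonnegative on $\mathbb{T}^n\times[0,T)$ with $\int_{\mathbb{T}^n}\sigma^{\varepsilon,z}(x,t)\,dx=1$ for all $t\in[0,T)$. For each $t\in[0,T]$, $\nu^{\varepsilon,z}(\cdot,\cdot,t)$ is the probability measure on $\mathbb{T}^n\times\overline B(0,C)$ such that $\int_{\mathbb{T}^n\times\mathbb{R}^n}\psi(x,p)\,d\nu^{\varepsilon,z}(x,p,t)=\int_{\mathbb{T}^n}\psi(x,Du^\varepsilon(x,t))\sigma^{\varepsilon,z}(x,t)\,dx$ for all $\psi\in C(\mathbb{T}^n\times\mathbb{R}^n)$, and $\mu^{\varepsilon,z}$ is the nonnegative Radon measure on $\mathbb{T}^n\times\overline B(0,C)\times[0,T]$ given by $d\mu^{\varepsilon,z}(x,p,t)=d\nu^{\varepsilon,z}(x,p,t)\,dt$. $\mathcal{R}^+(\mathbb{T}^n\times\overline B(0,C)\times[0,T])$ is the set of all nonnegative Radon measures on $\mathbb{T}^n\times\overline B(0,C)\times[0,T]$, and $\mathcal{P}(\mathbb{T}^n)$ is the set of all Radon probability measures on $\mathbb{T}^n$. For $\sigma_0\in\mathcal{P}(\mathbb{T}^n)$, $\mathcal{H}(\sigma_0,\delta_z;0,T)$ is the set of all $\gamma\in\mathcal{R}^+(\mathbb{T}^n\times\overline B(0,C)\times[0,T])$ such that $$\int_{\mathbb{T}^n\times\mathbb{R}^n\times[0,T]}\big(\varphi_t(x,t)+v\cdot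 D\varphi(x,t)\big)\,d\gamma(x,v,t)=\varphi(z,T)-\int_{\mathbb{T}^n}\varphi(x,0)\,d\sigma_0(x)$$ for all test functions $\varphi\in C^2(\mathbb{T}^n\times[0,T])$. Set $\mathcal{H}(\delta_z;0,T)=\bigcup_{\sigma_0\in\mathcal{P}(\mathbb{T}^n)}\mathcal{H}(\sigma_0,\delta_z;0,T)$. For $\gamma\in\mathcal{H}(\delta_z;0,T)$, $\sigma^\gamma\in\mathcal{P}(\mathbb{T}^n)$ denotes the unique element such that $\gamma\in\mathcal{H}(\sigma^\gamma,\delta_z;0,T)$.
   Formalization: That γ^z lies in H(σ^z,δ_z;0,T) and is a minimizer is proved when the relation between μ^z and γ^z holds for all continuous ψ(x,v,t); with ψ(x,v) only, as stated, these two claims fail, since the time distribution of γ^z is then undetermined. *)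

theory Defs
  imports "HOL-Analysis.Analysis"
begin

text \<open>
  Conventions for the flat torus \<open>\<real>\<^sup>n/\<int>\<^sup>n\<close>, with \<open>\<real>\<^sup>n\<close> the type \<^typ>\<open>real^'n\<close>.
  A function on the torus is a function on \<open>\<real>\<^sup>n\<close> that is invariant under integer translations.
  A measure on the torus is a measure on the half-open unit cube \<open>torus_dom\<close>. The cube contains
  exactly one representative of each point, and the quotient map restricted to it is a Borel
  isomorphism. The topology of the torus enters through the test functions, which are continuous
  and invariant under integer translations on all of \<open>\<real>\<^sup>n\<close>.
\<close>

definition torus_dom :: "(real^'n) set" where
  "torus_dom = {x. \<forall>i. 0 \<le> x $ i \<and> x $ i < 1}"

definition Zn_periodic :: "(real^'n \<Rightarrow> 'b) \<Rightarrow> bool" where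
  "Zn_periodic f \<longleftrightarrow> (\<forall>x k. (\<forall>i. k $ i \<in> \<int>) \<longrightarrow> f (x + k) = f x)"

text \<open>\<open>CT Y \<psi>\<close> states that \<open>\<psi>\<close> belongs to \<open>C(\<T>\<^sup>n \<times> Y)\<close>.\<close>

definition CT :: "'y::topological_space set \<Rightarrow> (real^'n \<Rightarrow> 'y \<Rightarrow> real) \<Rightarrow> bool" where
  "CT Y \<psi> \<longleftrightarrow> continuous_on (UNIV \<times> Y) (\<lambda>(x, y). \<psi> x y) \<and> (\<forall>y\<in>Y. Zn_periodic (\<lambda>x. \<psi> x y))"


subsection \<open>Differential operators and regularity classes\<close>

definition grad :: "(real^'n \<Rightarrow> real) \<Rightarrow> real^'n \<Rightarrow> real^'n" where
  "grad f x = (\<chi> i. frechet_derivative f (at x) (axis i 1))"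

definition laplacian :: "(real^'n \<Rightarrow> real) \<Rightarrow> real^'n \<Rightarrow> real" where
  "laplacian f x = (\<Sum>i\<in>UNIV. frechet_derivative (grad f) (at x) (axis i 1) $ i)"

text \<open>
  The derivatives below are taken within \<open>S\<close>, so that a closed strip such as \<open>\<real>\<^sup>n \<times> [0,T]\<close>
  is covered, with one-sided derivatives on its boundary.
\<close>

definition C1_on :: "('a::real_normed_vector \<Rightarrow> 'b::real_normed_vector) \<Rightarrow> 'a set \<Rightarrow> bool" where
  "C1_on f S \<longleftrightarrow> (\<exists>f'. (\<forall>x\<in>S. (f has_derivative blinfun_apply (f' x)) (at x within S)) \<and>
     continuous_on S f')"

definition C2_on :: "('a::real_normed_vector \<Rightarrow> 'b::real_normed_vector) \<Rightarrow> 'a set \<Rightarrow> bool" where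
  "C2_on f S \<longleftrightarrow> (\<exists>f'. (\<forall>x\<in>S. (f has_derivative blinfun_apply (f' x)) (at x within S)) \<and>
     C1_on f' S)"

text \<open>The parabolic class \<open>C\<^sup>2\<^sup>,\<^sup>1\<close>: \<open>w\<^sub>t\<close>, \<open>Dw\<close> and \<open>D\<^sup>2w\<close> exist and are continuous on \<open>\<real>\<^sup>n \<times> I\<close>, \<open>I\<close> open.\<close>

definition C21_on :: "(real^'n \<Rightarrow> real \<Rightarrow> real) \<Rightarrow> real set \<Rightarrow> bool" where
  "C21_on w I \<longleftrightarrow> (\<exists>wt (dw :: real^'n \<Rightarrow> real \<Rightarrow> real^'n) (ddw :: real^'n \<Rightarrow> real \<Rightarrow> real^'n^'n).
     (\<forall>x. \<forall>t\<in>I. (w x has_real_derivative wt x t) (at t) \<and>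
        ((\<lambda>y. w y t) has_derivative (\<lambda>h. dw x t \<bullet> h)) (at x) \<and>
        ((\<lambda>y. dw y t) has_derivative (\<lambda>h. ddw x t *v h)) (at x)) \<and>
     continuous_on (UNIV \<times> I) (\<lambda>(x, t). wt x t) \<and>
     continuous_on (UNIV \<times> I) (\<lambda>(x, t). dw x t) \<and>
     continuous_on (UNIV \<times> I) (\<lambda>(x, t). ddw x t))"


subsection \<open>The Hamiltonian and the Hamilton-Jacobi equations\<close>

text \<open>
  The growth condition on \<open>H\<close>. The function of \<open>x\<close> is continuous and periodic for \<open>H\<close> of class \<open>C\<^sup>2\<close>,
  so the infimum is a minimum.
\<close>

definition A1 :: "(real^'n \<Rightarrow> real^'n \<Rightarrow> real) \<Rightarrow> bool" where
  "A1 H \<longleftrightarrow> filterlim (\<lambda>p. INF x. (H x p)\<^sup>2 / 2 + grad (\<lambda>y. H y p) x \<bullet> p) at_top at_infinity"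

text \<open>The Legendre transform takes the value \<open>\<infinity>\<close> where \<open>H\<close> grows too slowly, e.g. linearly.\<close>

definition legendre :: "(real^'n \<Rightarrow> real^'n \<Rightarrow> real) \<Rightarrow> real^'n \<Rightarrow> real^'n \<Rightarrow> ereal" where
  "legendre H x v = (SUP p. ereal (v \<bullet> p - H x p))"

definition viscosity_subsolution ::
    "(real^'n \<Rightarrow> real^'n \<Rightarrow> real) \<Rightarrow> (real^'n \<Rightarrow> real \<Rightarrow> real) \<Rightarrow> bool" where
  "viscosity_subsolution H u \<longleftrightarrow>
     (\<forall>\<phi> x t. C1_on (\<lambda>(y, s). \<phi> y s) (UNIV \<times> {0<..}) \<longrightarrow> t > 0 \<longrightarrow>
        (\<forall>\<^sub>F (y, s) in nhds (x, t). u y s - \<phi> y s \<le> u x t - \<phi> x t) \<longrightarrow>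
        deriv (\<phi> x) t + H x (grad (\<lambda>y. \<phi> y t) x) \<le> 0)"

definition viscosity_supersolution ::
    "(real^'n \<Rightarrow> real^'n \<Rightarrow> real) \<Rightarrow> (real^'n \<Rightarrow> real \<Rightarrow> real) \<Rightarrow> bool" where
  "viscosity_supersolution H u \<longleftrightarrow>
     (\<forall>\<phi> x t. C1_on (\<lambda>(y, s). \<phi> y s) (UNIV \<times> {0<..}) \<longrightarrow> t > 0 \<longrightarrow>
        (\<forall>\<^sub>F (y, s) in nhds (x, t). u y s - \<phi> y s \<ge> u x t - \<phi> x t) \<longrightarrow>
        deriv (\<phi> x) t + H x (grad (\<lambda>y. \<phi> y t) x) \<ge> 0)"

definition viscosity_solution ::
    "(real^'n \<Rightarrow> real^'n \<Rightarrow> real) \<Rightarrow> (real^'n \<Rightarrow> real) \<Rightarrow> (real^'n \<Rightarrow> real \<Rightarrow> real) \<Rightarrow> bool" where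
  "viscosity_solution H g u \<longleftrightarrow> CT {0..} u \<and> (\<forall>x. u x 0 = g x) \<and>
     viscosity_subsolution H u \<and> viscosity_supersolution H u"

definition viscous_solution ::
    "real \<Rightarrow> (real^'n \<Rightarrow> real^'n \<Rightarrow> real) \<Rightarrow> (real^'n \<Rightarrow> real) \<Rightarrow> (real^'n \<Rightarrow> real \<Rightarrow> real) \<Rightarrow> bool" where
  "viscous_solution \<epsilon> H g w \<longleftrightarrow> CT {0..} w \<and> (\<forall>x. w x 0 = g x) \<and> C21_on w {0<..} \<and>
     (\<forall>x. \<forall>t>0. deriv (w x) t + H x (grad (\<lambda>y. w y t) x) = \<epsilon> * laplacian (\<lambda>y. w y t) x)"

text \<open>
  The bound \<open>\<parallel>w\<^sub>t\<parallel>\<^sub>\<infinity> + \<parallel>Dw\<parallel>\<^sub>\<infinity> \<le> C\<close> on \<open>\<T>\<^sup>n \<times> [0,\<infinity>)\<close>: \<open>A\<close> and \<open>B\<close> are essential upper bounds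
  of the two summands.
\<close>

definition derivative_bound :: "real \<Rightarrow> (real^'n \<Rightarrow> real \<Rightarrow> real) \<Rightarrow> bool" where
  "derivative_bound C w \<longleftrightarrow> (\<exists>A B. A + B \<le> C \<and>
     (AE (x, t) in lborel. t > 0 \<longrightarrow>
        (\<lambda>(y, s). w y s) differentiable (at (x, t)) \<and>
        \<bar>deriv (w x) t\<bar> \<le> A \<and> norm (grad (\<lambda>y. w y t) x) \<le> B))"


subsection \<open>The adjoint problem\<close>

text \<open>
  \<open>-\<sigma>\<^sub>t - div(D\<^sub>pH(x,Dw) \<sigma>) = \<epsilon> \<Delta>\<sigma>\<close> in \<open>\<T>\<^sup>n \<times> (0,T)\<close> with \<open>\<sigma>(\<cdot>,T) = \<delta>\<^sub>z\<close>. For \<open>H\<close> of class \<open>C\<^sup>2\<close> the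
  coefficient \<open>div(D\<^sub>pH(x,Dw))\<close> is only continuous, so \<open>\<sigma>\<close> need not be twice differentiable, and the
  equation is understood in the sense of distributions; \<open>\<sigma>(\<cdot>,t)dx \<rightarrow> \<delta>\<^sub>z\<close> is convergence of measures.
\<close>

definition adjoint_solution ::
    "real \<Rightarrow> (real^'n \<Rightarrow> real^'n \<Rightarrow> real) \<Rightarrow> (real^'n \<Rightarrow> real \<Rightarrow> real) \<Rightarrow> real^'n \<Rightarrow> real \<Rightarrow>
      (real^'n \<Rightarrow> real \<Rightarrow> real) \<Rightarrow> bool" where
  "adjoint_solution \<epsilon> H w z T \<sigma> \<longleftrightarrow>
     CT {0..<T} \<sigma> \<and>
     (\<forall>x. \<forall>t\<in>{0..<T}. \<sigma> x t \<ge> 0) \<and>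
     (\<forall>t\<in>{0..<T}. (LINT x:torus_dom|lborel. \<sigma> x t) = 1) \<and>
     (\<forall>\<phi>. C21_on \<phi> {0<..<T} \<longrightarrow> (\<forall>t. Zn_periodic (\<lambda>x. \<phi> x t)) \<longrightarrow>
        (\<exists>a b. 0 < a \<and> b < T \<and> (\<forall>x t. t \<notin> {a..b} \<longrightarrow> \<phi> x t = 0)) \<longrightarrow>
        (LINT (x, t):torus_dom \<times> {0<..<T}|lborel.
           (deriv (\<phi> x) t + grad (H x) (grad (\<lambda>y. w y t) x) \<bullet> grad (\<lambda>y. \<phi> y t) x
             - \<epsilon> * laplacian (\<lambda>y. \<phi> y t) x) * \<sigma> x t) = 0) \<and>
     (\<forall>\<psi>. continuous_on UNIV \<psi> \<longrightarrow> Zn_periodic \<psi> \<longrightarrow>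
        ((\<lambda>t. LINT x:torus_dom|lborel. \<psi> x * \<sigma> x t) \<longlongrightarrow> \<psi> z) (at_left T))"


subsection \<open>Measures\<close>

text \<open>
  Nonnegative Radon measures. The spaces in question are compact metric spaces, for which these are
  the finite Borel measures.
\<close>

definition radon_measures :: "'a::topological_space set \<Rightarrow> 'a measure set" where
  "radon_measures S = {M. sets M = sets (restrict_space borel S) \<and> finite_measure M}"

definition torus_probs :: "(real^'n) measure set" where
  "torus_probs = {M. M \<in> radon_measures torus_dom \<and> emeasure M (space M) = 1}"

text \<open>The space \<open>\<T>\<^sup>n \<times> B(0,C) \<times> [0,T]\<close>, with the closed ball.\<close>

definition phase :: "real \<Rightarrow> real \<Rightarrow> ((real^'n) \<times> (real^'n) \<times> real) set" where
  "phase C T = torus_dom \<times> cball 0 C \<times> {0..T}"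

definition is_nu ::
    "real \<Rightarrow> (real^'n \<Rightarrow> real \<Rightarrow> real) \<Rightarrow> (real^'n \<Rightarrow> real \<Rightarrow> real) \<Rightarrow> real \<Rightarrow>
      ((real^'n) \<times> (real^'n)) measure \<Rightarrow> bool" where
  "is_nu C w \<sigma> t \<nu> \<longleftrightarrow> \<nu> \<in> radon_measures (torus_dom \<times> cball 0 C) \<and> emeasure \<nu> (space \<nu>) = 1 \<and>
     (\<forall>\<psi>. CT UNIV \<psi> \<longrightarrow>
        (\<integral>(x, p). \<psi> x p \<partial>\<nu>) = (LINT x:torus_dom|lborel. \<psi> x (grad (\<lambda>y. w y t) x) * \<sigma> x t))"

text \<open>\<open>d\<mu>(x,p,t) = d\<nu>(x,p,t) dt\<close>, as an identity of integrals of continuous functions.\<close>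

definition is_mu ::
    "real \<Rightarrow> real \<Rightarrow> (real \<Rightarrow> ((real^'n) \<times> (real^'n)) measure) \<Rightarrow> ((real^'n) \<times> (real^'n) \<times> real) measure \<Rightarrow>
      bool" where
  "is_mu C T \<nu> \<mu> \<longleftrightarrow> \<mu> \<in> radon_measures (phase C T) \<and>
     (\<forall>\<psi>. CT (cball 0 C \<times> {0..T}) (\<lambda>x (p, t). \<psi> x p t) \<longrightarrow>
        (\<integral>(x, p, t). \<psi> x p t \<partial>\<mu>) = (LINT t:{0..T}|lborel. (\<integral>(x, p). \<psi> x p t \<partial>\<nu> t)))"

definition weak_conv_torus :: "(nat \<Rightarrow> real^'n \<Rightarrow> real) \<Rightarrow> (real^'n) measure \<Rightarrow> bool" where
  "weak_conv_torus s M \<longleftrightarrow> (\<forall>\<psi>. continuous_on UNIV \<psi> \<longrightarrow> Zn_periodic \<psi> \<longrightarrow>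
     (\<lambda>k. LINT x:torus_dom|lborel. \<psi> x * s k x) \<longlonglongrightarrow> (\<integral>x. \<psi> x \<partial>M))"

definition weak_conv_phase ::
    "real \<Rightarrow> real \<Rightarrow> (nat \<Rightarrow> ((real^'n) \<times> (real^'n) \<times> real) measure) \<Rightarrow>
      ((real^'n) \<times> (real^'n) \<times> real) measure \<Rightarrow> bool" where
  "weak_conv_phase C T Mk M \<longleftrightarrow>
     (\<forall>\<psi>. CT (cball 0 C \<times> {0..T}) (\<lambda>x (p, t). \<psi> x p t) \<longrightarrow>
        (\<lambda>k. \<integral>(x, p, t). \<psi> x p t \<partial>Mk k) \<longlonglongrightarrow> (\<integral>(x, p, t). \<psi> x p t \<partial>M))"

text \<open>
  Integral of a function with values in \<open>[-\<infinity>,\<infinity>]\<close>. It is used for \<open>L\<close>, which is bounded below on the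
  torus times \<open>\<real>\<^sup>n\<close> since \<open>L(x,v) \<ge> -H(x,0)\<close>, so that the subtracted term is finite.
\<close>

definition ereal_integral :: "'a measure \<Rightarrow> ('a \<Rightarrow> ereal) \<Rightarrow> ereal" where
  "ereal_integral M f =
     enn2ereal (\<integral>\<^sup>+ x. e2ennreal (f x) \<partial>M) - enn2ereal (\<integral>\<^sup>+ x. e2ennreal (- f x) \<partial>M)"

text \<open>The sets \<open>\<H>(\<sigma>\<^sub>0,\<delta>\<^sub>z;0,T)\<close> and \<open>\<H>(\<delta>\<^sub>z;0,T)\<close>, and the measure \<open>\<sigma>\<^sup>\<gamma>\<close>.\<close>

definition transport_from ::
    "real \<Rightarrow> real \<Rightarrow> real^'n \<Rightarrow> (real^'n) measure \<Rightarrow> ((real^'n) \<times> (real^'n) \<times> real) measure set" where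
  "transport_from C T z \<sigma>\<^sub>0 = {\<gamma>. \<gamma> \<in> radon_measures (phase C T) \<and>
     (\<forall>\<phi>. C2_on (\<lambda>(x, t). \<phi> x t) (UNIV \<times> {0..T}) \<longrightarrow> (\<forall>t\<in>{0..T}. Zn_periodic (\<lambda>x. \<phi> x t)) \<longrightarrow>
        (\<integral>(x, v, t). vector_derivative (\<phi> x) (at t within {0..T}) + v \<bullet> grad (\<lambda>y. \<phi> y t) x \<partial>\<gamma>)
          = \<phi> z T - (\<integral>x. \<phi> x 0 \<partial>\<sigma>\<^sub>0))}"

definition transport :: "real \<Rightarrow> real \<Rightarrow> real^'n \<Rightarrow> ((real^'n) \<times> (real^'n) \<times> real) measure set" where
  "transport C T z = (\<Union>\<sigma>\<^sub>0\<in>torus_probs. transport_from C T z \<sigma>\<^sub>0)"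

definition initial_marginal ::
    "real \<Rightarrow> real \<Rightarrow> real^'n \<Rightarrow> ((real^'n) \<times> (real^'n) \<times> real) measure \<Rightarrow> (real^'n) measure" where
  "initial_marginal C T z \<gamma> = (THE \<sigma>\<^sub>0. \<sigma>\<^sub>0 \<in> torus_probs \<and> \<gamma> \<in> transport_from C T z \<sigma>\<^sub>0)"

definition cost ::
    "(real^'n \<Rightarrow> real^'n \<Rightarrow> real) \<Rightarrow> (real^'n \<Rightarrow> real) \<Rightarrow> real \<Rightarrow> real \<Rightarrow> real^'n \<Rightarrow>
      ((real^'n) \<times> (real^'n) \<times> real) measure \<Rightarrow> ereal" where
  "cost H g C T z \<gamma> =
     ereal (\<integral>x. g x \<partial>initial_marginal C T z \<gamma>) + ereal_integral \<gamma> (\<lambda>(x, v, t). legendre H x v)"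

end

theory Submission
  imports Defs
begin

text \<open>
  Write \<open>w\<close> for the viscous solution \<open>u\<^sup>\<epsilon>\<close>. Testing the adjoint equation with a function \<open>\<phi>\<close> gives
  \<open>\<phi>(z,T) - \<integral>\<phi>(\<cdot>,0) d\<sigma>\<^sup>\<epsilon>(0) = \<integral>\<integral> (\<phi>\<^sub>t + D\<^sub>pH(x,Dw)\<cdot>D\<phi> - \<epsilon>\<Delta>\<phi>) \<sigma>\<^sup>\<epsilon>\<close> (\<open>adjoint_duality\<close>). For \<open>\<phi> = w\<close> the viscous
  equation turns the integrand into \<open>D\<^sub>pH\<cdot>Dw - H\<close>, so in the limit
  \<open>u(z,T) = \<integral>g d\<sigma>\<^sup>z + \<integral>(D\<^sub>pH\<cdot>p - H) d\<mu>\<^sup>z\<close>. For a fixed smooth \<open>\<phi>\<close> the viscous term is \<open>O(\<epsilon>)\<close>, and the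
  limit is the transport identity for the image of \<open>\<mu>\<^sup>z\<close> under \<open>(x,p,t) \<mapsto> (x,D\<^sub>pH(x,p),t)\<close>. Convexity
  makes \<open>D\<^sub>pH\<cdot>p - H\<close> equal to \<open>L(x,D\<^sub>pH)\<close>. The function \<open>L\<close> need be neither finite nor continuous, but it
  is the increasing limit of finite maxima of functions affine in \<open>v\<close>, and these carry the integral
  from \<open>\<mu>\<^sup>z\<close> to \<open>\<gamma>\<^sup>z\<close> (\<open>legendre_integral\<close>).

  For the lower bound let \<open>\<gamma>\<close> be admissible with initial measure \<open>\<sigma>\<^sub>0\<close>. With \<open>w\<close> as a test function,
  the viscous equation and the inequality \<open>v\<cdot>p \<le> H(x,p) + L(x,v)\<close> give
  \<open>w(z,T) - \<integral>g d\<sigma>\<^sub>0 \<le> \<integral>L d\<gamma> + \<epsilon>\<integral>\<Delta>w d\<gamma>\<close>. The last term is not small as it stands, since \<open>\<Delta>w\<close> is not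
  bounded uniformly in \<open>\<epsilon>\<close>. But \<open>F(a) = \<integral>w(x+a,t) d\<gamma>\<close> is Lipschitz in \<open>a\<close> with a constant independent
  of \<open>\<epsilon>\<close>, so for \<open>K\<close> of order \<open>1/\<eta>\<close> the function \<open>F(a) - K\<bar>a\<bar>\<^sup>2\<close> has an interior maximum in the ball of
  radius \<open>\<eta>\<close>, and there \<open>\<integral>\<Delta>w(x+a,t) d\<gamma>\<close> is at most of order \<open>1/\<eta>\<close> (\<open>translation_laplacian_bound\<close>).
  Testing with the translate of \<open>w\<close> by this \<open>a\<close> costs only \<open>O(\<eta>)\<close> and the modulus of continuity of \<open>H\<close>;
  then \<open>\<epsilon> \<rightarrow> 0\<close> and \<open>\<eta> \<rightarrow> 0\<close> (\<open>transport_lower_bound\<close>). Since \<open>w\<close> has only the regularity \<open>C\<^sup>2\<^sup>,\<^sup>1\<close>, and only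
  for positive times, it is first shifted and averaged in time, which makes it jointly \<open>C\<^sup>2\<close>
  (\<open>transport_from_C21\<close>).

  Three further facts enter. The convergence \<open>u\<^sup>\<epsilon>(z,T) \<rightarrow> u(z,T)\<close> comes from doubling the variables, where
  the classical derivatives of \<open>u\<^sup>\<epsilon>\<close> meet a quadratic test function for \<open>u\<close> (\<open>vanishing_viscosity_estimate\<close>). The initial measure of
  an admissible \<open>\<gamma>\<close> is unique because smooth periodic functions separate measures on the torus
  (\<open>initial_marginal_unique\<close>). Finally \<open>\<gamma>\<^sup>z\<close> is tied to \<open>\<mu>\<^sup>z\<close> only through functions of \<open>(x,v)\<close>, so its
  dependence on time is not determined; the infimum is shown to be attained at the image of \<open>\<mu>\<^sup>z\<close>
  described above (\<open>velocity_pushforward\<close>).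
\<close>

section \<open>Periodic functions and integrals over the torus\<close>

abbreviation unit_box :: "(real^'n) set" where
  "unit_box \<equiv> cbox 0 (\<chi> i. 1)"

lemma unit_box_iff: "x \<in> unit_box \<longleftrightarrow> (\<forall>i. 0 \<le> x $ i \<and> x $ i \<le> 1)"
  by (simp add: mem_box_cart)

lemma torus_dom_subset_unit_box: "torus_dom \<subseteq> unit_box"
  by (simp add: torus_dom_def unit_box_iff less_imp_le Collect_mono subset_iff)

lemma torus_representative:
  fixes x :: "real^'n"
  obtains k where "\<And>i. k $ i \<in> \<int>" "x + k \<in> torus_dom"
proof
  let ?k = "(\<chi> i. - real_of_int \<lfloor>x $ i\<rfloor>) :: real^'n"
  show "?k $ i \<in> \<int>" for i by simp
  show "x + ?k \<in> torus_dom"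
    by (simp add: torus_dom_def) linarith
qed

lemma Zn_periodicD: "Zn_periodic f \<Longrightarrow> (\<And>i. k $ i \<in> \<int>) \<Longrightarrow> f (x + k) = f x"
  by (simp add: Zn_periodic_def)

lemma Zn_periodic_translate: "Zn_periodic f \<Longrightarrow> Zn_periodic (\<lambda>x. f (x + a))"
  by (simp add: Zn_periodic_def) (metis add.assoc add.commute)

lemma torus_dom_borel [measurable, simp]: "torus_dom \<in> sets borel"
proof -
  have eq: "torus_dom = (\<Inter>i. {x::real^'n. 0 \<le> x $ i} \<inter> {x. x $ i < 1})"
    by (auto simp: torus_dom_def)
  have "{x::real^'n. 0 \<le> x $ i} \<inter> {x. x $ i < 1} \<in> sets borel" for i
    by (intro sets.Int borel_closed borel_open closed_Collect_le open_Collect_less continuous_intros)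
  then show ?thesis
    unfolding eq by (intro sets.finite_INT) auto
qed

text \<open>
  Faces of a box are null sets, so integrals over the half-open fundamental cell may be computed on
  the compact cube, where Henstock-Kurzweil integration has its theorems on continuous parameters.
\<close>

lemma negligible_unit_box_diff: "negligible (unit_box - torus_dom :: (real^'n) set)"
proof (rule negligible_subset[OF negligible_frontier_interval])
  show "unit_box - torus_dom \<subseteq> unit_box - box (0::real^'n) (\<chi> i. 1)"
    by (auto simp: torus_dom_def mem_box_cart intro: less_imp_le)
qed

lemma set_integrable_torus:
  fixes f :: "real^'n \<Rightarrow> 'b::euclidean_space"
  assumes "continuous_on unit_box f"
  shows "set_integrable lborel torus_dom f"
proof -
  have "set_integrable lborel unit_box f"
    unfolding set_integrable_def by (rule borel_integrable_compact) (use assms in auto)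
  then show ?thesis
    by (rule set_integrable_subset) (auto simp: torus_dom_subset_unit_box)
qed

lemma LINT_torus_eq_integral:
  fixes f :: "real^'n \<Rightarrow> 'b::euclidean_space"
  assumes "continuous_on unit_box f"
  shows "(LINT x:torus_dom|lborel. f x) = integral unit_box f"
proof -
  have "(LINT x:torus_dom|lborel. f x) = integral torus_dom f"
    by (rule set_borel_integral_eq_integral(2)[OF set_integrable_torus[OF assms]])
  also have "\<dots> = integral unit_box f"
  proof (rule integral_spike_set)
    show "negligible {x \<in> torus_dom - unit_box. f x \<noteq> 0}"
      using torus_dom_subset_unit_box by (auto intro!: negligible_subset[OF negligible_empty])
    show "negligible {x \<in> unit_box - torus_dom. f x \<noteq> 0}"
      by (rule negligible_subset[OF negligible_unit_box_diff]) auto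
  qed
  finally show ?thesis .
qed

text \<open>
  Every point has a representative in the compact unit cube.
\<close>

lemma periodic_bounded:
  fixes f :: "real^'n \<Rightarrow> 'y::topological_space \<Rightarrow> 'b::real_normed_vector"
  assumes cont: "continuous_on (UNIV \<times> K) (\<lambda>(x, y). f x y)" and "compact K"
    and per: "\<And>y. y \<in> K \<Longrightarrow> Zn_periodic (\<lambda>x. f x y)"
  obtains M where "0 \<le> M" "\<And>x y. y \<in> K \<Longrightarrow> norm (f x y) \<le> M"
proof -
  have "compact ((\<lambda>(x, y). f x y) ` (unit_box \<times> K))"
    by (intro compact_continuous_image continuous_on_subset[OF cont] compact_Times \<open>compact K\<close>) auto
  then obtain M where M: "\<And>z. z \<in> (\<lambda>(x, y). f x y) ` (unit_box \<times> K) \<Longrightarrow> norm z \<le> M"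
    using compact_imp_bounded bounded_iff by metis
  have "norm (f x y) \<le> max M 0" if "y \<in> K" for x y
  proof -
    obtain k where k: "\<And>i. k $ i \<in> \<int>" "x + k \<in> torus_dom"
      using torus_representative by blast
    have "norm (f (x + k) y) \<le> M"
      using k(2) torus_dom_subset_unit_box that by (intro M) force
    then show ?thesis using Zn_periodicD[OF per[OF that] k(1)] by simp
  qed
  then show ?thesis by (intro that[of "max M 0"]) auto
qed

text \<open>
  Two points at distance less than 1 can be translated by the same integer vector so that the first
  lies in the unit cube; the second then lies in the cube \<open>[-1,2]\<^sup>n\<close>, which is compact.
\<close>

lemma periodic_uniformly_continuous:
  fixes f :: "real^'n \<Rightarrow> 'y::metric_space \<Rightarrow> 'b::metric_space"
  assumes cont: "continuous_on (UNIV \<times> K) (\<lambda>(x, y). f x y)" and "compact K"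
    and per: "\<And>y. y \<in> K \<Longrightarrow> Zn_periodic (\<lambda>x. f x y)" and "e > 0"
  obtains d where "0 < d" "\<And>x x' y y'. y \<in> K \<Longrightarrow> y' \<in> K \<Longrightarrow> dist x x' < d \<Longrightarrow> dist y y' < d \<Longrightarrow>
    dist (f x y) (f x' y') < e"
proof -
  define B :: "(real^'n) set" where "B = cbox (\<chi> i. - 1) (\<chi> i. 2)"
  have "uniformly_continuous_on (B \<times> K) (\<lambda>(x, y). f x y)"
    by (intro compact_uniformly_continuous continuous_on_subset[OF cont] compact_Times \<open>compact K\<close>)
       (auto simp: B_def)
  then obtain d where d: "d > 0" "\<And>p q. p \<in> B \<times> K \<Longrightarrow> q \<in> B \<times> K \<Longrightarrow> dist q p < d \<Longrightarrow>
      dist ((\<lambda>(x, y). f x y) q) ((\<lambda>(x, y). f x y) p) < e"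
    unfolding uniformly_continuous_on_def using \<open>e > 0\<close> by metis
  have "dist (f x y) (f x' y') < e"
    if "y \<in> K" "y' \<in> K" "dist x x' < min 1 (d / 2)" "dist y y' < min 1 (d / 2)" for x x' y y'
  proof -
    obtain k where k: "\<And>i. k $ i \<in> \<int>" "x + k \<in> torus_dom"
      using torus_representative by blast
    have 1: "x + k \<in> B"
      unfolding B_def mem_box_cart
    proof
      fix i
      have "0 \<le> (x + k) $ i" "(x + k) $ i < 1" using k(2) by (auto simp: torus_dom_def)
      then show "(\<chi> i. - 1) $ i \<le> (x + k) $ i \<and> (x + k) $ i \<le> (\<chi> i. 2) $ i" by simp
    qed
  have 2: "x' + k \<in> B"
      unfolding B_def mem_box_cart
    proof
      fix i
      have "\<bar>(x - x') $ i\<bar> \<le> norm (x - x')" by (rule component_le_norm_cart)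
      then have "\<bar>x $ i - x' $ i\<bar> < 1" using that(3) by (simp add: dist_norm)
      moreover have "0 \<le> x $ i + k $ i" "x $ i + k $ i < 1"
        using k(2) by (auto simp: torus_dom_def)
      ultimately show "(\<chi> i. - 1) $ i \<le> (x' + k) $ i \<and> (x' + k) $ i \<le> (\<chi> i. 2) $ i" by auto
    qed
    have "dist (x + k, y) (x' + k, y') \<le> dist x x' + dist y y'"
      by (simp add: dist_Pair_Pair sqrt_sum_squares_le_sum)
    also have "\<dots> < d" using that by auto
    finally have "dist (f (x + k) y) (f (x' + k) y') < e"
      using d(2)[of "(x' + k, y')" "(x + k, y)"] 1 2 that by auto
    then show ?thesis
      using Zn_periodicD[OF per[OF that(1)] k(1)] Zn_periodicD[OF per[OF that(2)] k(1)] by simp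
  qed
  then show ?thesis using \<open>d > 0\<close> by (intro that[of "min 1 (d / 2)"]) auto
qed

section \<open>The parabolic class and calculus on strips\<close>

text \<open>
  The class \<open>C\<^sup>2\<^sup>,\<^sup>1\<close> with its derivatives as arguments: several lemmas below assert bounds, continuity or
  transformation rules for exactly these functions.
\<close>

definition C21_with :: "real set \<Rightarrow> (real^'n \<Rightarrow> real \<Rightarrow> real) \<Rightarrow> (real^'n \<Rightarrow> real \<Rightarrow> real) \<Rightarrow>
    (real^'n \<Rightarrow> real \<Rightarrow> real^'n) \<Rightarrow> (real^'n \<Rightarrow> real \<Rightarrow> real^'n^'n) \<Rightarrow> bool" where
  "C21_with I w wt dw ddw \<longleftrightarrow>
     (\<forall>x. \<forall>t\<in>I. (w x has_real_derivative wt x t) (at t) \<and>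
        ((\<lambda>y. w y t) has_derivative (\<lambda>h. dw x t \<bullet> h)) (at x) \<and>
        ((\<lambda>y. dw y t) has_derivative (\<lambda>h. ddw x t *v h)) (at x)) \<and>
     continuous_on (UNIV \<times> I) (\<lambda>(x, t). wt x t) \<and>
     continuous_on (UNIV \<times> I) (\<lambda>(x, t). dw x t) \<and>
     continuous_on (UNIV \<times> I) (\<lambda>(x, t). ddw x t)"

lemma C21_on_iff: "C21_on w I \<longleftrightarrow> (\<exists>wt dw ddw. C21_with I w wt dw ddw)"
  unfolding C21_on_def C21_with_def ..

lemma
  assumes "C21_with I w wt dw ddw"
  shows C21_withD: "t \<in> I \<Longrightarrow> (w x has_real_derivative wt x t) (at t)"
        "t \<in> I \<Longrightarrow> ((\<lambda>y. w y t) has_derivative (\<lambda>h. dw x t \<bullet> h)) (at x)"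
        "t \<in> I \<Longrightarrow> ((\<lambda>y. dw y t) has_derivative (\<lambda>h. ddw x t *v h)) (at x)"
     and C21_with_cont: "continuous_on (UNIV \<times> I) (\<lambda>(x, t). wt x t)"
     "continuous_on (UNIV \<times> I) (\<lambda>(x, t). dw x t)"
     "continuous_on (UNIV \<times> I) (\<lambda>(x, t). ddw x t)"
  using assms unfolding C21_with_def by auto

lemma grad_eqI: "(f has_derivative (\<lambda>h. v \<bullet> h)) (at x) \<Longrightarrow> grad f x = v"
  unfolding grad_def by (drule frechet_derivative_at[symmetric]) (simp add: vec_eq_iff inner_axis)

lemma matrix_vector_mult_axis: "(A *v axis i 1) $ j = (A::real^'n^'m) $ j $ i"
  by (simp add: matrix_vector_mult_def axis_def if_distrib cong: if_cong)

lemma C21_with_eq: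
  assumes "C21_with I w wt dw ddw" "t \<in> I"
  shows "deriv (w x) t = wt x t" "grad (\<lambda>y. w y t) x = dw x t"
    "laplacian (\<lambda>y. w y t) x = (\<Sum>i\<in>UNIV. ddw x t $ i $ i)"
proof -
  note D = C21_withD[OF assms]
  show "deriv (w x) t = wt x t" using D(1) by (rule DERIV_imp_deriv)
  have g: "grad (\<lambda>y. w y t) = (\<lambda>x. dw x t)" using D(2) by (intro ext grad_eqI)
  then show "grad (\<lambda>y. w y t) x = dw x t" by simp
  show "laplacian (\<lambda>y. w y t) x = (\<Sum>i\<in>UNIV. ddw x t $ i $ i)"
    unfolding laplacian_def g frechet_derivative_at[OF D(3), symmetric]
    by (simp add: matrix_vector_mult_axis)
qed

lemma has_derivative_shift:
  "((\<lambda>y. f (y + k)) has_derivative f') (at x) \<longleftrightarrow> (f has_derivative f') (at (x + k :: 'a::real_normed_vector))"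
  (is "?l = ?r")
proof
  assume r: ?r
  have "((\<lambda>y. y + k) has_derivative (\<lambda>h. h)) (at x)" by (auto intro!: derivative_eq_intros)
  from has_derivative_compose[OF this r] show ?l .
next
  assume ?l
  then have *: "((\<lambda>y. f (y + k)) has_derivative f') (at (x + k - k))" by simp
  have "((\<lambda>y. y - k) has_derivative (\<lambda>h. h)) (at (x + k))" by (auto intro!: derivative_eq_intros)
  from has_derivative_compose[OF this *] show ?r by simp
qed

lemma C21_with_periodic:
  assumes C: "C21_with I w wt dw ddw" and per: "\<And>t. t \<in> I \<Longrightarrow> Zn_periodic (\<lambda>x. w x t)" "open I" "t \<in> I"
  shows "Zn_periodic (\<lambda>x. wt x t)" "Zn_periodic (\<lambda>x. dw x t)" "Zn_periodic (\<lambda>x. ddw x t)"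
proof -
  have *: "wt (x + k) t = wt x t \<and> dw (x + k) t = dw x t" if "\<forall>i. k $ i \<in> \<int>" for x k
  proof
    have "(w (x + k) has_real_derivative wt (x + k) t) (at t)" using C21_withD(1)[OF C \<open>t \<in> I\<close>] .
    then have "(w x has_real_derivative wt (x + k) t) (at t)"
      by (rule DERIV_cong_ev[OF refl _ refl, THEN iffD1, rotated])
         (use per(1) that eventually_nhds_in_open[OF per(2,3)] in \<open>auto simp: Zn_periodic_def elim!: eventually_mono\<close>)
    then show "wt (x + k) t = wt x t" using C21_withD(1)[OF C \<open>t \<in> I\<close>] DERIV_unique by blast
    have eq: "(\<lambda>y. w (y + k) t) = (\<lambda>y. w y t)"
      using per(1)[OF \<open>t \<in> I\<close>] that by (auto simp: Zn_periodic_def)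
    have "((\<lambda>y. w (y + k) t) has_derivative (\<lambda>h. dw (x + k) t \<bullet> h)) (at x)"
      using C21_withD(2)[OF C \<open>t \<in> I\<close>, of "x + k"] has_derivative_shift[of "\<lambda>y. w y t"] by blast
    then show "dw (x + k) t = dw x t" unfolding eq
      using grad_eqI[OF C21_withD(2)[OF C \<open>t \<in> I\<close>, of x]] grad_eqI by metis
  qed
  then show "Zn_periodic (\<lambda>x. wt x t)" "Zn_periodic (\<lambda>x. dw x t)" by (auto simp: Zn_periodic_def)
  have "ddw (x + k) t = ddw x t" if k: "\<forall>i. k $ i \<in> \<int>" for x k
  proof -
    have eq: "(\<lambda>y. dw (y + k) t) = (\<lambda>y. dw y t)" using * k by auto
    have "((\<lambda>y. dw (y + k) t) has_derivative (\<lambda>h. ddw (x + k) t *v h)) (at x)"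
      using C21_withD(3)[OF C \<open>t \<in> I\<close>, of "x + k"] has_derivative_shift[of "\<lambda>y. dw y t"] by blast
    then have "(*v) (ddw (x + k) t) = (*v) (ddw x t)" unfolding eq
      using C21_withD(3)[OF C \<open>t \<in> I\<close>, of x] has_derivative_unique by blast
    then show ?thesis by (simp add: matrix_eq fun_eq_iff)
  qed
  then show "Zn_periodic (\<lambda>x. ddw x t)" by (auto simp: Zn_periodic_def)
qed

lemma radon_measures_space: "M \<in> radon_measures S \<Longrightarrow> space M = S"
  unfolding radon_measures_def using sets_eq_imp_space_eq[of M "restrict_space borel S"]
  by (auto simp: space_restrict_space)

lemma radon_measures_measurable:
  assumes "M \<in> radon_measures S" "continuous_on S f"
  shows "f \<in> borel_measurable M"
proof -
  have "f \<in> borel_measurable (restrict_space borel S)"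
    by (rule borel_measurable_continuous_on_restrict[OF assms(2)])
  then show ?thesis using assms(1) measurable_cong_sets unfolding radon_measures_def by blast
qed

lemma radon_measures_integrable:
  fixes f :: "'a::topological_space \<Rightarrow> 'b::{banach, second_countable_topology}"
  assumes M: "M \<in> radon_measures S" "continuous_on S f" "\<And>x. x \<in> S \<Longrightarrow> norm (f x) \<le> B"
  shows "integrable M f"
proof -
  interpret finite_measure M using M(1) by (simp add: radon_measures_def)
  show ?thesis
    using M(3) radon_measures_space[OF M(1)]
    by (intro integrable_const_bound[of _ B] radon_measures_measurable[OF M(1,2)]) auto
qed

lemma C1_on_add:
  assumes "C1_on f S" "C1_on g S" shows "C1_on (\<lambda>x. f x + g x) S"
proof -
  obtain f' g' where *: "\<And>x. x \<in> S \<Longrightarrow> (f has_derivative blinfun_apply (f' x)) (at x within S)" "continuous_on S f'"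
    "\<And>x. x \<in> S \<Longrightarrow> (g has_derivative blinfun_apply (g' x)) (at x within S)" "continuous_on S g'"
    using assms unfolding C1_on_def by blast
  show ?thesis unfolding C1_on_def
  proof (intro exI conjI ballI)
    show "((\<lambda>x. f x + g x) has_derivative blinfun_apply (f' x + g' x)) (at x within S)" if "x \<in> S" for x
      by (rule has_derivative_eq_rhs[OF has_derivative_add[OF *(1,3)[OF that]]])
         (simp add: fun_eq_iff blinfun.bilinear_simps)
  qed (use * in \<open>auto intro!: continuous_intros\<close>)
qed

lemma C1_on_bounded_linear:
  assumes f: "C1_on f S" and L: "bounded_linear L"
  shows "C1_on (\<lambda>x. L (f x)) S"
proof -
  obtain f' where *: "\<And>x. x \<in> S \<Longrightarrow> (f has_derivative blinfun_apply (f' x)) (at x within S)" "continuous_on S f'"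
    using assms unfolding C1_on_def by blast
  show ?thesis unfolding C1_on_def
  proof (intro exI conjI ballI)
    show "((\<lambda>x. L (f x)) has_derivative blinfun_apply (Blinfun L o\<^sub>L f' x)) (at x within S)" if "x \<in> S" for x
      using bounded_linear.has_derivative[OF L *(1)[OF that]]
      by (simp add: blinfun_compose.rep_eq bounded_linear_Blinfun_apply[OF L] o_def)
    show "continuous_on S (\<lambda>x. Blinfun L o\<^sub>L f' x)"
      by (intro bounded_bilinear.continuous_on[OF bounded_bilinear_blinfun_compose] continuous_intros *(2))
  qed
qed

text \<open>
  Joint differentiability follows from continuous partial derivatives; the derivative is assembled from
  the two partials as a bounded linear map so that its continuity can be read off.
\<close>

lemma C1_on_partials:
  fixes f :: "'a::real_normed_vector \<Rightarrow> real \<Rightarrow> 'b::real_normed_vector"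
  assumes fx: "\<And>x t. t \<in> J \<Longrightarrow> ((\<lambda>x. f x t) has_derivative blinfun_apply (fx x t)) (at x)"
    and ft: "\<And>x t. t \<in> J \<Longrightarrow> (f x has_vector_derivative ft x t) (at t)"
    and cont: "continuous_on (UNIV \<times> J) (\<lambda>(x, t). fx x t)" "continuous_on (UNIV \<times> J) (\<lambda>(x, t). ft x t)"
    and "convex J"
  shows "\<And>x t. t \<in> J \<Longrightarrow> ((\<lambda>(x, t). f x t) has_derivative (\<lambda>(h, k). fx x t h + k *\<^sub>R ft x t)) (at (x, t) within UNIV \<times> J)"
    and "C1_on (\<lambda>(x, t). f x t) (UNIV \<times> J)"
proof -
  have cft: "continuous_on (UNIV \<times> J) (\<lambda>(x, t). blinfun_scaleR_left (ft x t))"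
    using bounded_linear.continuous_on[OF bounded_linear_blinfun_scaleR_left cont(2)] by (simp add: split_beta)
  show D: "((\<lambda>(x, t). f x t) has_derivative (\<lambda>(h, k). fx x t h + k *\<^sub>R ft x t)) (at (x, t) within UNIV \<times> J)"
    if "t \<in> J" for x t
  proof -
    have "((\<lambda>(x, t). f x t) has_derivative (\<lambda>(h, k). fx x t h + blinfun_scaleR_left (ft x t) k)) (at (x, t) within UNIV \<times> J)"
    proof (rule has_derivative_partialsI)
      show "((\<lambda>y. f x y) has_derivative blinfun_apply (blinfun_scaleR_left (ft x y))) (at y within J)" if "y \<in> J" for x y
        using ft[OF that, of x] by (simp add: has_vector_derivative_def has_derivative_at_withinI)
      show "continuous (at (x, t) within UNIV \<times> J) (\<lambda>(x, y). blinfun_scaleR_left (ft x y))"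
        using cft \<open>t \<in> J\<close> by (auto simp: continuous_on_eq_continuous_within)
    qed (use fx that \<open>convex J\<close> in auto)
    then show ?thesis by simp
  qed
  show "C1_on (\<lambda>(x, t). f x t) (UNIV \<times> J)"
    unfolding C1_on_def
  proof (intro exI conjI ballI)
    let ?f' = "\<lambda>p. (fx (fst p) (snd p) o\<^sub>L fst_blinfun) + (blinfun_scaleR_left (ft (fst p) (snd p)) o\<^sub>L snd_blinfun)"
    show "((\<lambda>(x, t). f x t) has_derivative blinfun_apply (?f' p)) (at p within UNIV \<times> J)" if "p \<in> UNIV \<times> J" for p
    proof -
      have "blinfun_apply (?f' p) = (\<lambda>(h, k). fx (fst p) (snd p) h + k *\<^sub>R ft (fst p) (snd p))"
        by (auto simp: fun_eq_iff blinfun.bilinear_simps)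
      then show ?thesis using D[of "snd p" "fst p"] that by auto
    qed
    show "continuous_on (UNIV \<times> J) ?f'"
      using cont cft unfolding split_beta
      by (intro continuous_intros bounded_bilinear.continuous_on[OF bounded_bilinear_blinfun_compose])
  qed
qed

lemma C2_on_gradient:
  fixes f :: "'a::real_inner \<Rightarrow> real"
  assumes "\<And>x. x \<in> S \<Longrightarrow> (f has_derivative (\<lambda>h. G x \<bullet> h)) (at x within S)" "C1_on G S"
  shows "C2_on f S"
  unfolding C2_on_def
  using assms C1_on_bounded_linear[OF assms(2) bounded_linear_blinfun_inner_right]
  by (intro exI[of _ "\<lambda>x. blinfun_inner_right (G x)"]) simp

lemma has_derivative_grad:
  fixes f :: "real^'n \<Rightarrow> real"
  assumes "(f has_derivative f') (at x)"
  shows "(f has_derivative (\<lambda>h. grad f x \<bullet> h)) (at x)"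
proof -
  interpret f': bounded_linear f' using assms by (rule has_derivative_bounded_linear)
  have "f' h = grad f x \<bullet> h" for h
  proof -
    have "f' h = f' (\<Sum>i\<in>UNIV. h $ i *\<^sub>R axis i 1)"
      using basis_expansion[of h] by (simp add: scalar_mult_eq_scaleR)
    also have "\<dots> = grad f x \<bullet> h"
      unfolding grad_def frechet_derivative_at[OF assms, symmetric]
      by (simp add: f'.sum f'.scaleR inner_vec_def mult.commute)
    finally show ?thesis .
  qed
  then have "f' = (\<lambda>h. grad f x \<bullet> h)" by auto
  then show ?thesis using assms by simp
qed

section \<open>The Hamiltonian and its Legendre transform\<close>

lemma
  fixes H :: "real^'n \<Rightarrow> real^'n \<Rightarrow> real"
  assumes H: "C2_on (\<lambda>(x, p). H x p) UNIV"
  shows C2_on_hamiltonian_continuous: "continuous_on UNIV (\<lambda>(x, p). H x p)"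
    and C2_on_hamiltonian_deriv: "(H x has_derivative (\<lambda>h. grad (H x) p \<bullet> h)) (at p)"
    and C2_on_hamiltonian_grad_continuous: "continuous_on UNIV (\<lambda>(x, p). grad (H x) p)"
proof -
  obtain f' where f': "\<And>q. ((\<lambda>(x, p). H x p) has_derivative blinfun_apply (f' q)) (at q)" and "C1_on f' UNIV"
    using H unfolding C2_on_def by auto
  then obtain g where "\<And>x. (f' has_derivative blinfun_apply (g x)) (at x within UNIV)"
    unfolding C1_on_def by blast
  then have cf': "continuous_on UNIV f'" by (rule has_derivative_continuous_on)
  show "continuous_on UNIV (\<lambda>(x, p). H x p)"
    using f' by (auto intro!: has_derivative_continuous_on)
  have D: "(H x has_derivative (\<lambda>h. blinfun_apply (f' (x, p)) (0, h))) (at p)" for x p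
  proof -
    have "((\<lambda>p. (x, p)) has_derivative (\<lambda>h. (0, h))) (at p)" by (auto intro!: derivative_eq_intros)
    from has_derivative_compose[OF this f'] show ?thesis by simp
  qed
  then show "(H x has_derivative (\<lambda>h. grad (H x) p \<bullet> h)) (at p)" by (rule has_derivative_grad)
  have "grad (H x) p = (\<chi> i. blinfun_apply (f' (x, p)) (0, axis i 1))" for x p
    unfolding grad_def frechet_derivative_at[OF D, symmetric] ..
  then show "continuous_on UNIV (\<lambda>(x, p). grad (H x) p)"
    unfolding split_beta by (auto intro!: continuous_intros cf')
qed

text \<open>
  Restricting to the segment from \<open>p\<close> to \<open>q\<close> reduces this to convex functions on the line.
\<close>

lemma convex_on_above_tangent:
  fixes f :: "'a::real_normed_vector \<Rightarrow> real"
  assumes f: "convex_on UNIV f" and D: "(f has_derivative D) (at p)"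
  shows "f p + D (q - p) \<le> f q"
proof -
  define k where "k s = f (p + s *\<^sub>R (q - p))" for s :: real
  have "convex_on UNIV k"
  proof (rule convex_onI)
    fix t x y :: real assume t: "0 < t" "t < 1"
    have "p + ((1 - t) *\<^sub>R x + t *\<^sub>R y) *\<^sub>R (q - p) = (1 - t) *\<^sub>R (p + x *\<^sub>R (q - p)) + t *\<^sub>R (p + y *\<^sub>R (q - p))"
      by (simp add: algebra_simps)
    then show "k ((1 - t) *\<^sub>R x + t *\<^sub>R y) \<le> (1 - t) * k x + t * k y"
      unfolding k_def using convex_onD[OF f, of t "p + x *\<^sub>R (q - p)" "p + y *\<^sub>R (q - p)"] t by simp
  qed simp
  moreover have "(k has_field_derivative D (q - p)) (at 0 within UNIV)"
  proof -
    interpret D: bounded_linear D using D by (rule has_derivative_bounded_linear)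
    have 1: "((\<lambda>s. p + s *\<^sub>R (q - p)) has_derivative (\<lambda>h. h *\<^sub>R (q - p))) (at 0)"
      by (auto intro!: derivative_eq_intros)
    have 2: "(f has_derivative D) (at (p + 0 *\<^sub>R (q - p)))" using D by simp
    from has_derivative_compose[OF 1 2] show ?thesis
      unfolding k_def by (intro has_derivative_imp_has_field_derivative) (auto simp: D.scaleR)
  qed
  ultimately have "k 1 - k 0 \<ge> D (q - p) * (1 - 0)"
    by (intro convex_on_imp_above_tangent[of UNIV]) auto
  then show ?thesis by (simp add: k_def)
qed

lemma legendre_ge: "ereal (v \<bullet> p - H x p) \<le> legendre H x v"
  unfolding legendre_def by (rule SUP_upper) simp

text \<open>
  For convex \<open>H x\<close> the concave function \<open>q \<mapsto> v \<bullet> q - H x q\<close> with \<open>v = grad (H x) p\<close> has a critical point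
  at \<open>p\<close>, which is therefore a maximum.
\<close>

lemma legendre_grad:
  assumes "convex_on UNIV (H x)" "(H x has_derivative (\<lambda>h. grad (H x) p \<bullet> h)) (at p)"
  shows "legendre H x (grad (H x) p) = ereal (grad (H x) p \<bullet> p - H x p)"
proof (rule antisym)
  show "legendre H x (grad (H x) p) \<le> ereal (grad (H x) p \<bullet> p - H x p)"
    unfolding legendre_def
  proof (intro SUP_least)
    fix q
    have "H x p + grad (H x) p \<bullet> (q - p) \<le> H x q" by (rule convex_on_above_tangent[OF assms])
    then show "ereal (grad (H x) p \<bullet> q - H x q) \<le> ereal (grad (H x) p \<bullet> p - H x p)"
      by (simp add: inner_diff_right)
  qed
qed (rule legendre_ge)

text \<open>
  The supremum over a dense sequence equals the supremum over all momenta, by continuity of \<open>H\<close>.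
  Partial maxima of the sequence are continuous and increase to the possibly infinite limit.
\<close>

lemma legendre_approx:
  fixes H :: "real^'n \<Rightarrow> real^'n \<Rightarrow> real"
  assumes cH: "continuous_on UNIV (\<lambda>(x, p). H x p)" and pH: "\<And>p. Zn_periodic (\<lambda>x. H x p)"
  obtains f where "\<And>m. continuous_on UNIV (\<lambda>(x, v). f m x v)" "\<And>m v. Zn_periodic (\<lambda>x. f m x v)"
    "\<And>m x v. f m x v \<le> f (Suc m) x v" "\<And>x v. (\<lambda>m. ereal (f m x v)) \<longlonglongrightarrow> legendre H x v"
proof -
  obtain D :: "(real^'n) set" where D: "countable D" "\<And>X. open X \<Longrightarrow> X \<noteq> {} \<Longrightarrow> \<exists>d\<in>D. d \<in> X"
    using countable_dense_setE by blast
  then have "D \<noteq> {}" using open_UNIV by blast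
  define p where "p = from_nat_into D"
  define f where "f m x v = (MAX j\<in>{..m}. v \<bullet> p j - H x (p j))" for m :: nat and x v
  have f_Suc: "f (Suc m) x v = max (v \<bullet> p (Suc m) - H x (p (Suc m))) (f m x v)" for m x v
    unfolding f_def atMost_Suc by (simp add: Max_insert)
  have cHp: "continuous_on UNIV (\<lambda>(x, v :: real^'n). v \<bullet> q - H x q)" for q
  proof -
    have "continuous_on UNIV (\<lambda>q'. (\<lambda>(x, p). H x p) (fst q', q))"
      by (rule continuous_on_compose2[OF cH]) (auto intro!: continuous_intros)
    then show ?thesis unfolding split_beta by (auto intro!: continuous_intros)
  qed
  have cf: "continuous_on UNIV (\<lambda>(x, v). f m x v)" for m
  proof (induction m)
    case 0
    show ?case using cHp by (simp add: f_def)
  next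
    case (Suc m)
    then show ?case unfolding f_Suc split_beta
      using cHp[of "p (Suc m)"] by (intro continuous_on_max) (auto simp: split_beta)
  qed
  have pf: "Zn_periodic (\<lambda>x. f m x v)" for m v
    using pH by (simp add: f_def Zn_periodic_def)
  have mono: "f m x v \<le> f (Suc m) x v" for m x v by (simp add: f_Suc)
  have ub: "ereal (f m x v) \<le> legendre H x v" for m x v
  proof -
    have "f m x v \<in> (\<lambda>j. v \<bullet> p j - H x (p j)) ` {..m}" unfolding f_def by (intro Max_in) auto
    then show ?thesis using legendre_ge by fastforce
  qed
  have "legendre H x v \<le> (SUP m. ereal (f m x v))" for x v
    unfolding legendre_def
  proof (rule SUP_least, rule ereal_le_epsilon2)
    fix q :: "real^'n" and e :: real assume "e > 0"
    have "continuous_on UNIV (\<lambda>q. (\<lambda>(x, p). H x p) (x, q))"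
      by (rule continuous_on_compose2[OF cH]) (auto intro!: continuous_intros)
    then have "continuous_on UNIV (\<lambda>q. v \<bullet> q - H x q)" by (auto intro!: continuous_intros)
    then have "open ((\<lambda>q. v \<bullet> q - H x q) -` {v \<bullet> q - H x q - e <..})"
      by (intro open_vimage) auto
    then obtain d where d: "d \<in> D" "v \<bullet> q - H x q - e < v \<bullet> d - H x d"
      using D(2) \<open>e > 0\<close> by (metis (no_types, lifting) diff_strict_left_mono empty_iff greaterThan_iff
        vimageI diff_zero vimage_eq)
    obtain j where "d = p j" using from_nat_into_surj[OF D(1) d(1)] by (auto simp: p_def)
    then have "v \<bullet> d - H x d \<le> f j x v" unfolding f_def by (intro Max_ge) auto
    then have "ereal (v \<bullet> q - H x q) \<le> ereal (f j x v) + ereal e" using d by simp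
    also have "\<dots> \<le> (SUP m. ereal (f m x v)) + ereal e"
      by (intro add_right_mono SUP_upper) simp
    finally show "ereal (v \<bullet> q - H x q) \<le> (SUP m. ereal (f m x v)) + ereal e" .
  qed
  then have "(SUP m. ereal (f m x v)) = legendre H x v" for x v
    using ub by (intro antisym SUP_least) auto
  moreover have "incseq (\<lambda>m. ereal (f m x v))" for x v using mono by (intro incseq_SucI) auto
  ultimately have "(\<lambda>m. ereal (f m x v)) \<longlonglongrightarrow> legendre H x v" for x v
    using LIMSEQ_SUP by metis
  with cf pf mono show ?thesis using that by blast
qed

lemma ereal_integral_real:
  assumes "integrable M f"
  shows "ereal_integral M (\<lambda>x. ereal (f x)) = ereal (integral\<^sup>L M f)"
    "(\<integral>\<^sup>+ x. ennreal (f x) \<partial>M) < \<infinity>" "(\<integral>\<^sup>+ x. ennreal (- f x) \<partial>M) < \<infinity>"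
proof -
  show fin: "(\<integral>\<^sup>+ x. ennreal (f x) \<partial>M) < \<infinity>" "(\<integral>\<^sup>+ x. ennreal (- f x) \<partial>M) < \<infinity>"
    using assms by (auto simp: real_integrable_def less_top)
  have e: "e2ennreal (ereal r) = ennreal r" for r by (simp add: ennreal.abs_eq)
  have x: "enn2ereal y = ereal (enn2real y)" if "y < \<infinity>" for y
    using that by (cases y) (auto simp: enn2ereal_ennreal)
  show "ereal_integral M (\<lambda>x. ereal (f x)) = ereal (integral\<^sup>L M f)"
    unfolding ereal_integral_def real_lebesgue_integral_def[OF assms]
    using x[OF fin(1)] x[OF fin(2)] by (simp add: e)
qed

lemma ereal_integral_mono_real:
  assumes "integrable M f" "\<And>x. x \<in> space M \<Longrightarrow> ereal (f x) \<le> F x"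
  shows "ereal (integral\<^sup>L M f) \<le> ereal_integral M F"
proof -
  have "- F x \<le> - ereal (f x)" if "x \<in> space M" for x
    using assms(2)[OF that] by (simp only: ereal_minus_le_minus)
  then show ?thesis
    unfolding ereal_integral_real(1)[OF assms(1), symmetric] ereal_integral_def
    using assms(2)
    by (intro ereal_minus_mono less_eq_ennreal.rep_eq[THEN iffD1] nn_integral_mono e2ennreal_mono) auto
qed

text \<open>
  Monotone convergence for the positive parts and for the negative parts, whose integrals are finite
  from the start. The difference of the two limits is never \<open>\<infinity> - \<infinity>\<close>, so it is the limit of the
  differences.
\<close>

lemma ereal_integral_monotone_limit:
  fixes f :: "nat \<Rightarrow> 'a \<Rightarrow> real"
  assumes f: "\<And>m. integrable M (f m)" and mono: "\<And>m x. x \<in> space M \<Longrightarrow> f m x \<le> f (Suc m) x"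
    and lim: "\<And>x. x \<in> space M \<Longrightarrow> (\<lambda>m. ereal (f m x)) \<longlonglongrightarrow> F x"
    and V: "(\<lambda>m. integral\<^sup>L M (f m)) \<longlonglongrightarrow> V"
  shows "ereal_integral M F = ereal V"
proof -
  have e: "e2ennreal (ereal r) = ennreal r" for r by (simp add: ennreal.abs_eq)
  have inc: "incseq (\<lambda>m. f m x)" if "x \<in> space M" for x using mono[OF that] by (rule incseq_SucI)
  have [measurable]: "f m \<in> borel_measurable M" for m using f by auto
  have SUP: "(SUP m. ennreal (f m x)) = e2ennreal (F x)" if "x \<in> space M" for x
  proof (rule LIMSEQ_unique[OF LIMSEQ_SUP])
    show "incseq (\<lambda>m. ennreal (f m x))" using inc[OF that] by (auto simp: mono_def intro!: ennreal_leI)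
    have "(\<lambda>m. e2ennreal (ereal (f m x))) \<longlonglongrightarrow> e2ennreal (F x)"
      using lim[OF that] by (rule isCont_tendsto_compose[OF continuous_at_e2ennreal])
    then show "(\<lambda>m. ennreal (f m x)) \<longlonglongrightarrow> e2ennreal (F x)" by (simp add: e)
  qed
  have INF: "(INF m. ennreal (- f m x)) = e2ennreal (- F x)" if "x \<in> space M" for x
  proof (rule LIMSEQ_unique[OF LIMSEQ_INF])
    show "decseq (\<lambda>m. ennreal (- f m x))" using inc[OF that] by (auto simp: mono_def antimono_def intro!: ennreal_leI)
    have "(\<lambda>m. e2ennreal (- ereal (f m x))) \<longlonglongrightarrow> e2ennreal (- F x)"
      using lim[OF that] by (intro isCont_tendsto_compose[OF continuous_at_e2ennreal] tendsto_uminus_ereal)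
    then show "(\<lambda>m. ennreal (- f m x)) \<longlonglongrightarrow> e2ennreal (- F x)" by (simp add: e)
  qed
  have "(\<integral>\<^sup>+ x. e2ennreal (F x) \<partial>M) = (\<integral>\<^sup>+ x. (SUP m. ennreal (f m x)) \<partial>M)"
    by (intro nn_integral_cong) (simp add: SUP)
  also have "\<dots> = (SUP m. (\<integral>\<^sup>+ x. ennreal (f m x) \<partial>M))"
    using mono by (intro nn_integral_monotone_convergence_SUP_AE) (auto intro!: AE_I2 ennreal_leI)
  finally have P: "(\<integral>\<^sup>+ x. e2ennreal (F x) \<partial>M) = (SUP m. (\<integral>\<^sup>+ x. ennreal (f m x) \<partial>M))" .
  have "(\<integral>\<^sup>+ x. e2ennreal (- F x) \<partial>M) = (\<integral>\<^sup>+ x. (INF m. ennreal (- f m x)) \<partial>M)"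
    by (intro nn_integral_cong) (simp add: INF)
  also have "\<dots> = (INF m. (\<integral>\<^sup>+ x. ennreal (- f m x) \<partial>M))"
    using mono ereal_integral_real(3)[OF f]
    by (intro nn_integral_monotone_convergence_INF_AE') (auto intro!: AE_I2 ennreal_leI)
  finally have N: "(\<integral>\<^sup>+ x. e2ennreal (- F x) \<partial>M) = (INF m. (\<integral>\<^sup>+ x. ennreal (- f m x) \<partial>M))" .
  have "(\<lambda>m. enn2ereal (\<integral>\<^sup>+ x. ennreal (f m x) \<partial>M) - enn2ereal (\<integral>\<^sup>+ x. ennreal (- f m x) \<partial>M))
     \<longlonglongrightarrow> enn2ereal (\<integral>\<^sup>+ x. e2ennreal (F x) \<partial>M) - enn2ereal (\<integral>\<^sup>+ x. e2ennreal (- F x) \<partial>M)"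
  proof (rule tendsto_diff_ereal_general)
    show "(\<lambda>m. enn2ereal (\<integral>\<^sup>+ x. ennreal (f m x) \<partial>M)) \<longlonglongrightarrow> enn2ereal (\<integral>\<^sup>+ x. e2ennreal (F x) \<partial>M)"
      unfolding P using mono
      by (intro isCont_tendsto_compose[OF continuous_at_enn2ereal] LIMSEQ_SUP incseq_SucI nn_integral_mono ennreal_leI)
    show "(\<lambda>m. enn2ereal (\<integral>\<^sup>+ x. ennreal (- f m x) \<partial>M)) \<longlonglongrightarrow> enn2ereal (\<integral>\<^sup>+ x. e2ennreal (- F x) \<partial>M)"
      unfolding N using mono
      by (intro isCont_tendsto_compose[OF continuous_at_enn2ereal] LIMSEQ_INF decseq_SucI nn_integral_mono ennreal_leI) auto
    have "(\<integral>\<^sup>+ x. e2ennreal (- F x) \<partial>M) \<le> (\<integral>\<^sup>+ x. ennreal (- f 0 x) \<partial>M)"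
      unfolding N by (rule INF_lower) simp
    also have "\<dots> < \<infinity>" by (rule ereal_integral_real(3)[OF f])
    finally have "enn2ereal (\<integral>\<^sup>+ x. e2ennreal (- F x) \<partial>M) \<noteq> \<infinity>"
      by (metis enn2ereal_eq_top_iff infinity_ennreal_def less_irrefl)
    then show "\<not> (enn2ereal (\<integral>\<^sup>+ x. e2ennreal (F x) \<partial>M) = \<infinity> \<and> enn2ereal (\<integral>\<^sup>+ x. e2ennreal (- F x) \<partial>M) = \<infinity> \<or>
       enn2ereal (\<integral>\<^sup>+ x. e2ennreal (F x) \<partial>M) = - \<infinity> \<and> enn2ereal (\<integral>\<^sup>+ x. e2ennreal (- F x) \<partial>M) = - \<infinity>)"
      using enn2ereal_nonneg by auto
  qed
  moreover have "enn2ereal (\<integral>\<^sup>+ x. ennreal (f m x) \<partial>M) - enn2ereal (\<integral>\<^sup>+ x. ennreal (- f m x) \<partial>M) = ereal (integral\<^sup>L M (f m))" for m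
    using ereal_integral_real(1)[OF f] unfolding ereal_integral_def by (simp add: e)
  ultimately have "(\<lambda>m. ereal (integral\<^sup>L M (f m))) \<longlonglongrightarrow> ereal_integral M F"
    unfolding ereal_integral_def by simp
  moreover have "(\<lambda>m. ereal (integral\<^sup>L M (f m))) \<longlonglongrightarrow> ereal V" using V by simp
  ultimately show ?thesis by (rule LIMSEQ_unique)
qed

section \<open>The vanishing viscosity limit\<close>

text \<open>
  Taylor expansion of the even function \<open>r \<mapsto> w(x + r e\<^sub>i) + w(x - r e\<^sub>i)\<close> to second order: its first
  derivative vanishes at 0. The exact mean value form serves both for pointwise limits and for uniform
  bounds of second difference quotients.
\<close>

lemma second_difference:
  fixes w :: "real^'n \<Rightarrow> real \<Rightarrow> real"
  assumes C: "C21_with I w wt dw ddw" and t: "t \<in> I" and r: "0 < r"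
  obtains s where "0 < s" "s < r"
    "w (x + r *\<^sub>R axis i 1) t + w (x - r *\<^sub>R axis i 1) t - 2 * w x t
      = r\<^sup>2 / 2 * (ddw (x + s *\<^sub>R axis i 1) t $ i $ i + ddw (x - s *\<^sub>R axis i 1) t $ i $ i)"
proof -
  let ?e = "axis i 1 :: real^'n"
  have 1: "((\<lambda>r. w (x + (c * r) *\<^sub>R ?e) t) has_real_derivative c * dw (x + (c * r) *\<^sub>R ?e) t $ i) (at r)" for c r
  proof -
    have "((\<lambda>r. x + (c * r) *\<^sub>R ?e) has_derivative (\<lambda>h. (c * h) *\<^sub>R ?e)) (at r)"
      by (auto intro!: derivative_eq_intros)
    from has_derivative_compose[OF this C21_withD(2)[OF C t]]
    show ?thesis by (rule has_derivative_imp_has_field_derivative) (simp add: inner_axis mult_ac)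
  qed
  have 2: "((\<lambda>r. dw (x + (c * r) *\<^sub>R ?e) t $ i) has_real_derivative c * ddw (x + (c * r) *\<^sub>R ?e) t $ i $ i) (at r)" for c r
  proof -
    have "((\<lambda>r. x + (c * r) *\<^sub>R ?e) has_derivative (\<lambda>h. (c * h) *\<^sub>R ?e)) (at r)"
      by (auto intro!: derivative_eq_intros)
    from bounded_linear.has_derivative[OF bounded_linear_vec_nth has_derivative_compose[OF this C21_withD(3)[OF C t]], of i]
    show ?thesis
      by (rule has_derivative_imp_has_field_derivative)
         (simp add: matrix_vector_mult_scaleR matrix_vector_mult_axis mult_ac)
  qed
  \<comment> \<open>The even function and its first two derivatives, in the form that Maclaurin expansion expects.\<close>
  define D where "D m r = (if m = 0 then w (x + r *\<^sub>R ?e) t + w (x - r *\<^sub>R ?e) t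
     else if m = 1 then dw (x + r *\<^sub>R ?e) t $ i - dw (x - r *\<^sub>R ?e) t $ i
     else ddw (x + r *\<^sub>R ?e) t $ i $ i + ddw (x - r *\<^sub>R ?e) t $ i $ i)" for m :: nat and r
  have "(D m has_real_derivative D (Suc m) s) (at s)" if "m < 2" for m s
  proof (cases "m = 0")
    case True
    show ?thesis using DERIV_add[OF 1[of 1 s] 1[of "-1" s]] by (simp add: D_def[abs_def] True)
  next
    case False
    then have "m = 1" using that by simp
    then show ?thesis using DERIV_diff[OF 2[of 1 s] 2[of "-1" s]] by (simp add: D_def[abs_def])
  qed
  then obtain s where "0 < s" "s < r" "D 0 r = (\<Sum>m<2. D m 0 / fact m * r ^ m) + D 2 s / fact 2 * r ^ 2"
    using Maclaurin[of r 2 D "D 0"] r by auto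
  then show ?thesis
    by (intro that[of s]) (simp_all add: D_def numeral_2_eq_2 field_simps)
qed

lemma second_derivative_le:
  fixes w :: "real^'n \<Rightarrow> real \<Rightarrow> real"
  assumes C: "C21_with I w wt dw ddw" and t: "t \<in> I"
    and le: "\<And>r. 0 < r \<Longrightarrow> w (x + r *\<^sub>R axis i 1) t + w (x - r *\<^sub>R axis i 1) t - 2 * w x t \<le> K * r\<^sup>2"
  shows "ddw x t $ i $ i \<le> K"
proof (rule ccontr)
  assume "\<not> ?thesis"
  moreover have "continuous_on UNIV (\<lambda>y. ddw y t $ i $ i)"
    using t by (intro continuous_intros continuous_on_compose2[OF C21_with_cont(3)[OF C, unfolded split_beta], of _ "\<lambda>y. (y, t)", simplified]) auto
  ultimately have "\<forall>\<^sub>F y in at x. K < ddw y t $ i $ i"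
    by (intro order_tendstoD) (auto simp: continuous_on)
  then obtain d where d: "d > 0" "\<And>y. y \<noteq> x \<Longrightarrow> dist y x < d \<Longrightarrow> K < ddw y t $ i $ i"
    unfolding eventually_at by blast
  obtain s where s: "0 < s" "s < d"
    "w (x + d *\<^sub>R axis i 1) t + w (x - d *\<^sub>R axis i 1) t - 2 * w x t
      = d\<^sup>2 / 2 * (ddw (x + s *\<^sub>R axis i 1) t $ i $ i + ddw (x - s *\<^sub>R axis i 1) t $ i $ i)"
    using second_difference[OF C t \<open>d > 0\<close>] .
  have "K < ddw (x + s *\<^sub>R axis i 1) t $ i $ i" "K < ddw (x - s *\<^sub>R axis i 1) t $ i $ i"
    using s by (auto intro!: d(2) simp: dist_norm axis_eq_0_iff)
  then have "d\<^sup>2 / 2 * (K + K) < d\<^sup>2 / 2 * (ddw (x + s *\<^sub>R axis i 1) t $ i $ i + ddw (x - s *\<^sub>R axis i 1) t $ i $ i)"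
    using \<open>d > 0\<close> by (intro mult_strict_left_mono) auto
  then show False using le[OF \<open>d > 0\<close>] s(3) by (simp add: mult.commute)
qed

lemma viscous_lipschitz:
  fixes w :: "real^'n \<Rightarrow> real \<Rightarrow> real"
  assumes w: "CT {0..} w" and C: "C21_with {0<..} w wt dw ddw"
    and bd: "\<And>x t. t > 0 \<Longrightarrow> \<bar>wt x t\<bar> \<le> C" "\<And>x t. t > 0 \<Longrightarrow> norm (dw x t) \<le> C"
  shows "0 \<le> s \<Longrightarrow> s \<le> t \<Longrightarrow> \<bar>w x t - w x s\<bar> \<le> C * (t - s)"
    "0 \<le> t \<Longrightarrow> \<bar>w x t - w y t\<bar> \<le> C * norm (x - y)"
proof -
  have cw: "continuous_on (UNIV \<times> {0..}) (\<lambda>(x, t). w x t)" using w by (simp add: CT_def)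
  have ct: "continuous_on {0..} (w x)" for x
  proof -
    have "continuous_on {0..} (\<lambda>t. (\<lambda>(x, t). w x t) (x, t))"
      by (rule continuous_on_compose2[OF cw]) (auto intro!: continuous_intros)
    then show ?thesis by simp
  qed
  show *: "\<bar>w x t - w x s\<bar> \<le> C * (t - s)" if st: "0 \<le> s" "s \<le> t" for s t x
  proof (cases "s = t")
    case False
    then have "s < t" using st by simp
    moreover have "continuous_on {s..t} (w x)" by (rule continuous_on_subset[OF ct]) (use st in auto)
    moreover have "(w x has_real_derivative wt x r) (at r)" if "s < r" for r
      using C21_withD(1)[OF C] that st by auto
    ultimately obtain r where "s < r" "r < t" "w x t - w x s = wt x r * (t - s)"
      using mvt[of s t "w x" "\<lambda>r h. wt x r * h"] by (auto simp: has_field_derivative_def)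
    then show ?thesis using bd(1)[of r x] st by (simp add: abs_mult mult_right_mono)
  qed simp
  have **: "\<bar>w x t - w y t\<bar> \<le> C * norm (x - y)" if "0 < t" for t x y
  proof -
    have "norm (w x t - w y t) \<le> C * norm (x - y)"
    proof (rule differentiable_bound[of UNIV "\<lambda>x. w x t" "\<lambda>x h. dw x t \<bullet> h"])
      show "onorm ((\<bullet>) (dw x t)) \<le> C" for x
      proof (rule onorm_bound)
        show "norm (dw x t \<bullet> h) \<le> C * norm h" for h
          using Cauchy_Schwarz_ineq2[of "dw x t" h] bd(2)[OF that, of x]
          by (simp add: order_trans[OF _ mult_right_mono])
        show "0 \<le> C" using bd(2)[OF that, of x] norm_ge_zero order_trans by blast
      qed
    qed (use C21_withD(2)[OF C] that in auto)
    then show ?thesis by simp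
  qed
  show "\<bar>w x t - w y t\<bar> \<le> C * norm (x - y)" if t: "0 \<le> t"
  proof (rule tendsto_upperbound[where F="at_right t"])
    have "((w x) \<longlongrightarrow> w x t) (at_right t)" for x
    proof (rule tendsto_within_subset)
      show "(w x \<longlongrightarrow> w x t) (at t within {0..})" using ct[of x] t by (auto simp: continuous_on)
    qed (use t in auto)
    then show "((\<lambda>s. \<bar>w x s - w y s\<bar>) \<longlongrightarrow> \<bar>w x t - w y t\<bar>) (at_right t)"
      by (intro tendsto_intros)
    show "\<forall>\<^sub>F s in at_right t. \<bar>w x s - w y s\<bar> \<le> C * norm (x - y)"
      using ** t by (auto simp: eventually_at_right_field intro!: exI[of _ "t + 1"])
  qed auto
qed

lemma C1_on_quadratic:
  assumes "\<delta> > 0" shows "C1_on (\<lambda>(y::real^'n, s::real). - ((norm (y - x0))\<^sup>2 + (s - t0)\<^sup>2) / (2 * \<delta>)) S"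
proof -
  have eq: "(\<lambda>(y::real^'n, s::real). - ((norm (y - x0))\<^sup>2 + (s - t0)\<^sup>2) / (2 * \<delta>))
      = (\<lambda>q. (- 1 / (2 * \<delta>)) * ((q - (x0, t0)) \<bullet> (q - (x0, t0))))"
    by (auto simp: fun_eq_iff power2_norm_eq_inner power2_eq_square[of "_ - t0"] diff_divide_distrib add_divide_distrib)
  show ?thesis unfolding C1_on_def eq
  proof (intro exI conjI ballI)
    show "((\<lambda>q. (- 1 / (2 * \<delta>)) * ((q - (x0, t0)) \<bullet> (q - (x0, t0)))) has_derivative
       blinfun_inner_right ((- 1 / \<delta>) *\<^sub>R (q - (x0, t0)))) (at q within S)" for q
      using assms by (auto intro!: derivative_eq_intros simp: inner_commute fun_eq_iff)
    show "continuous_on S (\<lambda>q. blinfun_inner_right ((- 1 / \<delta>) *\<^sub>R (q - (x0, t0))))"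
      by (intro bounded_linear.continuous_on[OF bounded_linear_blinfun_inner_right] continuous_intros)
  qed
qed

text \<open>
  The bounds are required at every point with \<open>t > 0\<close>. For a solution of class \<open>C\<^sup>2\<^sup>,\<^sup>1\<close> they follow from
  bounds almost everywhere, and in this form they apply at the maximum points used below.
\<close>

definition bounded_viscous_solution ::
    "real \<Rightarrow> real \<Rightarrow> (real^'n \<Rightarrow> real^'n \<Rightarrow> real) \<Rightarrow> (real^'n \<Rightarrow> real) \<Rightarrow> (real^'n \<Rightarrow> real \<Rightarrow> real) \<Rightarrow>
      (real^'n \<Rightarrow> real \<Rightarrow> real) \<Rightarrow> (real^'n \<Rightarrow> real \<Rightarrow> real^'n) \<Rightarrow> (real^'n \<Rightarrow> real \<Rightarrow> real^'n^'n) \<Rightarrow> bool" where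
  "bounded_viscous_solution C \<epsilon> H g w wt dw ddw \<longleftrightarrow>
     CT {0..} w \<and> (\<forall>x. w x 0 = g x) \<and> C21_with {0<..} w wt dw ddw \<and>
     (\<forall>x. \<forall>t>0. wt x t + H x (dw x t) = \<epsilon> * (\<Sum>i\<in>UNIV. ddw x t $ i $ i)) \<and>
     (\<forall>x. \<forall>t>0. \<bar>wt x t\<bar> \<le> C \<and> norm (dw x t) \<le> C)"

lemma bounded_viscous_solutionD:
  assumes "bounded_viscous_solution C \<epsilon> H g w wt dw ddw"
  shows "CT {0..} w" "w x 0 = g x" "C21_with {0<..} w wt dw ddw"
    "t > 0 \<Longrightarrow> wt x t + H x (dw x t) = \<epsilon> * (\<Sum>i\<in>UNIV. ddw x t $ i $ i)"
    "t > 0 \<Longrightarrow> \<bar>wt x t\<bar> \<le> C" "t > 0 \<Longrightarrow> norm (dw x t) \<le> C"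
  using assms unfolding bounded_viscous_solution_def by auto

text \<open>
  Doubling of variables. The function
  \<open>\<Phi> = w(x,t) - u(x+q,s) - (\<bar>q\<bar>\<^sup>2 + (t-s)\<^sup>2)/(2\<delta>) - l t\<close> attains its maximum. If \<open>t\<close> and \<open>s\<close> are positive
  there, the classical derivatives of \<open>w\<close> and a quadratic test function for \<open>u\<close> have the same space
  gradient \<open>p\<close>, with \<open>\<bar>p\<bar> \<le> C\<close>. The second differences of the penalty bound \<open>\<epsilon>\<Delta>w\<close> by \<open>\<epsilon>n/\<delta>\<close>, and subtracting
  the two inequalities gives \<open>l \<le> \<epsilon>n/\<delta> + \<bar>H(x+q,p) - H(x,p)\<bar>\<close>, which fails for small \<open>\<delta>\<close> and then
  small \<open>\<epsilon>\<close>. So the maximum lies near time 0, where both functions are close to their common initial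
  value.
\<close>

lemma viscous_le_supersolution:
  fixes H :: "real^'n \<Rightarrow> real^'n \<Rightarrow> real" and u :: "real^'n \<Rightarrow> real \<Rightarrow> real"
  assumes cH: "continuous_on UNIV (\<lambda>(x, p). H x p)" and pH: "\<And>p. Zn_periodic (\<lambda>x. H x p)"
    and u: "CT {0..} u" "viscosity_supersolution H u"
    and "T > 0" "C \<ge> 0" "\<kappa> > 0"
  shows "\<exists>\<epsilon>0>0. \<forall>\<epsilon> w wt dw ddw z. 0 < \<epsilon> \<longrightarrow> \<epsilon> < \<epsilon>0 \<longrightarrow>
    bounded_viscous_solution C \<epsilon> H (\<lambda>x. u x 0) w wt dw ddw \<longrightarrow> w z T - u z T \<le> \<kappa>"
proof -
  define l where "l = \<kappa> / (T + 2)"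
  have "l > 0" using \<open>T > 0\<close> \<open>\<kappa> > 0\<close> by (simp add: l_def)
  have cu: "continuous_on (UNIV \<times> {0..T+1}) (\<lambda>(x, t). u x t)"
    using u(1) unfolding CT_def by (auto elim!: continuous_on_subset)
  have pu: "Zn_periodic (\<lambda>x. u x t)" if "t \<ge> 0" for t
    using u(1) that unfolding CT_def by auto
  obtain Mu where Mu: "0 \<le> Mu" "\<And>x t. t \<in> {0..T+1} \<Longrightarrow> norm (u x t) \<le> Mu"
    using periodic_bounded[OF cu compact_Icc] pu by (metis atLeastAtMost_iff)
  obtain d1 where d1: "d1 > 0" "\<And>x x' t t'. t \<in> {0..T+1} \<Longrightarrow> t' \<in> {0..T+1} \<Longrightarrow> dist x x' < d1 \<Longrightarrow>
      dist t t' < d1 \<Longrightarrow> dist (u x t) (u x' t') < l"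
    using periodic_uniformly_continuous[OF cu compact_Icc _ \<open>l > 0\<close>] pu by (metis atLeastAtMost_iff)
  have cH': "continuous_on (UNIV \<times> cball 0 C) (\<lambda>(x, p). H x p)"
    using cH by (rule continuous_on_subset) auto
  obtain d2 where d2: "d2 > 0" "\<And>x x' p p'. p \<in> cball 0 C \<Longrightarrow> p' \<in> cball 0 C \<Longrightarrow> dist x x' < d2 \<Longrightarrow>
      dist p p' < d2 \<Longrightarrow> dist (H x p) (H x' p') < l / 2"
    using periodic_uniformly_continuous[OF cH' compact_cball pH] \<open>l > 0\<close> by (metis half_gt_zero)
  define \<rho> where "\<rho> = min (min (d1 / 2) (d2 / 2)) (min (1 / 2) (l / (C + 1)))"
  have \<rho>: "\<rho> > 0" "\<rho> < d1" "\<rho> < d2" "\<rho> < 1" "C * \<rho> \<le> l"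
  proof -
    show "\<rho> > 0" "\<rho> < d1" "\<rho> < d2" "\<rho> < 1"
      using d1(1) d2(1) \<open>l > 0\<close> \<open>C \<ge> 0\<close> by (auto simp: \<rho>_def)
    have "C * \<rho> \<le> C * (l / (C + 1))" using \<open>C \<ge> 0\<close> by (intro mult_left_mono) (auto simp: \<rho>_def)
    also have "\<dots> \<le> l" using \<open>C \<ge> 0\<close> \<open>l > 0\<close> by (simp add: field_simps)
    finally show "C * \<rho> \<le> l" .
  qed
  \<comment> \<open>The penalty at distance \<open>\<rho>\<close> exceeds the oscillation \<open>2 Mu\<close> of \<open>u\<close>. So at a maximum both \<open>\<bar>q\<bar>\<close> and
    \<open>\<bar>t - s\<bar>\<close> are below \<open>\<rho>\<close>, and points with \<open>\<bar>q\<bar> > \<rho>\<close> may be discarded.\<close>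
  define \<delta> where "\<delta> = \<rho>\<^sup>2 / (4 * (Mu + 1))"
  have "\<delta> > 0" using \<rho> Mu by (simp add: \<delta>_def)
  have \<rho>2: "\<rho>\<^sup>2 / (2 * \<delta>) = 2 * Mu + 2" using \<rho> Mu by (simp add: \<delta>_def field_simps)
  define \<epsilon>0 where "\<epsilon>0 = l * \<delta> / (2 * CARD('n))"
  have "\<epsilon>0 > 0" using \<open>l > 0\<close> \<open>\<delta> > 0\<close> by (simp add: \<epsilon>0_def)
  moreover have "w z T - u z T \<le> \<kappa>"
    if \<epsilon>: "0 < \<epsilon>" "\<epsilon> < \<epsilon>0" and sol: "bounded_viscous_solution C \<epsilon> H (\<lambda>x. u x 0) w wt dw ddw"
    for \<epsilon> w wt dw ddw z
  proof -
    note w = bounded_viscous_solutionD(1)[OF sol] and w0 = bounded_viscous_solutionD(2)[OF sol]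
      and C21 = bounded_viscous_solutionD(3)[OF sol] and eq = bounded_viscous_solutionD(4)[OF sol]
      and bd = bounded_viscous_solutionD(5,6)[OF sol]
    define \<Phi> where "\<Phi> x q t s = w x t - u (x + q) s - ((norm q)\<^sup>2 + (t - s)\<^sup>2) / (2 * \<delta>) - l * t" for x q t s
    let ?K = "unit_box \<times> cball 0 \<rho> \<times> {0..T} \<times> {0..T+1} :: ((real^'n) \<times> (real^'n) \<times> real \<times> real) set"
    have cw: "continuous_on (UNIV \<times> {0..}) (\<lambda>(x, t). w x t)" using w by (simp add: CT_def)
    have "continuous_on ?K (\<lambda>(x, q, t, s). w x t)"
      using continuous_on_compose2[OF cw, of ?K "\<lambda>(x, q, t, s). (x, t)"]
      by (force simp: split_beta intro!: continuous_intros)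
    moreover have "continuous_on ?K (\<lambda>(x, q, t, s). u (x + q) s)"
      using continuous_on_compose2[OF cu, of ?K "\<lambda>(x, q, t, s). (x + q, s)"]
      by (force simp: split_beta intro!: continuous_intros)
    ultimately have "continuous_on ?K (\<lambda>(x, q, t, s). \<Phi> x q t s)"
      using \<open>\<delta> > 0\<close> unfolding \<Phi>_def split_beta by (intro continuous_intros) auto
    moreover have "?K \<noteq> {}" using \<rho> \<open>T > 0\<close> by (auto simp: interval_ne_empty_cart)
    moreover have "compact ?K" by (intro compact_Times compact_cball compact_Icc compact_cbox)
    ultimately have "\<exists>m\<in>?K. \<forall>m'\<in>?K. (\<lambda>(x, q, t, s). \<Phi> x q t s) m' \<le> (\<lambda>(x, q, t, s). \<Phi> x q t s) m"
      by (intro continuous_attains_sup)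
    then obtain m where m: "m \<in> ?K" "\<And>m'. m' \<in> ?K \<Longrightarrow> (\<lambda>(x, q, t, s). \<Phi> x q t s) m' \<le> (\<lambda>(x, q, t, s). \<Phi> x q t s) m"
      by blast
    obtain x0 q0 t0 s0 where m_eq: "m = (x0, q0, t0, s0)" by (cases m)
    have t0: "0 \<le> t0" "t0 \<le> T" "0 \<le> s0" "s0 \<le> T + 1" using m(1) by (auto simp: m_eq)
    \<comment> \<open>Translating \<open>x\<close> by an integer vector leaves \<open>\<Phi>\<close> unchanged, so the maximum over the unit cube is one
      over all \<open>x\<close>.\<close>
    have local_max: "\<Phi> x q t s \<le> \<Phi> x0 q0 t0 s0" if "norm q \<le> \<rho>" "0 \<le> t" "t \<le> T" "0 \<le> s" "s \<le> T + 1" for x q t s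
    proof -
      obtain k where k: "\<And>i. k $ i \<in> \<int>" "x + k \<in> torus_dom" using torus_representative by blast
      have "\<Phi> (x + k) q t s = \<Phi> x q t s"
        using Zn_periodicD[OF pu k(1), of s "x + q"] Zn_periodicD[OF _ k(1), of "\<lambda>x. w x t" x] w that
        by (simp add: \<Phi>_def CT_def algebra_simps)
      then show ?thesis using m(2)[of "(x + k, q, t, s)"] k(2) that torus_dom_subset_unit_box
        by (auto simp: m_eq dist_norm)
    qed
    have max: "\<Phi> x q t s \<le> \<Phi> x0 q0 t0 s0" if "0 \<le> t" "t \<le> T" "0 \<le> s" "s \<le> T + 1" for x q t s
    proof (cases "norm q \<le> \<rho>")
      case False
      then have "\<rho>\<^sup>2 / (2 * \<delta>) \<le> ((norm q)\<^sup>2 + (t - s)\<^sup>2) / (2 * \<delta>)"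
        using \<rho>(1) \<open>\<delta> > 0\<close> by (intro divide_right_mono add_increasing2 power_mono) auto
      moreover have "norm (u (x + q) s) \<le> Mu" "norm (u x t) \<le> Mu"
        using that by (auto intro!: Mu(2)[simplified])
      ultimately have "\<Phi> x q t s \<le> \<Phi> x 0 t t" unfolding \<Phi>_def \<rho>2 by simp
      also have "\<dots> \<le> \<Phi> x0 q0 t0 s0" using that \<rho> by (intro local_max) auto
      finally show ?thesis .
    qed (use local_max that in auto)
    have pen: "norm q0 < \<rho> \<and> \<bar>t0 - s0\<bar> < \<rho>"
    proof -
      have "\<Phi> x0 0 t0 t0 \<le> \<Phi> x0 q0 t0 s0" using t0 by (intro max) auto
      moreover have "norm (u (x0 + q0) s0) \<le> Mu" "norm (u x0 t0) \<le> Mu"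
        using t0 by (auto intro!: Mu(2)[simplified])
      ultimately have "((norm q0)\<^sup>2 + (t0 - s0)\<^sup>2) / (2 * \<delta>) < \<rho>\<^sup>2 / (2 * \<delta>)"
        unfolding \<Phi>_def \<rho>2 by simp
      then have "(norm q0)\<^sup>2 + (t0 - s0)\<^sup>2 < \<rho>\<^sup>2" using \<open>\<delta> > 0\<close> by (simp add: divide_less_cancel)
      moreover have "0 \<le> (norm q0)\<^sup>2" "0 \<le> (t0 - s0)\<^sup>2" by simp_all
      ultimately have "(norm q0)\<^sup>2 < \<rho>\<^sup>2" "\<bar>t0 - s0\<bar>\<^sup>2 < \<rho>\<^sup>2"
        unfolding power2_abs by linarith+
      then show ?thesis using \<rho>(1) by (meson power_less_imp_less_base less_imp_le)
    qed
    have d0: "dist x0 (x0 + q0) < d1" "dist x0 (x0 + q0) < d2" "dist t0 s0 < d1"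
      using pen \<rho> by (auto simp: dist_norm)
    have "\<Phi> x0 q0 t0 s0 \<le> 2 * l"
    proof (cases "t0 = 0 \<or> s0 = 0")
      case True
      have "0 \<le> ((norm q0)\<^sup>2 + (t0 - s0)\<^sup>2) / (2 * \<delta>)" "0 \<le> l * t0"
        using \<open>\<delta> > 0\<close> \<open>l > 0\<close> t0 by auto
      then have "\<Phi> x0 q0 t0 s0 \<le> w x0 t0 - u (x0 + q0) s0" unfolding \<Phi>_def by linarith
      also have "\<dots> \<le> 2 * l"
      proof (cases "t0 = 0")
        case True
        have "dist (u x0 t0) (u (x0 + q0) s0) < l" using d0 t0 by (intro d1(2)) auto
        then show ?thesis using w0 True \<open>l > 0\<close> by (simp add: dist_real_def)
      next
        case False
        then have "s0 = 0" using \<open>t0 = 0 \<or> s0 = 0\<close> by simp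
        have "\<bar>w x0 t0 - w x0 0\<bar> \<le> C * (t0 - 0)"
          using viscous_lipschitz(1)[OF w C21 bd] t0 by blast
        also have "\<dots> \<le> C * \<rho>" using pen \<open>s0 = 0\<close> \<open>C \<ge> 0\<close> by (intro mult_left_mono) auto
        also have "\<dots> \<le> l" by fact
        finally have "\<bar>w x0 t0 - u x0 0\<bar> \<le> l" using w0 by simp
        moreover have "dist (u x0 0) (u (x0 + q0) s0) < l"
          using d0 t0 d1(1) \<open>s0 = 0\<close> by (intro d1(2)) auto
        ultimately show ?thesis by (simp add: dist_real_def)
      qed
      finally show ?thesis .
    next
      case False
      then have pos: "t0 > 0" "s0 > 0" "s0 < T + 1" using t0 pen \<rho> by auto
      let ?y = "x0 + q0"
      define \<phi> where "\<phi> y s = - ((norm (y - x0))\<^sup>2 + (s - t0)\<^sup>2) / (2 * \<delta>)" for y :: "real^'n" and s :: real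
      have "C1_on (\<lambda>(y, s). \<phi> y s) (UNIV \<times> {0<..})" unfolding \<phi>_def using \<open>\<delta> > 0\<close> by (rule C1_on_quadratic)
      moreover have "\<forall>\<^sub>F (y, s) in nhds (?y, s0). u y s - \<phi> y s \<ge> u ?y s0 - \<phi> ?y s0"
      proof -
        have "u y s - \<phi> y s \<ge> u ?y s0 - \<phi> ?y s0" if "s \<in> {0<..<T+1}" for y s
          using max[of t0 s x0 "y - x0"] that t0
          by (auto simp: \<Phi>_def \<phi>_def power2_commute[of t0] algebra_simps diff_divide_distrib add_divide_distrib)
        moreover have "\<forall>\<^sub>F p in nhds (?y, s0). p \<in> UNIV \<times> {0<..<T+1}"
          using pos by (intro eventually_nhds_in_open open_Times) auto
        ultimately show ?thesis by (auto elim!: eventually_mono)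
      qed
      ultimately have "deriv (\<phi> ?y) s0 + H ?y (grad (\<lambda>y. \<phi> y s0) ?y) \<ge> 0"
        using u(2) pos unfolding viscosity_supersolution_def by blast
      moreover have "deriv (\<phi> ?y) s0 = (t0 - s0) / \<delta>"
        unfolding \<phi>_def using \<open>\<delta> > 0\<close>
        by (intro DERIV_imp_deriv) (auto intro!: derivative_eq_intros simp: field_simps)
      moreover have "grad (\<lambda>y. \<phi> y s0) ?y = (- 1 / \<delta>) *\<^sub>R q0"
        unfolding \<phi>_def using \<open>\<delta> > 0\<close>
        by (intro grad_eqI)
           (auto intro!: derivative_eq_intros simp: power2_norm_eq_inner inner_commute fun_eq_iff field_simps)
      moreover have p: "dw x0 t0 = (- 1 / \<delta>) *\<^sub>R q0"
      proof -
        have "((\<lambda>x. w x t0 - (norm (?y - x))\<^sup>2 / (2 * \<delta>)) has_derivative (\<lambda>h. (dw x0 t0 + (1 / \<delta>) *\<^sub>R q0) \<bullet> h)) (at x0)"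
          using \<open>\<delta> > 0\<close> C21_withD(2)[OF C21, of t0 x0] pos
          by (auto intro!: derivative_eq_intros
               simp: power2_norm_eq_inner inner_commute fun_eq_iff field_simps inner_add_left inner_add_right)
        moreover have "w x t0 - (norm (?y - x))\<^sup>2 / (2 * \<delta>) \<le> w x0 t0 - (norm (?y - x0))\<^sup>2 / (2 * \<delta>)" for x
          using max[of t0 s0 x "?y - x"] t0 by (simp add: \<Phi>_def add_divide_distrib)
        ultimately have "(\<lambda>h. (dw x0 t0 + (1 / \<delta>) *\<^sub>R q0) \<bullet> h) = (\<lambda>h. 0)"
          by (intro differential_zero_maxmin[of x0 UNIV]) auto
        then have "dw x0 t0 + (1 / \<delta>) *\<^sub>R q0 = 0"
          by (metis inner_eq_zero_iff)
        then show ?thesis by (simp add: eq_neg_iff_add_eq_0)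
      qed
      ultimately have super: "(t0 - s0) / \<delta> + H ?y (dw x0 t0) \<ge> 0" by simp
      \<comment> \<open>One-sided differences suffice, which includes the case \<open>t0 = T\<close>. For the variable \<open>s\<close> the interval
        reaches up to \<open>T + 1\<close> and \<open>\<bar>t0 - s0\<bar> < 1\<close>, so \<open>s0\<close> is interior, as the viscosity condition requires.\<close>
      have wt_ge: "l + (t0 - s0) / \<delta> \<le> wt x0 t0"
      proof (rule ccontr)
        assume "\<not> ?thesis"
        moreover have "((\<lambda>t. w x0 t - (t - s0)\<^sup>2 / (2 * \<delta>) - l * t) has_real_derivative wt x0 t0 - (t0 - s0) / \<delta> - l) (at t0)"
          using \<open>\<delta> > 0\<close> C21_withD(1)[OF C21, of t0 x0] pos
          by (auto intro!: derivative_eq_intros simp: field_simps)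
        ultimately obtain d where d: "d > 0" "\<And>h. h > 0 \<Longrightarrow> h < d \<Longrightarrow>
            w x0 t0 - (t0 - s0)\<^sup>2 / (2 * \<delta>) - l * t0 < w x0 (t0 - h) - (t0 - h - s0)\<^sup>2 / (2 * \<delta>) - l * (t0 - h)"
          using DERIV_neg_dec_left[of "\<lambda>t. w x0 t - (t - s0)\<^sup>2 / (2 * \<delta>) - l * t" "wt x0 t0 - (t0 - s0) / \<delta> - l" t0]
          by auto
        obtain h where h: "0 < h" "h < d" "h \<le> t0"
          using d(1) pos(1) by (intro that[of "min (d / 2) t0"]) auto
        have "\<Phi> x0 q0 (t0 - h) s0 \<le> \<Phi> x0 q0 t0 s0" using h t0 by (intro max) auto
        then show False
          using d(2)[OF h(1,2)] unfolding \<Phi>_def add_divide_distrib by linarith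
      qed
      have "ddw x0 t0 $ i $ i \<le> 1 / \<delta>" for i
      proof (rule second_derivative_le[OF C21])
        fix r :: real assume "0 < r"
        let ?e = "axis i 1 :: real^'n"
        have "w (x0 + r *\<^sub>R ?e) t0 - (norm (q0 - r *\<^sub>R ?e))\<^sup>2 / (2 * \<delta>) \<le> w x0 t0 - (norm q0)\<^sup>2 / (2 * \<delta>)"
          using max[of t0 s0 "x0 + r *\<^sub>R ?e" "q0 - r *\<^sub>R ?e"] t0 by (simp add: \<Phi>_def add_divide_distrib)
        moreover have "w (x0 - r *\<^sub>R ?e) t0 - (norm (q0 + r *\<^sub>R ?e))\<^sup>2 / (2 * \<delta>) \<le> w x0 t0 - (norm q0)\<^sup>2 / (2 * \<delta>)"
          using max[of t0 s0 "x0 - r *\<^sub>R ?e" "q0 + r *\<^sub>R ?e"] t0 by (simp add: \<Phi>_def add_divide_distrib)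
        moreover have "(norm (q0 - r *\<^sub>R ?e))\<^sup>2 / (2 * \<delta>) + (norm (q0 + r *\<^sub>R ?e))\<^sup>2 / (2 * \<delta>)
            = 2 * ((norm q0)\<^sup>2 / (2 * \<delta>)) + 1 / \<delta> * r\<^sup>2"
          using \<open>\<delta> > 0\<close> unfolding power2_norm_eq_inner
          by (simp add: inner_diff inner_add inner_commute field_simps power2_eq_square inner_axis_axis)
        ultimately show "w (x0 + r *\<^sub>R ?e) t0 + w (x0 - r *\<^sub>R ?e) t0 - 2 * w x0 t0 \<le> 1 / \<delta> * r\<^sup>2"
          by linarith
      qed (use pos in auto)
      then have "(\<Sum>i\<in>UNIV. ddw x0 t0 $ i $ i) \<le> CARD('n) * (1 / \<delta>)"
        by (intro sum_bounded_above) auto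
      then have "\<epsilon> * (\<Sum>i\<in>UNIV. ddw x0 t0 $ i $ i) \<le> \<epsilon> * (CARD('n) * (1 / \<delta>))"
        using \<epsilon> by (intro mult_left_mono) auto
      also have "\<dots> < \<epsilon>0 * (CARD('n) * (1 / \<delta>))"
        using \<epsilon> \<open>\<delta> > 0\<close> by (intro mult_strict_right_mono) auto
      also have "\<dots> = l / 2" using \<open>\<delta> > 0\<close> by (simp add: \<epsilon>0_def)
      finally have "\<epsilon> * (\<Sum>i\<in>UNIV. ddw x0 t0 $ i $ i) < l / 2" .
      moreover have "dist (H x0 (dw x0 t0)) (H ?y (dw x0 t0)) < l / 2"
        using bd(2)[OF pos(1), of x0] d0 d2(1) by (intro d2(2)) auto
      moreover note eq[OF pos(1), of x0] super wt_ge
      ultimately have False unfolding dist_real_def by linarith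
      then show ?thesis ..
    qed
    moreover have "\<Phi> z 0 T T \<le> \<Phi> x0 q0 t0 s0" using \<open>T > 0\<close> by (intro max) auto
    ultimately have "w z T - u z T \<le> l * (T + 2)" by (simp add: \<Phi>_def algebra_simps)
    also have "\<dots> = \<kappa>" using \<open>T > 0\<close> by (simp add: l_def)
    finally show ?thesis .
  qed
  ultimately show ?thesis by blast
qed

lemma AE_le_imp_le:
  fixes f :: "'a::euclidean_space \<Rightarrow> real"
  assumes "continuous_on S f" "open S" "AE p in lborel. p \<in> S \<longrightarrow> f p \<le> c" "p \<in> S"
  shows "f p \<le> c"
proof (rule ccontr)
  assume "\<not> f p \<le> c"
  let ?U = "f -` {c<..} \<inter> S"
  have "open ?U" using assms(1,2) by (auto simp: continuous_on_open_vimage)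
  moreover have "p \<in> ?U" using assms(4) \<open>\<not> f p \<le> c\<close> by auto
  moreover have "negligible ?U"
  proof -
    obtain N where "N \<in> null_sets lborel" "{p \<in> space lborel. \<not> (p \<in> S \<longrightarrow> f p \<le> c)} \<subseteq> N"
      using assms(3) unfolding eventually_ae_filter by blast
    then have "negligible N" "?U \<subseteq> N"
      by (auto simp: negligible_iff_null_sets null_sets_completionI not_le)
    then show ?thesis by (rule negligible_subset)
  qed
  ultimately show False using open_not_negligible by blast
qed

text \<open>
  A strict violation of the bound by a continuous derivative would hold on a nonempty open set, which
  is not a null set.
\<close>

lemma derivative_bound_C21:
  fixes w :: "real^'n \<Rightarrow> real \<Rightarrow> real"
  assumes b: "derivative_bound C w" and C21: "C21_with {0<..} w wt dw ddw" and t: "t > 0"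
  shows "\<bar>wt x t\<bar> \<le> C" "norm (dw x t) \<le> C"
proof -
  obtain A B where AB: "A + B \<le> C" and ae: "AE (x, t) in lborel. t > 0 \<longrightarrow>
        (\<lambda>(y, s). w y s) differentiable (at (x, t)) \<and> \<bar>deriv (w x) t\<bar> \<le> A \<and> norm (grad (\<lambda>y. w y t) x) \<le> B"
    using b unfolding derivative_bound_def by blast
  let ?S = "UNIV \<times> {0<..} :: ((real^'n) \<times> real) set"
  have op: "open ?S" by (intro open_Times) auto
  have 1: "AE p in lborel. p \<in> ?S \<longrightarrow> \<bar>wt (fst p) (snd p)\<bar> \<le> A"
    using ae by eventually_elim (auto simp: C21_with_eq[OF C21])
  have 2: "AE p in lborel. p \<in> ?S \<longrightarrow> norm (dw (fst p) (snd p)) \<le> B"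
    using ae by eventually_elim (auto simp: C21_with_eq[OF C21])
  have c: "continuous_on ?S (\<lambda>p. \<bar>wt (fst p) (snd p)\<bar>)" "continuous_on ?S (\<lambda>p. norm (dw (fst p) (snd p)))"
    using C21_with_cont(1,2)[OF C21] unfolding split_beta by (auto intro!: continuous_intros)
  have "\<bar>wt x t\<bar> \<le> A" using AE_le_imp_le[OF c(1) op 1, of "(x, t)"] t by simp
  moreover have "norm (dw x t) \<le> B" using AE_le_imp_le[OF c(2) op 2, of "(x, t)"] t by simp
  moreover have "0 \<le> \<bar>wt x t\<bar>" "0 \<le> norm (dw x t)" by auto
  ultimately show "\<bar>wt x t\<bar> \<le> C" "norm (dw x t) \<le> C" using AB by linarith+
qed

lemma C1_test_derivatives:
  fixes \<phi> :: "real^'n \<Rightarrow> real \<Rightarrow> real"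
  assumes "C1_on (\<lambda>(y, s). \<phi> y s) (UNIV \<times> {0<..})" "t > 0"
  shows "\<phi> x field_differentiable at t" "(\<lambda>y. \<phi> y t) differentiable at x"
proof -
  obtain f' where f': "((\<lambda>(y, s). \<phi> y s) has_derivative blinfun_apply f') (at (x, t) within UNIV \<times> {0<..})"
    using assms unfolding C1_on_def by blast
  then have f': "((\<lambda>(y, s). \<phi> y s) has_derivative blinfun_apply f') (at (x, t))"
    using assms(2) at_within_open[of "(x, t)" "UNIV \<times> {0<..}"] by (auto simp: open_Times)
  have "((\<lambda>s. (x, s)) has_derivative (\<lambda>k. (0, k))) (at t)" "((\<lambda>y. (y, t)) has_derivative (\<lambda>h. (h, 0))) (at x)"
    by (auto intro!: derivative_eq_intros)
  from this[THEN has_derivative_compose, OF f']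
  have 1: "(\<phi> x has_derivative (\<lambda>k. f' (0, k))) (at t)" and 2: "((\<lambda>y. \<phi> y t) has_derivative (\<lambda>h. f' (h, 0))) (at x)"
    by auto
  show "(\<lambda>y. \<phi> y t) differentiable at x" using 2 by (auto simp: differentiable_def)
  have "\<phi> x differentiable at t" using 1 by (auto simp: differentiable_def)
  then show "\<phi> x field_differentiable at t"
    by (simp add: real_differentiable_def field_differentiable_def)
qed

text \<open>
  The reflection \<open>u \<mapsto> -u\<close> turns subsolutions into supersolutions for the Hamiltonian \<open>-H(x,-p)\<close> and
  preserves the viscous equation, so that one comparison argument gives both estimates.
\<close>

lemma viscosity_sub_to_super:
  fixes H :: "real^'n \<Rightarrow> real^'n \<Rightarrow> real"
  assumes u: "viscosity_subsolution H u"
  shows "viscosity_supersolution (\<lambda>x p. - H x (- p)) (\<lambda>x t. - u x t)"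
  unfolding viscosity_supersolution_def
proof (intro allI impI)
  fix \<phi> :: "real^'n \<Rightarrow> real \<Rightarrow> real" and x and t :: real
  assume C1: "C1_on (\<lambda>(y, s). \<phi> y s) (UNIV \<times> {0<..})" and t: "t > 0"
    and ev: "\<forall>\<^sub>F (y, s) in nhds (x, t). - u x t - \<phi> x t \<le> - u y s - \<phi> y s"
  note D = C1_test_derivatives[OF C1 t]
  have "C1_on (\<lambda>p. - (\<lambda>(y, s). \<phi> y s) p) (UNIV \<times> {0<..})"
    by (rule C1_on_bounded_linear[OF C1 bounded_linear_minus[OF bounded_linear_ident]])
  then have "C1_on (\<lambda>(y, s). - \<phi> y s) (UNIV \<times> {0<..})" by (simp add: case_prod_unfold)
  moreover have "\<forall>\<^sub>F (y, s) in nhds (x, t). u y s - (- \<phi> y s) \<le> u x t - (- \<phi> x t)"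
    using ev by eventually_elim auto
  moreover note u[unfolded viscosity_subsolution_def, THEN spec[of _ "\<lambda>y s. - \<phi> y s"], THEN spec[of _ x], THEN spec[of _ t]]
  ultimately have "deriv (\<lambda>s. - \<phi> x s) t + H x (grad (\<lambda>y. - \<phi> y t) x) \<le> 0"
    using t by simp
  moreover have "deriv (\<lambda>s. - \<phi> x s) t = - deriv (\<phi> x) t"
    using D(1) by (rule deriv_minus)
  moreover have "grad (\<lambda>y. - \<phi> y t) x = - grad (\<lambda>y. \<phi> y t) x"
  proof (rule grad_eqI)
    obtain f' where "((\<lambda>y. \<phi> y t) has_derivative f') (at x)" using D(2) by (auto simp: differentiable_def)
    from has_derivative_minus[OF has_derivative_grad[OF this]]
    show "((\<lambda>y. - \<phi> y t) has_derivative (\<lambda>h. - grad (\<lambda>y. \<phi> y t) x \<bullet> h)) (at x)" by simp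
  qed
  ultimately show "deriv (\<phi> x) t + - H x (- grad (\<lambda>y. \<phi> y t) x) \<ge> 0" by simp
qed

lemma C21_with_uminus:
  fixes w :: "real^'n \<Rightarrow> real \<Rightarrow> real"
  assumes C: "C21_with I w wt dw ddw"
  shows "C21_with I (\<lambda>x t. - w x t) (\<lambda>x t. - wt x t) (\<lambda>x t. - dw x t) (\<lambda>x t. - ddw x t)"
  unfolding C21_with_def
proof (intro conjI allI ballI)
  fix x t assume t: "t \<in> I"
  note D = C21_withD[OF C t, of x]
  show "((\<lambda>t. - w x t) has_real_derivative - wt x t) (at t)" by (rule DERIV_minus[OF D(1)])
  show "((\<lambda>y. - w y t) has_derivative (\<bullet>) (- dw x t)) (at x)"
    by (rule has_derivative_eq_rhs[OF has_derivative_minus[OF D(2)]]) (simp add: fun_eq_iff)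
  show "((\<lambda>y. - dw y t) has_derivative (*v) (- ddw x t)) (at x)"
    by (rule has_derivative_eq_rhs[OF has_derivative_minus[OF D(3)]])
       (use scaleR_matrix_vector_assoc[of "- 1" "ddw x t"] in \<open>simp add: fun_eq_iff\<close>)
next
  show "continuous_on (UNIV \<times> I) (\<lambda>(x, t). - wt x t)" "continuous_on (UNIV \<times> I) (\<lambda>(x, t). - dw x t)"
    "continuous_on (UNIV \<times> I) (\<lambda>(x, t). - ddw x t)"
    using C21_with_cont[OF C] unfolding split_beta by (auto intro!: continuous_intros)
qed

lemma CT_uminus: "CT Y w \<Longrightarrow> CT Y (\<lambda>x t. - w x t)"
  unfolding CT_def split_beta by (auto intro!: continuous_intros simp: Zn_periodic_def)

lemma bounded_viscous_solution_uminus: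
  assumes "bounded_viscous_solution C \<epsilon> H g w wt dw ddw"
  shows "bounded_viscous_solution C \<epsilon> (\<lambda>x p. - H x (- p)) (\<lambda>x. - g x)
    (\<lambda>x t. - w x t) (\<lambda>x t. - wt x t) (\<lambda>x t. - dw x t) (\<lambda>x t. - ddw x t)"
  unfolding bounded_viscous_solution_def
proof (intro conjI allI impI)
  note D = bounded_viscous_solutionD[OF assms]
  show "CT {0..} (\<lambda>x t. - w x t)" by (rule CT_uminus[OF D(1)])
  show "C21_with {0<..} (\<lambda>x t. - w x t) (\<lambda>x t. - wt x t) (\<lambda>x t. - dw x t) (\<lambda>x t. - ddw x t)"
    by (rule C21_with_uminus[OF D(3)])
  fix x t
  show "- w x 0 = - g x" using D(2) by simp
  assume t: "0 < (t::real)"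
  show "- wt x t + - H x (- (- dw x t)) = \<epsilon> * (\<Sum>i\<in>UNIV. (- ddw x t) $ i $ i)"
    using D(4)[OF t, of x] by (simp add: sum_negf)
  show "\<bar>- wt x t\<bar> \<le> C" "norm (- dw x t) \<le> C" using D(5,6)[OF t] by auto
qed

lemma vanishing_viscosity_estimate:
  fixes H :: "real^'n \<Rightarrow> real^'n \<Rightarrow> real" and u :: "real^'n \<Rightarrow> real \<Rightarrow> real"
  assumes cH: "continuous_on UNIV (\<lambda>(x, p). H x p)" and pH: "\<And>p. Zn_periodic (\<lambda>x. H x p)"
    and u: "viscosity_solution H g u"
    and "T > 0" "C \<ge> 0" "\<kappa> > 0"
  shows "\<exists>\<epsilon>0>0. \<forall>\<epsilon> w wt dw ddw z. 0 < \<epsilon> \<longrightarrow> \<epsilon> < \<epsilon>0 \<longrightarrow>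
    bounded_viscous_solution C \<epsilon> H g w wt dw ddw \<longrightarrow> \<bar>w z T - u z T\<bar> \<le> \<kappa>"
proof -
  have g: "g = (\<lambda>x. u x 0)" using u by (simp add: viscosity_solution_def)
  have uCT: "CT {0..} u" and sub: "viscosity_subsolution H u" and super: "viscosity_supersolution H u"
    using u by (auto simp: viscosity_solution_def)
  let ?H = "\<lambda>x p. - H x (- p)"
  have cH': "continuous_on UNIV (\<lambda>(x, p). ?H x p)"
  proof -
    have "continuous_on UNIV (\<lambda>q. - (\<lambda>(x, p). H x p) (fst q, - snd q))"
      by (intro continuous_on_minus continuous_on_compose2[OF cH]) (auto intro!: continuous_intros)
    then show ?thesis by (simp add: split_beta)
  qed
  have pH': "Zn_periodic (\<lambda>x. ?H x p)" for p using pH[of "- p"] by (simp add: Zn_periodic_def)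
  obtain e1 where e1: "e1 > 0" "\<And>\<epsilon> w wt dw ddw z. 0 < \<epsilon> \<Longrightarrow> \<epsilon> < e1 \<Longrightarrow>
      bounded_viscous_solution C \<epsilon> H g w wt dw ddw \<Longrightarrow> w z T - u z T \<le> \<kappa>"
    using viscous_le_supersolution[OF cH pH uCT super assms(4-6)] unfolding g by blast
  obtain e2 where e2: "e2 > 0" "\<And>\<epsilon> w wt dw ddw z. 0 < \<epsilon> \<Longrightarrow> \<epsilon> < e2 \<Longrightarrow>
      bounded_viscous_solution C \<epsilon> ?H (\<lambda>x. - g x) w wt dw ddw \<Longrightarrow> w z T - - u z T \<le> \<kappa>"
    using viscous_le_supersolution[OF cH' pH' CT_uminus[OF uCT] viscosity_sub_to_super[OF sub] assms(4-6)]
    unfolding g by blast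
  have "\<bar>w z T - u z T\<bar> \<le> \<kappa>"
    if "0 < \<epsilon>" "\<epsilon> < min e1 e2" "bounded_viscous_solution C \<epsilon> H g w wt dw ddw" for \<epsilon> w wt dw ddw z
    using e1(2)[OF that(1) _ that(3), of z] e2(2)[OF that(1) _ bounded_viscous_solution_uminus[OF that(3)], of z] that(2)
    by (simp add: abs_le_iff)
  then show ?thesis using e1(1) e2(1) by (intro exI[of _ "min e1 e2"]) auto
qed

section \<open>Duality with the adjoint equation\<close>

lemma continuous_on_slice:
  assumes "continuous_on (UNIV \<times> J) (\<lambda>(x, t). f x t)" "t \<in> J"
  shows "continuous_on S (\<lambda>x. f x t)"
proof -
  have "continuous_on S (\<lambda>x. (\<lambda>(x, t). f x t) (x, t))"
    by (rule continuous_on_compose2[OF assms(1)]) (use assms(2) in \<open>auto intro!: continuous_intros\<close>)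
  then show ?thesis by simp
qed

lemma continuous_on_integral_slice:
  fixes f :: "real^'n \<Rightarrow> real \<Rightarrow> real"
  assumes "continuous_on (UNIV \<times> J) (\<lambda>(x, t). f x t)"
  shows "continuous_on J (\<lambda>t. integral unit_box (\<lambda>x. f x t))"
proof (rule integral_continuous_on_param)
  have "continuous_on (J \<times> unit_box) (\<lambda>p. (\<lambda>(x, t). f x t) (prod.swap p))"
    by (rule continuous_on_compose2[OF assms]) (auto simp: prod.swap_def intro!: continuous_intros)
  then show "continuous_on (J \<times> unit_box) (\<lambda>(t, x). f x t)"
    by (simp add: split_beta prod.swap_def)
qed

lemma abs_integral_density_le:
  fixes f s :: "real^'n \<Rightarrow> real"
  assumes "continuous_on unit_box f" "continuous_on unit_box s" "\<And>x. s x \<ge> 0"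
    "integral unit_box s = 1" "\<And>x. \<bar>f x\<bar> \<le> K"
  shows "\<bar>integral unit_box (\<lambda>x. f x * s x)\<bar> \<le> K"
proof -
  have "norm (integral unit_box (\<lambda>x. f x * s x)) \<le> integral unit_box (\<lambda>x. K * s x)"
    using assms
    by (intro integral_norm_bound_integral integrable_continuous continuous_intros)
       (auto simp: abs_mult intro!: mult_right_mono)
  then show ?thesis using assms(4) by simp
qed

text \<open>
  The square of the positive part is \<open>C\<^sup>1\<close>; three translates of it make a \<open>C\<^sup>1\<close> step.
\<close>

lemma pos_part_square_deriv: "((\<lambda>r::real. (max 0 r)\<^sup>2) has_real_derivative 2 * max 0 r) (at r)"
proof (cases "r = 0")
  case True
  have "((\<lambda>h::real. (max 0 h)\<^sup>2 / h) \<longlongrightarrow> 0) (at 0)"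
  proof (rule Lim_null_comparison[OF always_eventually tendsto_norm_zero[OF tendsto_ident_at]], rule allI)
    show "norm ((max 0 h)\<^sup>2 / h) \<le> norm h" for h :: real
      by (cases "h \<le> 0") (auto simp: power2_eq_square)
  qed
  then show ?thesis using True unfolding DERIV_def by simp
next
  case False
  show ?thesis
  proof (cases "r > 0")
    case True
    have "((\<lambda>r::real. r\<^sup>2) has_real_derivative 2 * max 0 r) (at r)"
      using True by (auto intro!: derivative_eq_intros)
    then show ?thesis
      by (rule has_field_derivative_transform_within_open[of _ _ _ "{0<..}"]) (use True in auto)
  next
    case False
    then have "r < 0" using \<open>r \<noteq> 0\<close> by simp
    have "((\<lambda>r::real. 0) has_real_derivative 2 * max 0 r) (at r)"
      using \<open>r < 0\<close> by (auto intro!: derivative_eq_intros)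
    then show ?thesis
      by (rule has_field_derivative_transform_within_open[of _ _ _ "{..<0}"]) (use \<open>r < 0\<close> in auto)
  qed
qed

text \<open>
  The quadratic spline that rises from 0 to 1 on \<open>[0,1]\<close>; its derivative is the tent function of height
  2 on the same interval.
\<close>

definition smooth_step :: "real \<Rightarrow> real" where
  "smooth_step r = 2 * ((max 0 r)\<^sup>2 - 2 * (max 0 (r - 1 / 2))\<^sup>2 + (max 0 (r - 1))\<^sup>2)"

definition tent :: "real \<Rightarrow> real" where
  "tent r = 4 * (max 0 r - 2 * max 0 (r - 1 / 2) + max 0 (r - 1))"

lemma smooth_step_deriv: "(smooth_step has_real_derivative tent r) (at r)"
proof -
  have *: "((\<lambda>r. (max 0 (r - a))\<^sup>2) has_real_derivative 2 * max 0 (r - a)) (at r)" for a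
  proof -
    have "((\<lambda>r. r - a) has_real_derivative 1) (at r)" by (auto intro!: derivative_eq_intros)
    from DERIV_chain2[OF pos_part_square_deriv this] show ?thesis by simp
  qed
  show ?thesis
    unfolding smooth_step_def[abs_def] tent_def
    by (rule derivative_eq_intros pos_part_square_deriv * refl | simp)+
qed

lemma smooth_step_simps: "r \<le> 0 \<Longrightarrow> smooth_step r = 0" "r \<ge> 1 \<Longrightarrow> smooth_step r = 1"
  by (auto simp: smooth_step_def max_def field_simps power2_eq_square)

lemma tent_nonneg: "tent r \<ge> 0"
  by (auto simp: tent_def max_def)

lemma tent_eq_0: "r \<le> 0 \<or> r \<ge> 1 \<Longrightarrow> tent r = 0"
  by (auto simp: tent_def max_def)

lemma tent_continuous: "continuous_on S (\<lambda>x. tent (f x))" if "continuous_on S f"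
  unfolding tent_def by (intro continuous_intros that)

lemma smooth_step_mono: "r \<le> s \<Longrightarrow> smooth_step r \<le> smooth_step s"
  using DERIV_nonneg_imp_nondecreasing[of r s smooth_step] smooth_step_deriv tent_nonneg by blast

lemma smooth_step_range: "0 \<le> smooth_step r" "smooth_step r \<le> 1"
  using smooth_step_mono[of "min r 0" r] smooth_step_mono[of r "max r 1"] smooth_step_simps by auto

text \<open>
  The rescaled tent function is a probability density on \<open>[a,a+h]\<close>.
\<close>

lemma tent_average:
  fixes m :: "real \<Rightarrow> real"
  assumes m: "continuous_on {\<alpha>..\<beta>} m" and h: "h > 0" "\<alpha> \<le> a" "a + h \<le> \<beta>"
    and \<eta>: "\<And>t. a \<le> t \<Longrightarrow> t \<le> a + h \<Longrightarrow> \<bar>m t - c\<bar> \<le> \<eta>"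
  shows "\<bar>integral {\<alpha>..\<beta>} (\<lambda>t. tent ((t - a) / h) / h * m t) - c\<bar> \<le> \<eta>"
proof -
  have ct: "continuous_on {\<alpha>..\<beta>} (\<lambda>t. tent ((t - a) / h) / h)"
    using h by (intro continuous_intros tent_continuous) auto
  have "((\<lambda>t. tent ((t - a) / h) / h) has_integral (smooth_step ((\<beta> - a) / h) - smooth_step ((\<alpha> - a) / h))) {\<alpha>..\<beta>}"
  proof (rule fundamental_theorem_of_calculus)
    fix t assume "t \<in> {\<alpha>..\<beta>}"
    have "((\<lambda>t. smooth_step ((t - a) / h)) has_real_derivative tent ((t - a) / h) * (1 / h)) (at t)"
      by (rule DERIV_chain2[OF smooth_step_deriv]) (use h in \<open>auto intro!: derivative_eq_intros\<close>)
    then show "((\<lambda>t. smooth_step ((t - a) / h)) has_vector_derivative tent ((t - a) / h) / h) (at t within {\<alpha>..\<beta>})"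
      by (simp add: has_real_derivative_iff_has_vector_derivative has_vector_derivative_at_within)
  qed (use h in simp)
  also have "smooth_step ((\<beta> - a) / h) - smooth_step ((\<alpha> - a) / h) = 1"
    using h by (simp add: smooth_step_simps divide_nonpos_pos)
  finally have one: "integral {\<alpha>..\<beta>} (\<lambda>t. tent ((t - a) / h) / h) = 1" by (rule integral_unique)
  have "integral {\<alpha>..\<beta>} (\<lambda>t. tent ((t - a) / h) / h * m t) - c
      = integral {\<alpha>..\<beta>} (\<lambda>t. tent ((t - a) / h) / h * m t) - integral {\<alpha>..\<beta>} (\<lambda>t. tent ((t - a) / h) / h * c)"
    unfolding integral_mult_left one by simp
  also have "\<dots> = integral {\<alpha>..\<beta>} (\<lambda>t. tent ((t - a) / h) / h * m t - tent ((t - a) / h) / h * c)"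
    by (intro integral_diff[symmetric] integrable_continuous_interval continuous_intros ct m)
  also have "\<bar>\<dots>\<bar> \<le> integral {\<alpha>..\<beta>} (\<lambda>t. tent ((t - a) / h) / h * \<eta>)"
    unfolding real_norm_def[symmetric]
  proof (intro integral_norm_bound_integral integrable_continuous_interval continuous_intros ct m)
    fix t assume "t \<in> {\<alpha>..\<beta>}"
    show "norm (tent ((t - a) / h) / h * m t - tent ((t - a) / h) / h * c) \<le> tent ((t - a) / h) / h * \<eta>"
    proof (cases "a \<le> t \<and> t \<le> a + h")
      case True
      have "norm (tent ((t - a) / h) / h * m t - tent ((t - a) / h) / h * c) = tent ((t - a) / h) / h * \<bar>m t - c\<bar>"
        unfolding right_diff_distrib[symmetric] using h tent_nonneg by (simp add: abs_mult)
      then show ?thesis using True \<eta>[of t] h tent_nonneg by (simp add: divide_right_mono mult_left_mono)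
    next
      case False
      then have "tent ((t - a) / h) = 0" using h by (intro tent_eq_0) (auto simp: field_simps)
      then show ?thesis by simp
    qed
  qed (use h in \<open>auto intro!: tent_continuous continuous_intros\<close>)
  also have "\<dots> = \<eta>" unfolding integral_mult_left one by simp
  finally show ?thesis .
qed

lemma LINT_torus_time_eq_iterated:
  fixes f :: "real^'n \<Rightarrow> real \<Rightarrow> real"
  assumes cont: "continuous_on (UNIV \<times> {0<..<T}) (\<lambda>(x, t). f x t)" and ab: "0 < a" "b < T"
    and supp: "\<And>x t. t \<in> {0<..<T} \<Longrightarrow> t \<notin> {a..b} \<Longrightarrow> f x t = 0"
  shows "(LINT (x, t):torus_dom \<times> {0<..<T}|lborel. f x t) = integral {a..b} (\<lambda>t. integral unit_box (\<lambda>x. f x t))"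
proof -
  let ?f = "\<lambda>(x, t). f x t" and ?Q = "cbox (0, a) (\<chi> i. 1, b) :: ((real^'n) \<times> real) set"
  have Q: "?Q = unit_box \<times> {a..b}" by (simp add: cbox_Pair_eq)
  have contQ: "continuous_on ?Q ?f"
    unfolding Q using ab by (intro continuous_on_subset[OF cont]) auto
  have "(LINT (x, t):torus_dom \<times> {0<..<T}|lborel. f x t) = (LINT (x, t):torus_dom \<times> {a..b}|lborel. f x t)"
    unfolding set_lebesgue_integral_def
  proof (intro Bochner_Integration.integral_cong refl)
    fix p :: "(real^'n) \<times> real"
    show "indicator (torus_dom \<times> {0<..<T}) p *\<^sub>R ?f p = indicator (torus_dom \<times> {a..b}) p *\<^sub>R ?f p"
      using ab supp[of "snd p" "fst p"] by (cases "snd p \<in> {a..b}") (auto simp: indicator_def split: prod.splits)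
  qed
  also have "\<dots> = integral (torus_dom \<times> {a..b}) ?f"
  proof (rule set_borel_integral_eq_integral)
    have "set_integrable lborel ?Q ?f"
      unfolding set_integrable_def by (rule borel_integrable_compact[OF compact_cbox contQ])
    then show "set_integrable lborel (torus_dom \<times> {a..b}) ?f"
      by (rule set_integrable_subset) (use torus_dom_subset_unit_box in \<open>auto simp: Q borel_Times\<close>)
  qed
  also have "\<dots> = integral ?Q ?f"
  proof (rule integral_spike_set)
    show "negligible {x \<in> torus_dom \<times> {a..b} - ?Q. ?f x \<noteq> 0}"
      using torus_dom_subset_unit_box by (auto simp: Q intro!: negligible_subset[OF negligible_empty])
    show "negligible {x \<in> ?Q - torus_dom \<times> {a..b}. ?f x \<noteq> 0}"
    proof (rule negligible_subset[OF negligible_frontier_interval])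
      show "{x \<in> ?Q - torus_dom \<times> {a..b}. ?f x \<noteq> 0} \<subseteq> ?Q - box (0, a) (\<chi> i. 1, b)"
      proof
        fix p assume p: "p \<in> {x \<in> ?Q - torus_dom \<times> {a..b}. ?f x \<noteq> 0}"
        then have "fst p \<in> unit_box - torus_dom" by (auto simp: Q)
        then have "fst p \<notin> box 0 (\<chi> i. 1)" by (auto simp: torus_dom_def mem_box_cart intro: less_imp_le)
        then have "p \<notin> box (0, a) (\<chi> i. 1, b)"
          by (cases p) (auto simp: mem_box Basis_prod_def ball_Un)
        then show "p \<in> ?Q - box (0, a) (\<chi> i. 1, b)" using p by auto
      qed
    qed
  qed
  also have "\<dots> = integral unit_box (\<lambda>x. integral {a..b} (\<lambda>t. f x t))"
    using integral_prod_continuous[OF contQ] by simp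
  also have "\<dots> = integral {a..b} (\<lambda>t. integral unit_box (\<lambda>x. f x t))"
    using integral_swap_continuous[of 0 a "\<chi> i. 1" b f] contQ by simp
  finally show ?thesis .
qed

text \<open>
  The distributional equation only admits test functions with compact support in \<open>(0,T)\<close>. For \<open>\<phi>\<close> times
  a \<open>C\<^sup>1\<close> cutoff in time, rising on \<open>[h,2h]\<close> and falling on \<open>[T-2h,T-h]\<close>, it says that the integral of
  cutoff times \<open>\<integral>E \<sigma>\<close> equals the difference of the averages of \<open>m(t) = \<integral>\<phi> \<sigma>\<close> over these two intervals. As
  \<open>h \<rightarrow> 0\<close> the averages tend to \<open>m(0)\<close> and, because \<open>\<sigma>(\<cdot>,t) \<rightarrow> \<delta>\<^sub>z\<close>, to \<open>\<phi>(z,T)\<close>.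
\<close>

lemma adjoint_duality:
  fixes \<phi> :: "real^'n \<Rightarrow> real \<Rightarrow> real" and b :: "real^'n \<Rightarrow> real \<Rightarrow> real^'n"
  assumes adj: "adjoint_solution \<epsilon> H W z T \<sigma>" and "T > 0"
    and b: "continuous_on (UNIV \<times> {0<..<T}) (\<lambda>(x, t). b x t)"
      "\<And>x t. t \<in> {0<..<T} \<Longrightarrow> grad (H x) (grad (\<lambda>y. W y t) x) = b x t"
    and \<phi>: "C21_with {0<..<T} \<phi> \<phi>t d\<phi> dd\<phi>" "CT {0..T} \<phi>"
    and E: "\<And>x t. t \<in> {0<..<T} \<Longrightarrow> E x t = \<phi>t x t + b x t \<bullet> d\<phi> x t - \<epsilon> * (\<Sum>i\<in>UNIV. dd\<phi> x t $ i $ i)"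
      "\<And>x t. t \<in> {0<..<T} \<Longrightarrow> \<bar>E x t\<bar> \<le> K"
  shows "\<phi> z T - (LINT x:torus_dom|lborel. \<phi> x 0 * \<sigma> x 0)
      = (LINT t:{0<..<T}|lborel. LINT x:torus_dom|lborel. E x t * \<sigma> x t)"
proof -
  let ?I = "{0<..<T}"
  have c\<sigma>: "continuous_on (UNIV \<times> {0..<T}) (\<lambda>(x, t). \<sigma> x t)" and \<sigma>0: "t \<in> {0..<T} \<Longrightarrow> \<sigma> x t \<ge> 0"
    and \<sigma>1: "t \<in> {0..<T} \<Longrightarrow> (LINT x:torus_dom|lborel. \<sigma> x t) = 1" for x t
    using adj by (auto simp: adjoint_solution_def CT_def)
  have c\<sigma>I: "continuous_on (UNIV \<times> ?I) (\<lambda>(x, t). \<sigma> x t)"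
    using c\<sigma> by (rule continuous_on_subset) auto
  have c\<sigma>t: "continuous_on unit_box (\<lambda>x. \<sigma> x t)" if "t \<in> {0..<T}" for t
    using continuous_on_slice[OF c\<sigma> that] .
  have \<sigma>i: "integral unit_box (\<lambda>x. \<sigma> x t) = 1" if "t \<in> {0..<T}" for t
    using \<sigma>1[OF that] LINT_torus_eq_integral[OF c\<sigma>t[OF that]] by simp
  have c\<phi>: "continuous_on (UNIV \<times> {0..T}) (\<lambda>(x, t). \<phi> x t)" using \<phi>(2) by (simp add: CT_def)
  have p\<phi>: "Zn_periodic (\<lambda>x. \<phi> x t)" if "t \<in> {0..T}" for t using \<phi>(2) that by (simp add: CT_def)
  have c\<phi>\<sigma>: "continuous_on (UNIV \<times> {0..<T}) (\<lambda>(x, t). \<phi> x t * \<sigma> x t)"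
  proof -
    have "continuous_on (UNIV \<times> {0..<T}) (\<lambda>(x, t). \<phi> x t)" by (rule continuous_on_subset[OF c\<phi>]) auto
    then show ?thesis unfolding split_beta using c\<sigma> by (intro continuous_intros) (auto simp: split_beta)
  qed
  have cE: "continuous_on (UNIV \<times> ?I) (\<lambda>(x, t). E x t)"
  proof -
    have "continuous_on (UNIV \<times> ?I) (\<lambda>(x, t). \<phi>t x t + b x t \<bullet> d\<phi> x t - \<epsilon> * (\<Sum>i\<in>UNIV. dd\<phi> x t $ i $ i))"
      unfolding split_beta using b(1) C21_with_cont[OF \<phi>(1)]
      by (intro continuous_intros) (auto simp: split_beta)
    then show ?thesis
      by (rule continuous_on_cong[THEN iffD1, rotated -1]) (auto simp: E(1))
  qed
  have cE\<sigma>: "continuous_on (UNIV \<times> ?I) (\<lambda>(x, t). E x t * \<sigma> x t)"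
    unfolding split_beta using cE c\<sigma>I by (intro continuous_intros) (auto simp: split_beta)
  define m where "m t = integral unit_box (\<lambda>x. \<phi> x t * \<sigma> x t)" for t
  define e where "e t = integral unit_box (\<lambda>x. E x t * \<sigma> x t)" for t
  have m_eq: "m t = (LINT x:torus_dom|lborel. \<phi> x t * \<sigma> x t)" if "t \<in> {0..<T}" for t
    unfolding m_def using LINT_torus_eq_integral[OF continuous_on_slice[OF c\<phi>\<sigma> that]] by simp
  have e_eq: "e t = (LINT x:torus_dom|lborel. E x t * \<sigma> x t)" if "t \<in> ?I" for t
    unfolding e_def using LINT_torus_eq_integral[OF continuous_on_slice[OF cE\<sigma> that]] by simp
  have cm: "continuous_on {0..<T} m"
    unfolding m_def by (rule continuous_on_integral_slice[OF c\<phi>\<sigma>])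
  have ce: "continuous_on ?I e"
    unfolding e_def by (rule continuous_on_integral_slice[OF cE\<sigma>])
  have K: "\<bar>e t\<bar> \<le> K" if "t \<in> ?I" for t
    unfolding e_def using that
    by (intro abs_integral_density_le continuous_on_slice[OF cE] c\<sigma>t \<sigma>i \<sigma>0 E(2)) auto
  \<comment> \<open>The terminal condition concerns a fixed test function; uniform continuity of \<open>\<phi>\<close> allows its time to vary.\<close>
  have mT: "(m \<longlongrightarrow> \<phi> z T) (at_left T)"
  proof -
    have conv: "\<forall>\<psi>. continuous_on UNIV \<psi> \<longrightarrow> Zn_periodic \<psi> \<longrightarrow>
        ((\<lambda>t. LINT x:torus_dom|lborel. \<psi> x * \<sigma> x t) \<longlongrightarrow> \<psi> z) (at_left T)"
      using adj unfolding adjoint_solution_def by (elim conjE)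
    have "((\<lambda>t. LINT x:torus_dom|lborel. \<phi> x T * \<sigma> x t) \<longlongrightarrow> \<phi> z T) (at_left T)"
      by (rule conv[rule_format]) (use continuous_on_slice[OF c\<phi>, of T] p\<phi>[of T] \<open>T > 0\<close> in auto)
    moreover have "((\<lambda>t. m t - (LINT x:torus_dom|lborel. \<phi> x T * \<sigma> x t)) \<longlongrightarrow> 0) (at_left T)"
    proof (rule tendstoI)
      fix r :: real assume "r > 0"
      then obtain d where d: "d > 0" "\<And>x x' t t'. t \<in> {0..T} \<Longrightarrow> t' \<in> {0..T} \<Longrightarrow> dist x x' < d \<Longrightarrow>
          dist t t' < d \<Longrightarrow> dist (\<phi> x t) (\<phi> x' t') < r / 2"
        using periodic_uniformly_continuous[OF c\<phi> compact_Icc p\<phi>, of "r / 2"] by auto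
      have "dist (m t - (LINT x:torus_dom|lborel. \<phi> x T * \<sigma> x t)) 0 < r" if t: "max 0 (T - d) < t" "t < T" for t
      proof -
        have t': "t \<in> {0..<T}" using t by auto
        have 1: "continuous_on unit_box (\<lambda>x. \<phi> x T)" "continuous_on unit_box (\<lambda>x. \<phi> x t)"
          using t' \<open>T > 0\<close> by (auto intro!: continuous_on_slice[OF c\<phi>])
        have "m t - (LINT x:torus_dom|lborel. \<phi> x T * \<sigma> x t)
            = integral unit_box (\<lambda>x. \<phi> x t * \<sigma> x t) - integral unit_box (\<lambda>x. \<phi> x T * \<sigma> x t)"
          unfolding m_def using 1 c\<sigma>t[OF t'] by (subst LINT_torus_eq_integral) (auto intro!: continuous_intros)
        also have "\<dots> = integral unit_box (\<lambda>x. (\<phi> x t - \<phi> x T) * \<sigma> x t)"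
          unfolding left_diff_distrib using 1 c\<sigma>t[OF t']
          by (intro integral_diff[symmetric] integrable_continuous continuous_intros)
        also have "\<bar>\<dots>\<bar> \<le> r / 2"
        proof (rule abs_integral_density_le)
          show "\<bar>\<phi> x t - \<phi> x T\<bar> \<le> r / 2" for x
            using d(2)[of t T x x] d(1) t by (auto simp: dist_real_def)
        qed (use 1 c\<sigma>t[OF t'] \<sigma>i[OF t'] \<sigma>0[OF t'] in \<open>auto intro!: continuous_intros\<close>)
        finally have "\<bar>m t - (LINT x:torus_dom|lborel. \<phi> x T * \<sigma> x t)\<bar> \<le> r / 2" .
        then show ?thesis using \<open>r > 0\<close> by (simp add: dist_real_def)
      qed
      then show "\<forall>\<^sub>F t in at_left T. dist (m t - (LINT x:torus_dom|lborel. \<phi> x T * \<sigma> x t)) 0 < r"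
        using \<open>T > 0\<close> \<open>d > 0\<close> by (intro eventually_at_leftI[of "max 0 (T - d)"]) auto
    qed
    ultimately show ?thesis using tendsto_add by fastforce
  qed
  have key: "integral {h..T - h} (\<lambda>t. (smooth_step ((t - h) / h) - smooth_step ((t - (T - 2 * h)) / h)) * e t)
      = integral {h..T - h} (\<lambda>t. tent ((t - (T - 2 * h)) / h) / h * m t) - integral {h..T - h} (\<lambda>t. tent ((t - h) / h) / h * m t)"
    if h: "0 < h" "4 * h < T" for h
  proof -
    define \<eta> where "\<eta> t = smooth_step ((t - h) / h) - smooth_step ((t - (T - 2 * h)) / h)" for t
    define \<eta>' where "\<eta>' t = tent ((t - h) / h) / h - tent ((t - (T - 2 * h)) / h) / h" for t
    have step: "((\<lambda>t. smooth_step ((t - a) / h)) has_real_derivative tent ((t - a) / h) / h) (at t)" for a t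
    proof -
      have "((\<lambda>t. (t - a) / h) has_real_derivative 1 / h) (at t)"
        using h by (auto intro!: derivative_eq_intros)
      from DERIV_chain2[OF smooth_step_deriv this] show ?thesis by simp
    qed
    have d\<eta>: "(\<eta> has_real_derivative \<eta>' t) (at t)" for t
      unfolding \<eta>_def[abs_def] \<eta>'_def by (intro DERIV_diff step)
    have c\<eta>: "continuous_on S \<eta>" for S
      using d\<eta> by (meson DERIV_isCont continuous_at_imp_continuous_on)
    have c\<eta>': "continuous_on S \<eta>'" for S
      unfolding \<eta>'_def using h by (intro continuous_intros tent_continuous) auto
    have out: "\<eta> t = 0 \<and> \<eta>' t = 0" if "t \<notin> {h..T - h}" for t
    proof (cases "t < h")
      case True
      then have "(t - h) / h \<le> 0" "(t - (T - 2 * h)) / h \<le> 0" using h by (auto simp: divide_le_0_iff)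
      then show ?thesis by (simp add: \<eta>_def \<eta>'_def smooth_step_simps tent_eq_0)
    next
      case False
      then have "(t - h) / h \<ge> 1" "(t - (T - 2 * h)) / h \<ge> 1" using h that by (auto simp: field_simps)
      then show ?thesis by (simp add: \<eta>_def \<eta>'_def smooth_step_simps tent_eq_0)
    qed
    have c\<eta>2: "continuous_on S (\<lambda>p. \<eta> (snd p))" "continuous_on S (\<lambda>p. \<eta>' (snd p))" for S :: "((real^'n) \<times> real) set"
      by (intro continuous_on_compose2[OF c\<eta>[of UNIV]] continuous_on_compose2[OF c\<eta>'[of UNIV]] continuous_intros; simp)+
    \<comment> \<open>The test function must be periodic for all real times, but \<open>\<phi>\<close> is controlled on \<open>[0,T]\<close> only.\<close>
    define \<psi> where "\<psi> x t = (if t \<in> ?I then \<eta> t * \<phi> x t else 0)" for x t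
    have C\<psi>: "C21_with ?I \<psi> (\<lambda>x t. \<eta>' t * \<phi> x t + \<eta> t * \<phi>t x t) (\<lambda>x t. \<eta> t *\<^sub>R d\<phi> x t) (\<lambda>x t. \<eta> t *\<^sub>R dd\<phi> x t)"
      unfolding C21_with_def
    proof (intro conjI allI ballI)
      fix x t assume t: "t \<in> ?I"
      note D = C21_withD[OF \<phi>(1) t, of x]
      have "((\<lambda>t. \<eta> t * \<phi> x t) has_real_derivative \<eta>' t * \<phi> x t + \<eta> t * \<phi>t x t) (at t)"
        by (auto intro!: derivative_eq_intros d\<eta> D(1))
      then show "(\<psi> x has_real_derivative \<eta>' t * \<phi> x t + \<eta> t * \<phi>t x t) (at t)"
        by (rule has_field_derivative_transform_within_open[of _ _ _ ?I]) (use t in \<open>auto simp: \<psi>_def\<close>)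
      show "((\<lambda>y. \<psi> y t) has_derivative (\<bullet>) (\<eta> t *\<^sub>R d\<phi> x t)) (at x)"
        using t unfolding \<psi>_def by (auto intro!: derivative_eq_intros D(2))
      show "((\<lambda>y. \<eta> t *\<^sub>R d\<phi> y t) has_derivative (*v) (\<eta> t *\<^sub>R dd\<phi> x t)) (at x)"
        using has_derivative_scaleR_right[OF D(3), of "\<eta> t"] by (simp add: scaleR_matrix_vector_assoc)
    next
      have "continuous_on (UNIV \<times> ?I) (\<lambda>(x, t). \<phi> x t)" by (rule continuous_on_subset[OF c\<phi>]) auto
      then show "continuous_on (UNIV \<times> ?I) (\<lambda>(x, t). \<eta>' t * \<phi> x t + \<eta> t * \<phi>t x t)"
        "continuous_on (UNIV \<times> ?I) (\<lambda>(x, t). \<eta> t *\<^sub>R d\<phi> x t)"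
        "continuous_on (UNIV \<times> ?I) (\<lambda>(x, t). \<eta> t *\<^sub>R dd\<phi> x t)"
        using C21_with_cont[OF \<phi>(1)] unfolding split_beta
        by (auto intro!: continuous_intros c\<eta>2)
    qed
    have "Zn_periodic (\<lambda>x. \<psi> x t)" for t
      using p\<phi>[of t] by (auto simp: \<psi>_def Zn_periodic_def)
    moreover have "\<exists>a b. 0 < a \<and> b < T \<and> (\<forall>x t. t \<notin> {a..b} \<longrightarrow> \<psi> x t = 0)"
      using h out by (intro exI[of _ h] exI[of _ "T - h"]) (auto simp: \<psi>_def)
    moreover have "C21_on \<psi> ?I" using C\<psi> C21_on_iff by blast
    ultimately have "(LINT (x, t):torus_dom \<times> ?I|lborel.
           (deriv (\<psi> x) t + grad (H x) (grad (\<lambda>y. W y t) x) \<bullet> grad (\<lambda>y. \<psi> y t) x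
             - \<epsilon> * laplacian (\<lambda>y. \<psi> y t) x) * \<sigma> x t) = 0"
      using adj unfolding adjoint_solution_def by blast
    also have "(LINT (x, t):torus_dom \<times> ?I|lborel.
           (deriv (\<psi> x) t + grad (H x) (grad (\<lambda>y. W y t) x) \<bullet> grad (\<lambda>y. \<psi> y t) x
             - \<epsilon> * laplacian (\<lambda>y. \<psi> y t) x) * \<sigma> x t)
        = (LINT (x, t):torus_dom \<times> ?I|lborel. \<eta>' t * (\<phi> x t * \<sigma> x t) + \<eta> t * (E x t * \<sigma> x t))"
      unfolding set_lebesgue_integral_def
      by (intro Bochner_Integration.integral_cong)
         (auto simp: indicator_def C21_with_eq[OF C\<psi>] b(2) E(1) algebra_simps sum_distrib_left)
    also have "\<dots> = integral {h..T - h} (\<lambda>t. integral unit_box (\<lambda>x. \<eta>' t * (\<phi> x t * \<sigma> x t) + \<eta> t * (E x t * \<sigma> x t)))"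
    proof (rule LINT_torus_time_eq_iterated)
      have "continuous_on (UNIV \<times> ?I) (\<lambda>(x, t). \<phi> x t * \<sigma> x t)" by (rule continuous_on_subset[OF c\<phi>\<sigma>]) auto
      then show "continuous_on (UNIV \<times> ?I) (\<lambda>(x, t). \<eta>' t * (\<phi> x t * \<sigma> x t) + \<eta> t * (E x t * \<sigma> x t))"
        using cE\<sigma> unfolding split_beta by (auto intro!: continuous_intros c\<eta>2)
    qed (use h out in auto)
    also have "\<dots> = integral {h..T - h} (\<lambda>t. (tent ((t - h) / h) / h * m t - tent ((t - (T - 2 * h)) / h) / h * m t) + \<eta> t * e t)"
    proof (rule integral_cong)
      fix t assume "t \<in> {h..T - h}"
      then have t: "t \<in> ?I" "t \<in> {0..<T}" using h by auto
      have "integral unit_box (\<lambda>x. \<eta>' t * (\<phi> x t * \<sigma> x t) + \<eta> t * (E x t * \<sigma> x t)) = \<eta>' t * m t + \<eta> t * e t"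
        unfolding m_def e_def
        using continuous_on_slice[OF c\<phi>\<sigma> t(2)] continuous_on_slice[OF cE\<sigma> t(1)]
        by (subst integral_add) (auto intro!: integrable_continuous continuous_on_mult_left)
      then show "integral unit_box (\<lambda>x. \<eta>' t * (\<phi> x t * \<sigma> x t) + \<eta> t * (E x t * \<sigma> x t))
         = (tent ((t - h) / h) / h * m t - tent ((t - (T - 2 * h)) / h) / h * m t) + \<eta> t * e t"
        by (simp add: \<eta>'_def left_diff_distrib)
    qed
    also have "\<dots> = integral {h..T - h} (\<lambda>t. tent ((t - h) / h) / h * m t)
         - integral {h..T - h} (\<lambda>t. tent ((t - (T - 2 * h)) / h) / h * m t) + integral {h..T - h} (\<lambda>t. \<eta> t * e t)"
    proof -
      have "continuous_on {h..T - h} m" "continuous_on {h..T - h} e"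
        using h by (auto intro: continuous_on_subset[OF cm] continuous_on_subset[OF ce])
      then have "(\<lambda>t. tent ((t - a) / h) / h * m t) integrable_on {h..T - h}" "(\<lambda>t. \<eta> t * e t) integrable_on {h..T - h}" for a
        using h by (auto intro!: integrable_continuous_interval continuous_intros tent_continuous c\<eta>)
      then show ?thesis by (simp only: integral_add integral_diff integrable_diff)
    qed
    finally show ?thesis unfolding \<eta>_def by simp
  qed
  define h where "h k = T / (real k + 5)" for k :: nat
  have h: "0 < h k" "4 * h k < T" for k
    using \<open>T > 0\<close> by (auto simp: h_def field_simps add_pos_nonneg)
  have hlim: "h \<longlonglongrightarrow> 0"
  proof -
    have "filterlim (\<lambda>k. real k + 5) at_top sequentially"
      by (rule filterlim_at_top_mono[OF filterlim_real_sequentially]) auto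
    from tendsto_divide_0[OF tendsto_const filterlim_at_top_imp_at_infinity[OF this]]
    show ?thesis unfolding h_def[abs_def] .
  qed
  define X where "X k t = smooth_step ((t - h k) / h k) - smooth_step ((t - (T - 2 * h k)) / h k)" for k t
  have X01: "0 \<le> X k t" "X k t \<le> 1" for k t
  proof -
    have "(t - (T - 2 * h k)) / h k \<le> (t - h k) / h k" using h[of k] by (intro divide_right_mono) auto
    then show "0 \<le> X k t" using smooth_step_mono by (simp add: X_def)
    show "X k t \<le> 1" using smooth_step_range[of "(t - h k) / h k"] smooth_step_range[of "(t - (T - 2 * h k)) / h k"] by (simp add: X_def)
  qed
  have Xcont: "continuous_on S (X k)" for S k
  proof -
    have "continuous_on UNIV smooth_step" using smooth_step_deriv by (meson DERIV_isCont continuous_at_imp_continuous_on)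
    then show ?thesis unfolding X_def using h[of k]
      by (auto intro!: continuous_intros continuous_on_compose2[of UNIV smooth_step])
  qed
  have Xout: "X k t = 0" if "t \<notin> {h k..T - h k}" for k t
  proof (cases "t < h k")
    case True
    then have "(t - h k) / h k \<le> 0" "(t - (T - 2 * h k)) / h k \<le> 0" using h[of k] by (auto simp: divide_le_0_iff)
    then show ?thesis by (simp add: X_def smooth_step_simps)
  next
    case False
    then have "(t - h k) / h k \<ge> 1" "(t - (T - 2 * h k)) / h k \<ge> 1" using h[of k] that by (auto simp: field_simps)
    then show ?thesis by (simp add: X_def smooth_step_simps)
  qed
  have 1: "(LINT t:?I|lborel. X k t * e t) = integral {h k..T - h k} (\<lambda>t. X k t * e t)" for k
  proof -
    have "continuous_on {h k..T - h k} e" by (rule continuous_on_subset[OF ce]) (use h[of k] in auto)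
    then have "set_integrable lborel {h k..T - h k} (\<lambda>t. X k t * e t)"
      unfolding set_integrable_def by (intro borel_integrable_compact continuous_intros Xcont) auto
    then have "(LINT t:{h k..T - h k}|lborel. X k t * e t) = integral {h k..T - h k} (\<lambda>t. X k t * e t)"
      by (rule set_borel_integral_eq_integral)
    moreover have "(LINT t:?I|lborel. X k t * e t) = (LINT t:{h k..T - h k}|lborel. X k t * e t)"
      unfolding set_lebesgue_integral_def using h[of k] Xout[of _ k]
      by (intro Bochner_Integration.integral_cong) (auto simp: indicator_def not_le)
    ultimately show ?thesis by simp
  qed
  have lim1: "(\<lambda>k. LINT t:?I|lborel. X k t * e t) \<longlonglongrightarrow> (LINT t:?I|lborel. e t)"
    unfolding set_lebesgue_integral_def
  proof (rule integral_dominated_convergence[where w="\<lambda>t. K * indicator ?I t"])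
    show "(\<lambda>t. indicator ?I t *\<^sub>R e t) \<in> borel_measurable lborel"
      using borel_measurable_continuous_on_indicator[OF _ ce] by simp
    show "(\<lambda>t. indicator ?I t *\<^sub>R (X k t * e t)) \<in> borel_measurable lborel" for k
      using borel_measurable_continuous_on_indicator[of ?I "\<lambda>t. X k t * e t"] ce Xcont
      by (simp add: continuous_on_mult)
    show "integrable lborel (\<lambda>t. K * indicator ?I t)"
      using \<open>T > 0\<close> by (intro integrable_mult_right integrable_real_indicator) auto
    show "AE t in lborel. (\<lambda>k. indicator ?I t *\<^sub>R (X k t * e t)) \<longlonglongrightarrow> indicator ?I t *\<^sub>R e t"
    proof (rule AE_I2)
      fix t
      show "(\<lambda>k. indicator ?I t *\<^sub>R (X k t * e t)) \<longlonglongrightarrow> indicator ?I t *\<^sub>R e t"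
      proof (cases "t \<in> ?I")
        case True
        have "\<forall>\<^sub>F k in sequentially. h k < min t (T - t) / 2"
          using True by (intro order_tendstoD(2)[OF hlim]) auto
        then have "\<forall>\<^sub>F k in sequentially. indicator ?I t *\<^sub>R (X k t * e t) = indicator ?I t *\<^sub>R e t"
        proof eventually_elim
          case (elim k)
          then have "(t - h k) / h k \<ge> 1" "(t - (T - 2 * h k)) / h k \<le> 0"
            using h[of k] by (auto simp: field_simps divide_le_0_iff)
          then show ?case by (simp add: X_def smooth_step_simps)
        qed
        then show ?thesis by (rule tendsto_eventually)
      qed simp
    qed
    show "AE t in lborel. norm (indicator ?I t *\<^sub>R (X k t * e t)) \<le> K * indicator ?I t" for k
    proof (rule AE_I2)
      fix t
      have "\<bar>X k t * e t\<bar> \<le> 1 * K" if "t \<in> ?I"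
        unfolding abs_mult using X01[of k t] K[OF that] by (intro mult_mono) auto
      then show "norm (indicator ?I t *\<^sub>R (X k t * e t)) \<le> K * indicator ?I t" by (auto simp: indicator_def)
    qed
  qed
  have cmk: "continuous_on {h k..T - h k} m" for k
    by (rule continuous_on_subset[OF cm]) (use h[of k] in auto)
  have lim2: "(\<lambda>k. integral {h k..T - h k} (\<lambda>t. tent ((t - h k) / h k) / h k * m t)) \<longlonglongrightarrow> m 0"
  proof (rule tendstoI)
    fix r :: real assume "r > 0"
    have "(m \<longlongrightarrow> m 0) (at 0 within {0..<T})" using cm \<open>T > 0\<close> by (auto simp: continuous_on)
    from tendstoD[OF this, of "r / 2"] obtain d where d: "d > 0" "\<And>t. t \<in> {0..<T} \<Longrightarrow> t \<noteq> 0 \<Longrightarrow> dist t 0 < d \<Longrightarrow> dist (m t) (m 0) < r / 2"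
      using \<open>r > 0\<close> unfolding eventually_at by auto
    have "\<forall>\<^sub>F k in sequentially. h k < d / 2" using d by (intro order_tendstoD(2)[OF hlim]) auto
    then show "\<forall>\<^sub>F k in sequentially. dist (integral {h k..T - h k} (\<lambda>t. tent ((t - h k) / h k) / h k * m t)) (m 0) < r"
    proof eventually_elim
      case (elim k)
      have "\<bar>integral {h k..T - h k} (\<lambda>t. tent ((t - h k) / h k) / h k * m t) - m 0\<bar> \<le> r / 2"
      proof (rule tent_average[OF cmk])
        fix t assume "h k \<le> t" "t \<le> h k + h k"
        then show "\<bar>m t - m 0\<bar> \<le> r / 2" using d(2)[of t] h[of k] elim by (auto simp: dist_real_def)
      qed (use h[of k] in auto)
      then show ?case using \<open>r > 0\<close> by (simp add: dist_real_def)
    qed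
  qed
  have lim3: "(\<lambda>k. integral {h k..T - h k} (\<lambda>t. tent ((t - (T - 2 * h k)) / h k) / h k * m t)) \<longlonglongrightarrow> \<phi> z T"
  proof (rule tendstoI)
    fix r :: real assume "r > 0"
    from tendstoD[OF mT, of "r / 2"] obtain d where d: "d > 0" "\<And>t. t < T \<Longrightarrow> dist t T < d \<Longrightarrow> dist (m t) (\<phi> z T) < r / 2"
      using \<open>r > 0\<close> unfolding eventually_at by auto
    have "\<forall>\<^sub>F k in sequentially. h k < d / 2" using d by (intro order_tendstoD(2)[OF hlim]) auto
    then show "\<forall>\<^sub>F k in sequentially. dist (integral {h k..T - h k} (\<lambda>t. tent ((t - (T - 2 * h k)) / h k) / h k * m t)) (\<phi> z T) < r"
    proof eventually_elim
      case (elim k)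
      have "\<bar>integral {h k..T - h k} (\<lambda>t. tent ((t - (T - 2 * h k)) / h k) / h k * m t) - \<phi> z T\<bar> \<le> r / 2"
      proof (rule tent_average[OF cmk])
        fix t assume "T - 2 * h k \<le> t" "t \<le> T - 2 * h k + h k"
        then show "\<bar>m t - \<phi> z T\<bar> \<le> r / 2" using d(2)[of t] h[of k] elim by (auto simp: dist_real_def)
      qed (use h[of k] in auto)
      then show ?case using \<open>r > 0\<close> by (simp add: dist_real_def)
    qed
  qed
  have "(LINT t:?I|lborel. e t) = \<phi> z T - m 0"
  proof (rule LIMSEQ_unique[OF lim1])
    show "(\<lambda>k. LINT t:?I|lborel. X k t * e t) \<longlonglongrightarrow> \<phi> z T - m 0"
      unfolding 1 unfolding X_def key[OF h] by (intro tendsto_diff lim2 lim3)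
  qed
  moreover have "(LINT t:?I|lborel. e t) = (LINT t:?I|lborel. LINT x:torus_dom|lborel. E x t * \<sigma> x t)"
    unfolding set_lebesgue_integral_def[of _ ?I]
    by (intro Bochner_Integration.integral_cong) (auto simp: indicator_def e_eq)
  moreover have "m 0 = (LINT x:torus_dom|lborel. \<phi> x 0 * \<sigma> x 0)" using \<open>T > 0\<close> by (intro m_eq) auto
  ultimately show ?thesis by simp
qed

section \<open>Transport of functions of class \<open>C\<^sup>2\<^sup>,\<^sup>1\<close>\<close>

lemma moving_integral_deriv:
  fixes g :: "real \<Rightarrow> 'b::euclidean_space"
  assumes g: "continuous_on {0<..} g" and "t > 0" "h > 0"
  shows "((\<lambda>t. integral {0..h} (\<lambda>s. g (t + s))) has_vector_derivative g (t + h) - g t) (at t)"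
proof -
  define a b where "a = t / 2" and "b = t + h + 1"
  define G where "G r = integral {a..r} g" for r
  have cg: "continuous_on {a..b} g" by (rule continuous_on_subset[OF g]) (use \<open>t > 0\<close> in \<open>auto simp: a_def\<close>)
  have G: "(G has_vector_derivative g r) (at r)" if "r \<in> {a<..<b}" for r
    using integral_has_vector_derivative[OF cg, of r] that at_within_interior[of r "{a..b}"]
    by (auto simp: G_def[abs_def])
  have eq: "G (r + h) - G r = integral {0..h} (\<lambda>s. g (r + s))" if "r \<in> {a<..<t+1}" for r
  proof -
    have "integral {0..h} (g \<circ> (\<lambda>s. s + r)) = integral {0 + r..h + r} g"
      by (rule integral_shift, rule continuous_on_subset[OF cg]) (use that in \<open>auto simp: b_def\<close>)
    moreover have "integral {a..r} g + integral {r..r + h} g = integral {a..r + h} g"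
      using that \<open>h > 0\<close>
      by (intro Henstock_Kurzweil_Integration.integral_combine integrable_continuous_interval continuous_on_subset[OF cg]) (auto simp: b_def)
    ultimately show ?thesis unfolding G_def o_def by (simp add: add.commute eq_diff_eq diff_eq_eq)
  qed
  have "((\<lambda>r. G (r + h)) has_vector_derivative g (t + h)) (at t)"
  proof -
    have "((\<lambda>r. r + h) has_vector_derivative 1) (at t)"
      by (auto intro!: derivative_eq_intros)
    from vector_diff_chain_at[OF this G] show ?thesis
      using \<open>t > 0\<close> \<open>h > 0\<close> by (auto simp: a_def b_def o_def)
  qed
  moreover have "(G has_vector_derivative g t) (at t)" using \<open>t > 0\<close> \<open>h > 0\<close> by (intro G) (auto simp: a_def b_def)
  ultimately have "((\<lambda>r. G (r + h) - G r) has_vector_derivative g (t + h) - g t) (at t)"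
    by (rule has_vector_derivative_diff)
  then show ?thesis
    by (rule has_vector_derivative_transform_within_open[of _ _ _ "{a<..<t+1}"]) (use \<open>t > 0\<close> eq in \<open>auto simp: a_def\<close>)
qed

lemma time_average_continuous:
  fixes f :: "'a::metric_space \<Rightarrow> real \<Rightarrow> 'b::banach"
  assumes f: "continuous_on (UNIV \<times> {0<..}) (\<lambda>(x, t). f x t)" and \<tau>: "\<tau> > 0"
  shows "continuous_on (UNIV \<times> {0..}) (\<lambda>(x, t). integral {0..h} (\<lambda>s. f x (t + \<tau> + s)))"
proof -
  have "continuous_on ((UNIV \<times> {0..}) \<times> cbox 0 h) (\<lambda>p. (\<lambda>(x, t). f x t) (fst (fst p), snd (fst p) + \<tau> + snd p))"
    by (rule continuous_on_compose2[OF f]) (use \<tau> in \<open>auto intro!: continuous_intros\<close>)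
  then have "continuous_on ((UNIV \<times> {0..}) \<times> cbox 0 h) (\<lambda>(p, s). f (fst p) (snd p + \<tau> + s))"
    by (simp add: split_beta)
  from integral_continuous_on_param[OF this] show ?thesis by (simp add: split_beta cbox_interval)
qed

text \<open>
  Averaging over \<open>[t+\<tau>,t+\<tau>+h]\<close> gains a continuous time derivative, namely a difference of values, while
  the space derivative passes under the integral. Thus continuity of \<open>f\<close> and of its space derivative is
  enough for an average of class \<open>C\<^sup>1\<close>.
\<close>

lemma time_average_C1:
  fixes f :: "real^'n \<Rightarrow> real \<Rightarrow> 'b::euclidean_space"
  assumes f: "continuous_on (UNIV \<times> {0<..}) (\<lambda>(x, t). f x t)"
    and fx: "\<And>x t. t > 0 \<Longrightarrow> ((\<lambda>x. f x t) has_derivative blinfun_apply (fx x t)) (at x)"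
    and cfx: "continuous_on (UNIV \<times> {0<..}) (\<lambda>(x, t). fx x t)" and \<tau>: "\<tau> > 0" and h: "h > 0"
  defines "A \<equiv> \<lambda>x t. integral {0..h} (\<lambda>s. f x (t + \<tau> + s))"
  shows "t \<ge> 0 \<Longrightarrow> ((\<lambda>x. A x t) has_derivative blinfun_apply (integral {0..h} (\<lambda>s. fx x (t + \<tau> + s)))) (at x)"
    "t \<ge> 0 \<Longrightarrow> (A x has_vector_derivative f x (t + \<tau> + h) - f x (t + \<tau>)) (at t)"
    "C1_on (\<lambda>(x, t). A x t) (UNIV \<times> {0..T})"
    "t \<in> {0..T} \<Longrightarrow> ((\<lambda>(x, t). A x t) has_derivative
       (\<lambda>(y, k). blinfun_apply (integral {0..h} (\<lambda>s. fx x (t + \<tau> + s))) y + k *\<^sub>R (f x (t + \<tau> + h) - f x (t + \<tau>)))) (at (x, t) within UNIV \<times> {0..T})"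
proof -
  have c1: "continuous_on {0<..} (f x)" for x
  proof -
    have "continuous_on {0<..} (\<lambda>t. (\<lambda>(x, t). f x t) (x, t))"
      by (rule continuous_on_compose2[OF f]) (auto intro!: continuous_intros)
    then show ?thesis by simp
  qed
  show 1: "((\<lambda>x. A x t) has_derivative blinfun_apply (integral {0..h} (\<lambda>s. fx x (t + \<tau> + s)))) (at x)" if t: "t \<ge> 0" for t x
  proof -
    have "((\<lambda>x. integral (cbox 0 h) (\<lambda>s. f x (t + \<tau> + s))) has_derivative blinfun_apply (integral (cbox 0 h) (\<lambda>s. fx x (t + \<tau> + s)))) (at x within UNIV)"
    proof (rule leibniz_rule)
      show "((\<lambda>x. f x (t + \<tau> + s)) has_derivative blinfun_apply (fx x (t + \<tau> + s))) (at x within UNIV)" if "s \<in> cbox 0 h" for x s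
        using fx[of "t + \<tau> + s" x] that t \<tau> by auto
      show "(\<lambda>s. f x (t + \<tau> + s)) integrable_on cbox 0 h" for x
        by (intro integrable_continuous continuous_on_compose2[OF c1[of x]]) (use t \<tau> in \<open>auto intro!: continuous_intros\<close>)
      have "continuous_on (UNIV \<times> cbox 0 h) (\<lambda>p. (\<lambda>(x, t). fx x t) (fst p, t + \<tau> + snd p))"
        by (rule continuous_on_compose2[OF cfx]) (use t \<tau> in \<open>auto intro!: continuous_intros\<close>)
      then show "continuous_on (UNIV \<times> cbox 0 h) (\<lambda>(x, s). fx x (t + \<tau> + s))" by (simp add: split_beta)
    qed auto
    then show ?thesis unfolding A_def by (simp add: cbox_interval)
  qed
  show 2: "(A x has_vector_derivative f x (t + \<tau> + h) - f x (t + \<tau>)) (at t)" if t: "t \<ge> 0" for t x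
  proof -
    have "((\<lambda>t. t + \<tau>) has_vector_derivative 1) (at t)" by (auto intro!: derivative_eq_intros)
    from vector_diff_chain_at[OF this moving_integral_deriv[OF c1[of x] _ h]] show ?thesis
      using t \<tau> by (simp add: A_def[abs_def] o_def)
  qed
  have c3: "continuous_on (UNIV \<times> {0..T}) (\<lambda>(x, t). integral {0..h} (\<lambda>s. fx x (t + \<tau> + s)))"
    by (rule continuous_on_subset[OF time_average_continuous[OF cfx \<tau>]]) auto
  have c4: "continuous_on (UNIV \<times> {0..T}) (\<lambda>(x, t). f x (t + \<tau> + h) - f x (t + \<tau>))"
  proof -
    have "continuous_on (UNIV \<times> {0..T}) (\<lambda>p. (\<lambda>(x, t). f x t) (fst p, snd p + \<tau> + h) - (\<lambda>(x, t). f x t) (fst p, snd p + \<tau>))"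
      by (intro continuous_on_diff; rule continuous_on_compose2[OF f]) (use h \<tau> in \<open>auto intro!: continuous_intros\<close>)
    then show ?thesis by (simp add: split_beta)
  qed
  show "C1_on (\<lambda>(x, t). A x t) (UNIV \<times> {0..T})"
    by (rule C1_on_partials(2)[OF 1 2 c3 c4]) auto
  show "((\<lambda>(x, t). A x t) has_derivative
       (\<lambda>(y, k). blinfun_apply (integral {0..h} (\<lambda>s. fx x (t + \<tau> + s))) y + k *\<^sub>R (f x (t + \<tau> + h) - f x (t + \<tau>)))) (at (x, t) within UNIV \<times> {0..T})"
    if "t \<in> {0..T}" for x t
    by (rule C1_on_partials(1)[OF 1 2 c3 c4]) (use that in auto)
qed

lemma C21_with_continuous:
  assumes C: "C21_with I w wt dw ddw" and "convex I"
  shows "t \<in> I \<Longrightarrow> ((\<lambda>(x, t). w x t) has_derivative (\<lambda>(h, k). dw x t \<bullet> h + k * wt x t)) (at (x, t) within UNIV \<times> I)"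
    "continuous_on (UNIV \<times> I) (\<lambda>(x, t). w x t)" "C1_on (\<lambda>(x, t). w x t) (UNIV \<times> I)"
proof -
  have 1: "((\<lambda>x. w x t) has_derivative blinfun_apply (blinfun_inner_right (dw x t))) (at x)" if "t \<in> I" for x t
    using C21_withD(2)[OF C that] by simp
  have 2: "(w x has_vector_derivative wt x t) (at t)" if "t \<in> I" for x t
    using C21_withD(1)[OF C that] by (simp add: has_real_derivative_iff_has_vector_derivative)
  have 3: "continuous_on (UNIV \<times> I) (\<lambda>(x, t). blinfun_inner_right (dw x t))"
    using bounded_linear.continuous_on[OF bounded_linear_blinfun_inner_right C21_with_cont(2)[OF C]]
    by (simp add: split_beta)
  show D: "((\<lambda>(x, t). w x t) has_derivative (\<lambda>(h, k). dw x t \<bullet> h + k * wt x t)) (at (x, t) within UNIV \<times> I)"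
    if "t \<in> I" for x t
  proof -
    have "((\<lambda>(x, t). w x t) has_derivative (\<lambda>(h, k). blinfun_inner_right (dw x t) h + k *\<^sub>R wt x t)) (at (x, t) within UNIV \<times> I)"
      by (rule C1_on_partials(1)[OF 1 2 3 C21_with_cont(1)[OF C] \<open>convex I\<close>]) (use that in auto)
    then show ?thesis by simp
  qed
  show "continuous_on (UNIV \<times> I) (\<lambda>(x, t). w x t)"
    unfolding continuous_on_eq_continuous_within using has_derivative_continuous[OF D] by auto
  show "C1_on (\<lambda>(x, t). w x t) (UNIV \<times> I)"
    by (rule C1_on_partials(2)[OF 1 2 3 C21_with_cont(1)[OF C] \<open>convex I\<close>])
qed

lemma continuous_on_time_shift:
  fixes f :: "'a::topological_space \<Rightarrow> real \<Rightarrow> 'b::topological_space"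
  assumes "continuous_on (UNIV \<times> {0<..}) (\<lambda>(x, t). f x t)" "\<tau> > 0"
  shows "continuous_on (UNIV \<times> {0..}) (\<lambda>(x, t). f x (t + \<tau>))"
proof -
  have "continuous_on (UNIV \<times> {0..}) (\<lambda>p. (\<lambda>(x, t). f x t) (fst p, snd p + \<tau>))"
    by (rule continuous_on_compose2[OF assms(1)]) (use assms(2) in \<open>auto intro!: continuous_intros\<close>)
  then show ?thesis by (simp add: split_beta)
qed

lemma C1_on_time_shift:
  fixes w :: "real^'n \<Rightarrow> real \<Rightarrow> real"
  assumes C: "C21_with {0<..} w wt dw ddw" and \<tau>: "\<tau> > 0"
  shows "C1_on (\<lambda>(x, t). w x (t + \<tau>)) (UNIV \<times> {0..T})"
proof (rule C1_on_partials(2))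
  show "((\<lambda>x. w x (t + \<tau>)) has_derivative blinfun_apply (blinfun_inner_right (dw x (t + \<tau>)))) (at x)" if "t \<in> {0..T}" for x t
    using C21_withD(2)[OF C, of "t + \<tau>"] that \<tau> by simp
  show "((\<lambda>t. w x (t + \<tau>)) has_vector_derivative wt x (t + \<tau>)) (at t)" if "t \<in> {0..T}" for x t
    using C21_withD(1)[OF C, of "t + \<tau>" x] that \<tau> DERIV_shift[of "w x" "wt x (t + \<tau>)" t \<tau>]
    by (simp add: has_real_derivative_iff_has_vector_derivative)
  have "continuous_on (UNIV \<times> {0..T}) (\<lambda>(x, t). dw x (t + \<tau>))"
    by (rule continuous_on_subset[OF continuous_on_time_shift[OF C21_with_cont(2)[OF C] \<tau>]]) auto
  from bounded_linear.continuous_on[OF bounded_linear_blinfun_inner_right this]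
  show "continuous_on (UNIV \<times> {0..T}) (\<lambda>(x, t). blinfun_inner_right (dw x (t + \<tau>)))"
    by (simp add: split_beta)
  show "continuous_on (UNIV \<times> {0..T}) (\<lambda>(x, t). wt x (t + \<tau>))"
    by (rule continuous_on_subset[OF continuous_on_time_shift[OF C21_with_cont(1)[OF C] \<tau>]]) auto
qed auto

text \<open>
  The gradient of the average of \<open>w\<close> is the average of \<open>dw\<close>, and its time derivative is a difference of
  values of \<open>w\<close>. Both are \<open>C\<^sup>1\<close>, although \<open>w\<^sub>t\<close> itself need not be differentiable.
\<close>

lemma time_average_C2:
  fixes w :: "real^'n \<Rightarrow> real \<Rightarrow> real"
  assumes C: "C21_with {0<..} w wt dw ddw" and \<tau>: "\<tau> > 0" and h: "h > 0" and "T > 0"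
  defines "W \<equiv> \<lambda>x t. integral {0..h} (\<lambda>s. w x (t + \<tau> + s))"
  shows "C2_on (\<lambda>(x, t). W x t) (UNIV \<times> {0..T})"
    "t \<in> {0..T} \<Longrightarrow> vector_derivative (W x) (at t within {0..T}) = integral {0..h} (\<lambda>s. wt x (t + \<tau> + s))"
    "t \<in> {0..T} \<Longrightarrow> grad (\<lambda>y. W y t) x = integral {0..h} (\<lambda>s. dw x (t + \<tau> + s))"
proof -
  have cw: "continuous_on (UNIV \<times> {0<..}) (\<lambda>(x, t). w x t)"
    by (rule C21_with_continuous(2)[OF C]) auto
  have dw: "((\<lambda>x. w x t) has_derivative blinfun_apply (blinfun_inner_right (dw x t))) (at x)" if "t > 0" for x t
    using C21_withD(2)[OF C, of t] that by simp
  have cdw: "continuous_on (UNIV \<times> {0<..}) (\<lambda>(x, t). blinfun_inner_right (dw x t))"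
    using bounded_linear.continuous_on[OF bounded_linear_blinfun_inner_right C21_with_cont(2)[OF C]]
    by (simp add: split_beta)
  have ddw: "((\<lambda>x. dw x t) has_derivative blinfun_apply (Blinfun ((*v) (ddw x t)))) (at x)" if "t > 0" for x t
    using C21_withD(3)[OF C, of t] that by (simp add: bounded_linear_Blinfun_apply)
  have cddw: "continuous_on (UNIV \<times> {0<..}) (\<lambda>(x, t). Blinfun ((*v) (ddw x t)))"
    unfolding split_beta
  proof (rule continuous_on_blinfun_componentwise)
    fix i :: "real^'n"
    show "continuous_on (UNIV \<times> {0<..}) (\<lambda>p. blinfun_apply (Blinfun ((*v) (ddw (fst p) (snd p)))) i)"
      using C21_with_cont(3)[OF C] unfolding split_beta
      by (simp add: bounded_linear_Blinfun_apply matrix_vector_mult_def) (intro continuous_intros)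
  qed
  have W1: "((\<lambda>x. W x t) has_derivative blinfun_apply (integral {0..h} (\<lambda>s. blinfun_inner_right (dw x (t + \<tau> + s))))) (at x)"
    and W2: "(W x has_vector_derivative w x (t + \<tau> + h) - w x (t + \<tau>)) (at t)" if "t \<ge> 0" for x t
    unfolding W_def
    by (rule time_average_C1(1)[OF cw dw cdw \<tau> h] time_average_C1(2)[OF cw dw cdw \<tau> h]; use that in simp)+
  have W4: "((\<lambda>(x, t). W x t) has_derivative (\<lambda>(y, k).
       blinfun_apply (integral {0..h} (\<lambda>s. blinfun_inner_right (dw x (t + \<tau> + s)))) y
         + k *\<^sub>R (w x (t + \<tau> + h) - w x (t + \<tau>)))) (at (x, t) within UNIV \<times> {0..T})" if "t \<in> {0..T}" for x t
    unfolding W_def by (rule time_average_C1(4)[OF cw dw cdw \<tau> h]) (use that in simp)+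
  have D3: "C1_on (\<lambda>(x, t). integral {0..h} (\<lambda>s. dw x (t + \<tau> + s))) (UNIV \<times> {0..T})"
    by (rule time_average_C1(3)[OF C21_with_cont(2)[OF C] ddw cddw \<tau> h])
  have slice: "continuous_on {0..h} (\<lambda>s. f x (t + \<tau> + s))"
    if "continuous_on (UNIV \<times> {0<..}) (\<lambda>(x, t). f x t)" "t \<ge> 0" for f :: "real^'n \<Rightarrow> real \<Rightarrow> 'z::topological_space" and x t
  proof -
    have "continuous_on {0..h} (\<lambda>s. (\<lambda>(x, t). f x t) (x, t + \<tau> + s))"
      by (rule continuous_on_compose2[OF that(1)]) (use that(2) \<tau> in \<open>auto intro!: continuous_intros\<close>)
    then show ?thesis by simp
  qed
  have int: "integral {0..h} (\<lambda>s. blinfun_inner_right (dw x (t + \<tau> + s))) = blinfun_inner_right (integral {0..h} (\<lambda>s. dw x (t + \<tau> + s)))"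
    if "t \<ge> 0" for x t
    using integral_linear[OF integrable_continuous_interval[OF slice[OF C21_with_cont(2)[OF C] that]] bounded_linear_blinfun_inner_right]
    by (simp add: o_def)
  have fst_inj: "bounded_linear (\<lambda>p::real^'n. (p, 0::real))" and snd_inj: "bounded_linear (\<lambda>q::real. (0::real^'n, q))"
    by (intro bounded_linear_Pair bounded_linear_ident bounded_linear_zero)+
  \<comment> \<open>The gradient in \<open>(x,t)\<close> as a sum of two linear images of \<open>C\<^sup>1\<close> functions.\<close>
  have C1: "C1_on (\<lambda>p. (\<lambda>p::real^'n. (p, 0::real)) ((\<lambda>(x, t). integral {0..h} (\<lambda>s. dw x (t + \<tau> + s))) p)
      + (\<lambda>q::real. (0::real^'n, q)) ((\<lambda>(x, t). w x (t + (\<tau> + h))) p + (- 1) * (\<lambda>(x, t). w x (t + \<tau>)) p)) (UNIV \<times> {0..T})"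
    using \<tau> h
    by (intro C1_on_add C1_on_bounded_linear[OF _ fst_inj] C1_on_bounded_linear[OF _ snd_inj] D3
          C1_on_bounded_linear[OF C1_on_time_shift[OF C \<tau>] bounded_linear_mult_right] C1_on_time_shift[OF C]) auto
  show "C2_on (\<lambda>(x, t). W x t) (UNIV \<times> {0..T})"
  proof (rule C2_on_gradient[OF _ C1])
    fix p :: "(real^'n) \<times> real" assume "p \<in> UNIV \<times> {0..T}"
    then obtain x t where p: "p = (x, t)" "t \<in> {0..T}" by auto
    show "((\<lambda>(x, t). W x t) has_derivative
       (\<lambda>h'. ((\<lambda>p::real^'n. (p, 0::real)) ((\<lambda>(x, t). integral {0..h} (\<lambda>s. dw x (t + \<tau> + s))) p)
      + (\<lambda>q::real. (0::real^'n, q)) ((\<lambda>(x, t). w x (t + (\<tau> + h))) p + (- 1) * (\<lambda>(x, t). w x (t + \<tau>)) p)) \<bullet> h')) (at p within UNIV \<times> {0..T})"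
      unfolding p(1)
      by (rule has_derivative_eq_rhs[OF W4[OF p(2)]])
         (use p(2) in \<open>auto simp: fun_eq_iff int add.assoc[of t \<tau> h] mult.commute\<close>)
  qed
  show "grad (\<lambda>y. W y t) x = integral {0..h} (\<lambda>s. dw x (t + \<tau> + s))" if "t \<in> {0..T}"
    using W1[of t x] that by (intro grad_eqI) (simp add: int)
  show "vector_derivative (W x) (at t within {0..T}) = integral {0..h} (\<lambda>s. wt x (t + \<tau> + s))" if t: "t \<in> {0..T}"
  proof -
    have "vector_derivative (W x) (at t within {0..T}) = w x (t + \<tau> + h) - w x (t + \<tau>)"
      using W2[of t x] t \<open>T > 0\<close>
      by (intro vector_derivative_within_closed_interval) (auto simp: has_vector_derivative_at_within)
    also have "((\<lambda>s. wt x (t + \<tau> + s)) has_integral w x (t + \<tau> + h) - w x (t + \<tau> + 0)) {0..h}"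
    proof (rule fundamental_theorem_of_calculus)
      show "((\<lambda>s. w x (t + \<tau> + s)) has_vector_derivative wt x (t + \<tau> + s)) (at s within {0..h})" if "s \<in> {0..h}" for s
        using C21_withD(1)[OF C, of "t + \<tau> + s" x] that t \<tau> DERIV_shift[of "w x" "wt x (t + \<tau> + s)" s "t + \<tau>"]
        by (simp add: has_real_derivative_iff_has_vector_derivative has_vector_derivative_at_within add.commute add.left_commute)
    qed (use h in auto)
    then have "w x (t + \<tau> + h) - w x (t + \<tau>) = integral {0..h} (\<lambda>s. wt x (t + \<tau> + s))"
      by (simp add: integral_unique)
    finally show ?thesis .
  qed
qed

lemma average_tendsto:
  fixes g :: "real \<Rightarrow> real"
  assumes g: "continuous_on {0..1} g"
  shows "(\<lambda>k. real (Suc k) * integral {0..1 / real (Suc k)} g) \<longlonglongrightarrow> g 0"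
proof -
  have "((\<lambda>u. integral {0..u} g) has_real_derivative g 0) (at 0 within {0..1})"
    using integral_has_vector_derivative[OF g, of 0] by (simp add: has_real_derivative_iff_has_vector_derivative)
  then have "((\<lambda>u. integral {0..u} g / u) \<longlongrightarrow> g 0) (at 0 within {0..1})"
    by (simp add: has_field_derivative_iff)
  moreover have "filterlim (\<lambda>k. 1 / real (Suc k)) (at 0 within {0..1}) sequentially"
    unfolding filterlim_at
    using LIMSEQ_inverse_real_of_nat by (auto intro!: always_eventually simp: inverse_eq_divide)
  ultimately have "(\<lambda>k. integral {0..1 / real (Suc k)} g / (1 / real (Suc k))) \<longlonglongrightarrow> g 0"
    by (rule filterlim_compose)
  then show ?thesis by (simp add: mult.commute)
qed

lemma abs_average_le:
  fixes g :: "real \<Rightarrow> real"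
  assumes g: "continuous_on {0..1} g" "\<And>s. s \<in> {0..1} \<Longrightarrow> \<bar>g s\<bar> \<le> B"
  shows "\<bar>real (Suc k) * integral {0..1 / real (Suc k)} g\<bar> \<le> B"
proof -
  have "norm (integral {0..1 / real (Suc k)} g) \<le> B * (1 / real (Suc k) - 0)"
  proof (rule integral_bound)
    have 1: "{0..1 / real (Suc k)} \<subseteq> {0..1::real}" by (auto intro: order_trans)
    show "continuous_on {0..1 / real (Suc k)} g" by (rule continuous_on_subset[OF g(1) 1])
    show "norm (g t) \<le> B" if "t \<in> {0..1 / real (Suc k)}" for t
      using g(2)[OF subsetD[OF 1 that]] by simp
  qed simp
  then have "real (Suc k) * \<bar>integral {0..1 / real (Suc k)} g\<bar> \<le> real (Suc k) * (B * (1 / real (Suc k)))"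
    by (intro mult_left_mono) auto
  then show ?thesis by (simp add: abs_mult del: of_nat_Suc)
qed

text \<open>
  The defining identity of the transport class is available for jointly \<open>C\<^sup>2\<close> functions. It is applied to
  the averages of \<open>w\<close> over \<open>[t+\<tau>,t+\<tau>+h]\<close>, with \<open>h = 1/(k+1)\<close>; as \<open>k \<rightarrow> \<infinity>\<close> all terms converge boundedly.
  The shift by \<open>\<tau>\<close> keeps the times in the range where \<open>w\<close> is differentiable.
\<close>

lemma transport_from_C21:
  fixes w :: "real^'n \<Rightarrow> real \<Rightarrow> real"
  assumes \<gamma>: "\<gamma> \<in> transport_from C T z \<sigma>\<^sub>0" and \<sigma>0: "\<sigma>\<^sub>0 \<in> torus_probs" and T: "T > 0"
    and w: "C21_with {0<..} w wt dw ddw" and per: "\<And>t. t > 0 \<Longrightarrow> Zn_periodic (\<lambda>x. w x t)" and \<tau>: "\<tau> > 0"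
  shows "(\<integral>(x, v, t). wt x (t + \<tau>) + v \<bullet> dw x (t + \<tau>) \<partial>\<gamma>) = w z (T + \<tau>) - (\<integral>x. w x \<tau> \<partial>\<sigma>\<^sub>0)"
proof -
  have \<gamma>r: "\<gamma> \<in> radon_measures (phase C T)" using \<gamma> by (simp add: transport_from_def)
  have \<sigma>r: "\<sigma>\<^sub>0 \<in> radon_measures torus_dom" using \<sigma>0 by (simp add: torus_probs_def)
  note space = radon_measures_space[OF \<gamma>r] radon_measures_space[OF \<sigma>r]
  have fin: "finite_measure \<gamma>" "finite_measure \<sigma>\<^sub>0" using \<gamma>r \<sigma>r by (auto simp: radon_measures_def)
  have cw: "continuous_on (UNIV \<times> {0<..}) (\<lambda>(x, t). w x t)"
    by (rule C21_with_continuous(2)[OF w]) auto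
  note cont = cw C21_with_cont(1,2)[OF w]
  have pers: "Zn_periodic (\<lambda>x. wt x t)" "Zn_periodic (\<lambda>x. dw x t)" if "t > 0" for t
    using C21_with_periodic[OF w per] that by auto
  let ?J = "{\<tau>..T + \<tau> + 1}"
  have J: "?J \<subseteq> {0<..}" using \<tau> by auto
  have contJ: "continuous_on (UNIV \<times> ?J) (\<lambda>(x, t). w x t)" "continuous_on (UNIV \<times> ?J) (\<lambda>(x, t). wt x t)"
    "continuous_on (UNIV \<times> ?J) (\<lambda>(x, t). dw x t)"
    using cont J by (auto elim!: continuous_on_subset)
  have perJ: "Zn_periodic (\<lambda>x. w x t)" "Zn_periodic (\<lambda>x. wt x t)" "Zn_periodic (\<lambda>x. dw x t)" if "t \<in> ?J" for t
    using that J per pers by auto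
  obtain Kw where Kw: "\<And>x t. t \<in> ?J \<Longrightarrow> norm (w x t) \<le> Kw"
    using periodic_bounded[OF contJ(1) compact_Icc perJ(1)] by metis
  obtain Kt where Kt: "\<And>x t. t \<in> ?J \<Longrightarrow> norm (wt x t) \<le> Kt"
    using periodic_bounded[OF contJ(2) compact_Icc perJ(2)] by metis
  obtain Kd where Kd: "0 \<le> Kd" "\<And>x t. t \<in> ?J \<Longrightarrow> norm (dw x t) \<le> Kd"
    using periodic_bounded[OF contJ(3) compact_Icc perJ(3)] by metis
  define h where "h k = 1 / real (Suc k)" for k
  have h: "h k > 0" "h k \<le> 1" for k by (auto simp: h_def)
  have slice: "continuous_on {0..1} (\<lambda>s. f x (t + \<tau> + s))"
    if "continuous_on (UNIV \<times> {0<..}) (\<lambda>(x, t). f x t)" "t \<ge> 0" for f :: "real^'n \<Rightarrow> real \<Rightarrow> 'z::topological_space" and x t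
  proof -
    have "continuous_on {0..1} (\<lambda>s. (\<lambda>(x, t). f x t) (x, t + \<tau> + s))"
      by (rule continuous_on_compose2[OF that(1)]) (use that(2) \<tau> in \<open>auto intro!: continuous_intros\<close>)
    then show ?thesis by simp
  qed
  define S where "S k x v t = real (Suc k) * (integral {0..h k} (\<lambda>s. wt x (t + \<tau> + s)) + v \<bullet> integral {0..h k} (\<lambda>s. dw x (t + \<tau> + s)))"
    for k x v t
  have S_eq: "S k x v t = real (Suc k) * integral {0..1 / real (Suc k)} (\<lambda>s. wt x (t + \<tau> + s) + v \<bullet> dw x (t + \<tau> + s))"
    if "t \<ge> 0" for k x v t
  proof -
    have int: "(\<lambda>s. wt x (t + \<tau> + s)) integrable_on {0..h k}" "(\<lambda>s. dw x (t + \<tau> + s)) integrable_on {0..h k}"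
      using h[of k]
      by (auto intro!: integrable_continuous_interval continuous_on_subset[OF slice[OF cont(2) that]]
            continuous_on_subset[OF slice[OF cont(3) that]])
    have "(\<lambda>s. v \<bullet> dw x (t + \<tau> + s)) integrable_on {0..h k}"
      using integrable_linear[OF int(2) bounded_linear_inner_right] by (simp add: o_def)
    then show ?thesis
      using integral_linear[OF int(2) bounded_linear_inner_right, of v] int(1)
      unfolding S_def h_def o_def by (simp add: integral_add del: of_nat_Suc)
  qed
  have S_bound: "\<bar>S k x v t\<bar> \<le> Kt + C * Kd" and S_lim: "(\<lambda>k. S k x v t) \<longlonglongrightarrow> wt x (t + \<tau>) + v \<bullet> dw x (t + \<tau>)"
    if "(x, v, t) \<in> phase C T" for k x v t
  proof -
    have v: "norm v \<le> C" and t: "0 \<le> t" "t \<le> T" using that by (auto simp: phase_def)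
    have g: "continuous_on {0..1} (\<lambda>s. wt x (t + \<tau> + s) + v \<bullet> dw x (t + \<tau> + s))"
      using slice[OF cont(2) t(1)] slice[OF cont(3) t(1)] by (intro continuous_intros)
    have "\<bar>wt x (t + \<tau> + s) + v \<bullet> dw x (t + \<tau> + s)\<bar> \<le> Kt + C * Kd" if "s \<in> {0..1}" for s
    proof -
      have J: "t + \<tau> + s \<in> ?J" using that t by auto
      have "\<bar>v \<bullet> dw x (t + \<tau> + s)\<bar> \<le> norm v * norm (dw x (t + \<tau> + s))" by (rule Cauchy_Schwarz_ineq2)
      also have "\<dots> \<le> C * Kd" using v Kd(2)[OF J] Kd(1) by (intro mult_mono) (auto intro: order_trans[OF norm_ge_zero])
      finally show ?thesis using Kt[OF J, of x] by simp
    qed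
    from abs_average_le[OF g this] show "\<bar>S k x v t\<bar> \<le> Kt + C * Kd" unfolding S_eq[OF t(1)] .
    from average_tendsto[OF g] show "(\<lambda>k. S k x v t) \<longlonglongrightarrow> wt x (t + \<tau>) + v \<bullet> dw x (t + \<tau>)"
      unfolding S_eq[OF t(1)] by simp
  qed
  have cp: "continuous_on (phase C T) (\<lambda>(x, v, t). f x v t)" if "continuous_on (UNIV \<times> {0..}) (\<lambda>(x, t). f1 x t)"
    "continuous_on (UNIV \<times> {0..}) (\<lambda>(x, t). f2 x t)" "\<And>x v t. f x v t = q * (f1 x t + v \<bullet> f2 x t)"
    for f :: "real^'n \<Rightarrow> real^'n \<Rightarrow> real \<Rightarrow> real" and f1 f2 and q :: real
  proof -
    have "continuous_on (phase C T) (\<lambda>p. (\<lambda>(x, t). f1 x t) (fst p, snd (snd p)))"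
      "continuous_on (phase C T) (\<lambda>p. (\<lambda>(x, t). f2 x t) (fst p, snd (snd p)))"
      by (rule continuous_on_compose2[OF that(1)] continuous_on_compose2[OF that(2)];
          force simp: phase_def intro!: continuous_intros)+
    then show ?thesis unfolding that(3) split_beta by (auto intro!: continuous_intros)
  qed
  have cS: "continuous_on (phase C T) (\<lambda>(x, v, t). S k x v t)" for k
    by (rule cp[OF time_average_continuous[OF cont(2) \<tau>] time_average_continuous[OF cont(3) \<tau>]]) (simp add: S_def)
  have c0: "continuous_on (phase C T) (\<lambda>(x, v, t). wt x (t + \<tau>) + v \<bullet> dw x (t + \<tau>))"
    using cp[OF continuous_on_time_shift[OF cont(2) \<tau>] continuous_on_time_shift[OF cont(3) \<tau>], of _ 1] by simp
  have L: "(\<lambda>k. \<integral>(x, v, t). S k x v t \<partial>\<gamma>) \<longlonglongrightarrow> (\<integral>(x, v, t). wt x (t + \<tau>) + v \<bullet> dw x (t + \<tau>) \<partial>\<gamma>)"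
  proof (rule integral_dominated_convergence[where w="\<lambda>_. Kt + C * Kd"])
    show "integrable \<gamma> (\<lambda>_. Kt + C * Kd)" using fin by (simp add: finite_measure.integrable_const)
  qed (use radon_measures_measurable[OF \<gamma>r] cS c0 S_bound S_lim space in \<open>auto intro!: AE_I2\<close>)
  define W where "W k x t = integral {0..h k} (\<lambda>s. w x (t + \<tau> + s))" for k x t
  have id: "(\<integral>(x, v, t). S k x v t \<partial>\<gamma>) = real (Suc k) * W k z T - (\<integral>x. real (Suc k) * W k x 0 \<partial>\<sigma>\<^sub>0)" for k
  proof -
    note A = time_average_C2[OF w \<tau> h(1)[of k] T, folded W_def]
    have "Zn_periodic (\<lambda>x. W k x t)" if "t \<in> {0..T}" for t
    proof -
      have "w (x + a) (t + \<tau> + s) = w x (t + \<tau> + s)" if "\<forall>i. a $ i \<in> \<int>" "s \<in> {0..h k}" for x a s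
        using per[of "t + \<tau> + s"] that \<tau> \<open>t \<in> {0..T}\<close> by (auto simp: Zn_periodic_def)
      then show ?thesis unfolding Zn_periodic_def W_def by (auto intro!: integral_cong)
    qed
    then have "(\<integral>(x, v, t). vector_derivative (W k x) (at t within {0..T}) + v \<bullet> grad (\<lambda>y. W k y t) x \<partial>\<gamma>)
          = W k z T - (\<integral>x. W k x 0 \<partial>\<sigma>\<^sub>0)"
      using \<gamma> A(1) unfolding transport_from_def by blast
    then have "real (Suc k) * (W k z T - (\<integral>x. W k x 0 \<partial>\<sigma>\<^sub>0))
      = (\<integral>p. real (Suc k) * (\<lambda>(x, v, t). vector_derivative (W k x) (at t within {0..T}) + v \<bullet> grad (\<lambda>y. W k y t) x) p \<partial>\<gamma>)"
      by simp
    also have "\<dots> = (\<integral>(x, v, t). S k x v t \<partial>\<gamma>)"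
      by (intro Bochner_Integration.integral_cong) (auto simp: space phase_def S_def A(2,3))
    finally show ?thesis by (simp add: right_diff_distrib)
  qed
  have W_bound: "\<bar>real (Suc k) * W k x t\<bar> \<le> Kw" and W_lim: "(\<lambda>k. real (Suc k) * W k x t) \<longlonglongrightarrow> w x (t + \<tau>)" if "t \<in> {0..T}" for x t k
  proof -
    have g: "continuous_on {0..1} (\<lambda>s. w x (t + \<tau> + s))" using slice[OF cont(1)] that by auto
    from abs_average_le[OF g, of Kw] show "\<bar>real (Suc k) * W k x t\<bar> \<le> Kw"
      using Kw that by (auto simp: W_def h_def)
    from average_tendsto[OF g] show "(\<lambda>k. real (Suc k) * W k x t) \<longlonglongrightarrow> w x (t + \<tau>)"
      by (simp add: W_def h_def)
  qed
  have cW: "continuous_on torus_dom (\<lambda>x. real (Suc k) * W k x 0)" "continuous_on torus_dom (\<lambda>x. w x \<tau>)" for k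
  proof -
    have "continuous_on torus_dom (\<lambda>x. (\<lambda>(x, t). W k x t) (x, 0))"
      unfolding W_def by (rule continuous_on_compose2[OF time_average_continuous[OF cont(1) \<tau>]]) (auto intro!: continuous_intros)
    then show "continuous_on torus_dom (\<lambda>x. real (Suc k) * W k x 0)" by (auto intro!: continuous_intros)
    have "continuous_on torus_dom (\<lambda>x. (\<lambda>(x, t). w x t) (x, \<tau>))"
      by (rule continuous_on_compose2[OF cont(1)]) (use \<tau> in \<open>auto intro!: continuous_intros\<close>)
    then show "continuous_on torus_dom (\<lambda>x. w x \<tau>)" by simp
  qed
  have R: "(\<lambda>k. \<integral>x. real (Suc k) * W k x 0 \<partial>\<sigma>\<^sub>0) \<longlonglongrightarrow> (\<integral>x. w x \<tau> \<partial>\<sigma>\<^sub>0)"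
  proof (rule integral_dominated_convergence[where w="\<lambda>_. Kw"])
    show "integrable \<sigma>\<^sub>0 (\<lambda>_. Kw)" using fin by (simp add: finite_measure.integrable_const)
    show "AE x in \<sigma>\<^sub>0. (\<lambda>k. real (Suc k) * W k x 0) \<longlonglongrightarrow> w x \<tau>" using W_lim[of 0] T by (intro AE_I2) simp
    show "AE x in \<sigma>\<^sub>0. norm (real (Suc k) * W k x 0) \<le> Kw" for k
      unfolding real_norm_def using T by (intro AE_I2 W_bound) auto
  qed (use radon_measures_measurable[OF \<sigma>r] cW in auto)
  have "(\<lambda>k. \<integral>(x, v, t). S k x v t \<partial>\<gamma>) \<longlonglongrightarrow> w z (T + \<tau>) - (\<integral>x. w x \<tau> \<partial>\<sigma>\<^sub>0)"
    unfolding id using T by (intro tendsto_diff R W_lim) auto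
  with L show ?thesis by (rule LIMSEQ_unique)
qed

section \<open>Uniqueness of the initial measure\<close>

lemma C21_with_separable:
  fixes s s' s'' :: "'n::finite \<Rightarrow> real \<Rightarrow> real" and F F' F'' :: "real \<Rightarrow> real"
  assumes s: "\<And>i r. (s i has_real_derivative s' i r) (at r)" "\<And>i r. (s' i has_real_derivative s'' i r) (at r)"
      "\<And>i. continuous_on UNIV (s'' i)"
    and F: "\<And>r. (F has_real_derivative F' r) (at r)" "\<And>r. (F' has_real_derivative F'' r) (at r)"
      "continuous_on UNIV F''"
  defines "S \<equiv> \<lambda>x::real^'n. \<Sum>i\<in>UNIV. s i (x $ i)" and "D \<equiv> \<lambda>x::real^'n. (\<chi> i. s' i (x $ i))"
  shows "C21_with I (\<lambda>x t. F (S x)) (\<lambda>x t. 0) (\<lambda>x t. F' (S x) *\<^sub>R D x)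
    (\<lambda>x t. \<chi> i j. F'' (S x) * D x $ i * D x $ j + (if i = j then F' (S x) * s'' i (x $ i) else 0))"
proof -
  have ds: "((\<lambda>x::real^'n. f (x $ i)) has_derivative (\<lambda>h. f' (x $ i) * h $ i)) (at x)"
    if "\<And>r. (f has_real_derivative f' r) (at r)" for f f' :: "real \<Rightarrow> real" and i x
  proof -
    have "(f has_derivative (\<lambda>h. f' (x $ i) * h)) (at (x $ i))" using that by (simp add: has_field_derivative_def)
    from has_derivative_compose[OF bounded_linear.has_derivative[OF bounded_linear_vec_nth has_derivative_ident] this]
    show ?thesis by simp
  qed
  have dS: "(S has_derivative (\<lambda>h. D x \<bullet> h)) (at x)" for x
    unfolding S_def D_def inner_vec_def using ds[OF s(1)]
    by (auto intro!: has_derivative_sum)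
  have dF: "((\<lambda>x. f (S x)) has_derivative (\<lambda>h. f' (S x) * (D x \<bullet> h))) (at x)"
    if "\<And>r. (f has_real_derivative f' r) (at r)" for f f' :: "real \<Rightarrow> real" and x
  proof -
    have "(f has_derivative (\<lambda>h. f' (S x) * h)) (at (S x))" using that by (simp add: has_field_derivative_def)
    from has_derivative_compose[OF dS this] show ?thesis by simp
  qed
  have dD: "(D has_derivative (\<lambda>h. \<chi> i. s'' i (x $ i) * h $ i)) (at x)" for x
    unfolding D_def
    by (subst has_derivative_componentwise_within) (use ds[OF s(2)] in \<open>auto simp: Basis_vec_def inner_axis\<close>)
  have cs: "continuous_on UNIV (s i)" "continuous_on UNIV (s' i)" for i
    using s(1,2) by (meson DERIV_isCont continuous_at_imp_continuous_on)+
  have cF: "continuous_on UNIV F'" using F(2) by (meson DERIV_isCont continuous_at_imp_continuous_on)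
  have cS: "continuous_on A (\<lambda>p. S (fst p))" for A :: "((real^'n) \<times> real) set"
    unfolding S_def by (intro continuous_intros continuous_on_compose2[OF cs(1)]) auto
  have cD: "continuous_on A (\<lambda>p. D (fst p))" for A :: "((real^'n) \<times> real) set"
    unfolding D_def by (intro continuous_intros continuous_on_compose2[OF cs(2)]) auto
  show ?thesis
    unfolding C21_with_def
  proof (intro conjI allI ballI)
    fix x t
    show "((\<lambda>t. F (S x)) has_real_derivative 0) (at t)" by simp
    show "((\<lambda>y. F (S y)) has_derivative (\<bullet>) (F' (S x) *\<^sub>R D x)) (at x)"
      by (rule has_derivative_eq_rhs[OF dF[OF F(1)]]) (simp add: fun_eq_iff)
    show "((\<lambda>y. F' (S y) *\<^sub>R D y) has_derivative (*v)
        (\<chi> i j. F'' (S x) * D x $ i * D x $ j + (if i = j then F' (S x) * s'' i (x $ i) else 0))) (at x)"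
    proof (rule has_derivative_eq_rhs[OF has_derivative_scaleR[OF dF[OF F(2)] dD]])
      show "(\<lambda>h. F' (S x) *\<^sub>R (\<chi> i. s'' i (x $ i) * h $ i) + (F'' (S x) * (D x \<bullet> h)) *\<^sub>R D x)
         = (*v) (\<chi> i j. F'' (S x) * D x $ i * D x $ j + (if i = j then F' (S x) * s'' i (x $ i) else 0))"
      proof (intro ext, simp add: vec_eq_iff matrix_vector_mult_def, intro allI)
        fix h i
        have "(\<Sum>j\<in>UNIV. (F'' (S x) * D x $ i * D x $ j + (if i = j then F' (S x) * s'' i (x $ i) else 0)) * h $ j)
            = (\<Sum>j\<in>UNIV. F'' (S x) * D x $ i * (D x $ j * h $ j)) + (\<Sum>j\<in>UNIV. if i = j then F' (S x) * s'' i (x $ i) * h $ j else 0)"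
          unfolding sum.distrib[symmetric] by (intro sum.cong) (auto simp: algebra_simps)
        also have "\<dots> = F'' (S x) * D x $ i * (D x \<bullet> h) + F' (S x) * s'' i (x $ i) * h $ i"
          by (simp add: inner_vec_def sum_distrib_left)
        finally show "F' (S x) * (s'' i (x $ i) * h $ i) + F'' (S x) * (D x \<bullet> h) * D x $ i =
           (\<Sum>j\<in>UNIV. (F'' (S x) * D x $ i * D x $ j + (if i = j then F' (S x) * s'' i (x $ i) else 0)) * h $ j)"
          by simp
      qed
    qed
  next
    show "continuous_on (UNIV \<times> I) (\<lambda>(x::real^'n, t). F' (S x) *\<^sub>R D x)"
      unfolding split_beta by (intro continuous_intros cD continuous_on_compose2[OF cF cS]) auto
    have "continuous_on (UNIV \<times> I) (\<lambda>p::(real^'n) \<times> real. if i = j then F' (S (fst p)) * s'' i (fst p $ i) else 0)" for i j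
      by (cases "i = j")
         (auto intro!: continuous_intros continuous_on_compose2[OF cF cS] continuous_on_compose2[OF s(3)])
    then show "continuous_on (UNIV \<times> I) (\<lambda>(x::real^'n, t). \<chi> i j. F'' (S x) * D x $ i * D x $ j + (if i = j then F' (S x) * s'' i (x $ i) else 0))"
      unfolding split_beta by (intro continuous_intros cD continuous_on_compose2[OF F(3) cS]) auto
  qed simp
qed

text \<open>
  On \<open>[0,1)\<close>, for \<open>0 \<le> a < 1\<close>, the trigonometric polynomial \<open>cos (\<pi>a) - cos (2\<pi>r - \<pi>a)\<close> equals
  \<open>2 sin (\<pi>r) sin (\<pi>(r-a))\<close> and is positive exactly for \<open>r > a\<close>. The double exponential turns its sign into
  the values 1 and 0 as \<open>m \<rightarrow> \<infinity>\<close>, with the value 0 also at its zeros, and it is smooth and periodic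
  without any case distinction.
\<close>

definition corner_bump :: "'n::finite set \<Rightarrow> ('n \<Rightarrow> real) \<Rightarrow> real \<Rightarrow> real^'n \<Rightarrow> real" where
  "corner_bump I a m x = exp (- m * (\<Sum>i\<in>UNIV. (if i \<in> I then 1 else 0) *
     exp (- m * (cos (pi * a i) - cos (2 * pi * x $ i - pi * a i)))))"

lemma corner_bump_C21:
  obtains dw ddw where "C21_with J (\<lambda>x t. corner_bump I a m x) (\<lambda>x t. 0) dw ddw"
proof -
  define E E1 E2 where "E i r = - m * (cos (pi * a i) - cos (2 * pi * r - pi * a i))"
    and "E1 i r = - m * (sin (2 * pi * r - pi * a i) * (2 * pi))"
    and "E2 i r = - m * (cos (2 * pi * r - pi * a i) * (2 * pi) * (2 * pi))" for i and r :: real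
  have dE: "(E i has_real_derivative E1 i r) (at r)" "(E1 i has_real_derivative E2 i r) (at r)" for i r
    unfolding E_def[abs_def] E1_def[abs_def] E2_def by (auto intro!: derivative_eq_intros)
  have "C21_with J (\<lambda>x t. (\<lambda>y. exp (- m * y)) (\<Sum>i\<in>UNIV. (\<lambda>i r. (if i \<in> I then 1 else 0) * exp (E i r)) i (x $ i))) (\<lambda>x t. 0)
      (\<lambda>x t. (\<lambda>y. exp (- m * y) * (- m)) (\<Sum>i\<in>UNIV. (\<lambda>i r. (if i \<in> I then 1 else 0) * exp (E i r)) i (x $ i)) *\<^sub>R
         (\<chi> i. (\<lambda>i r. (if i \<in> I then 1 else 0) * (exp (E i r) * E1 i r)) i (x $ i)))
      (\<lambda>x t. \<chi> i j. (\<lambda>y. exp (- m * y) * (- m) * (- m)) (\<Sum>i\<in>UNIV. (\<lambda>i r. (if i \<in> I then 1 else 0) * exp (E i r)) i (x $ i))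
           * (\<chi> i. (\<lambda>i r. (if i \<in> I then 1 else 0) * (exp (E i r) * E1 i r)) i (x $ i)) $ i
           * (\<chi> i. (\<lambda>i r. (if i \<in> I then 1 else 0) * (exp (E i r) * E1 i r)) i (x $ i)) $ j
        + (if i = j then (\<lambda>y. exp (- m * y) * (- m)) (\<Sum>i\<in>UNIV. (\<lambda>i r. (if i \<in> I then 1 else 0) * exp (E i r)) i (x $ i))
           * (\<lambda>i r. (if i \<in> I then 1 else 0) * (exp (E i r) * E1 i r * E1 i r + exp (E i r) * E2 i r)) i (x $ i) else 0))"
  proof (rule C21_with_separable)
    show "continuous_on UNIV (\<lambda>r. (if i \<in> I then 1 else 0) * (exp (E i r) * E1 i r * E1 i r + exp (E i r) * E2 i r))" for i
      unfolding E_def E1_def E2_def by (intro continuous_intros)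
    show "continuous_on UNIV (\<lambda>y. exp (- m * y) * (- m) * (- m))" by (intro continuous_intros)
  qed (auto intro!: derivative_eq_intros dE simp: algebra_simps)
  then show ?thesis using that unfolding corner_bump_def E_def by simp
qed

lemma corner_bump_periodic: "Zn_periodic (corner_bump I a m)"
proof -
  have "cos (2 * pi * (x + k) - b) = cos (2 * pi * x - b)" if "k \<in> \<int>" for x k b :: real
  proof -
    have "2 * pi * (x + k) - b = (2 * pi * x - b) + 2 * pi * k" by (simp add: algebra_simps)
    then show ?thesis using that by (simp only: cos_add) (simp add: cos_integer_2pi sin_integer_2pi)
  qed
  then show ?thesis unfolding Zn_periodic_def corner_bump_def by simp
qed

lemma corner_bump_range: "0 \<le> corner_bump I a m x" "m \<ge> 0 \<Longrightarrow> corner_bump I a m x \<le> 1"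
  unfolding corner_bump_def by (auto intro!: mult_nonneg_nonneg sum_nonneg)

lemma cos_diff_pos_iff:
  assumes "0 \<le> r" "r < 1" "0 \<le> a" and "a < 1"
  shows "0 < cos (pi * a) - cos (2 * pi * r - pi * a) \<longleftrightarrow> a < r"
proof -
  have eq: "cos (pi * a) - cos (2 * pi * r - pi * a) = 2 * sin (pi * r) * sin (pi * (r - a))"
  proof -
    have "(pi * a + (2 * pi * r - pi * a)) / 2 = pi * r" "(2 * pi * r - pi * a - pi * a) / 2 = pi * (r - a)"
      by (simp_all add: field_simps)
    then show ?thesis unfolding cos_diff_cos by simp
  qed
  have "sin (pi * r) > 0" if "a < r"
    using assms that by (intro sin_gt_zero) auto
  moreover have "sin (pi * (r - a)) > 0" if "a < r"
    using assms that \<open>a < 1\<close> by (intro sin_gt_zero) (auto simp: mult_less_cancel_left1)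
  moreover have "sin (pi * r) \<ge> 0" using assms by (intro sin_ge_zero) auto
  moreover have "sin (pi * (r - a)) \<le> 0" if "r \<le> a"
  proof -
    have "sin (pi * (a - r)) \<ge> 0" using assms that \<open>a < 1\<close> by (intro sin_ge_zero) auto
    moreover have "pi * (r - a) = - (pi * (a - r))" by (simp add: algebra_simps)
    ultimately show ?thesis by (simp only: sin_minus neg_le_0_iff_le)
  qed
  ultimately have "a < r \<Longrightarrow> sin (pi * r) * sin (pi * (r - a)) > 0" "r \<le> a \<Longrightarrow> sin (pi * r) * sin (pi * (r - a)) \<le> 0"
    by (auto simp: mult_nonneg_nonpos)
  then show ?thesis unfolding eq by (cases "a < r") (auto simp: mult.assoc not_less)
qed

lemma corner_bump_tendsto:
  assumes "x \<in> torus_dom" "\<And>i. i \<in> I \<Longrightarrow> 0 \<le> a i \<and> a i < 1"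
  shows "(\<lambda>m. corner_bump I a (real m) x) \<longlonglongrightarrow> indicator {x. \<forall>i\<in>I. a i < x $ i} x"
proof -
  define q where "q i = cos (pi * a i) - cos (2 * pi * x $ i - pi * a i)" for i
  have q: "0 < q i \<longleftrightarrow> a i < x $ i" if "i \<in> I" for i
    unfolding q_def using assms(1) assms(2)[OF that]
    by (intro cos_diff_pos_iff) (auto simp: torus_dom_def)
  define b where "b i = (if i \<in> I then 1 else 0 :: real)" for i
  have eq: "corner_bump I a (real m) x = exp (- (\<Sum>i\<in>UNIV. b i * (real m * exp (- real m * q i))))" for m
  proof -
    have "corner_bump I a (real m) x = exp (- (real m * (\<Sum>i\<in>UNIV. b i * exp (- real m * q i))))"
      by (simp add: corner_bump_def q_def b_def)
    also have "real m * (\<Sum>i\<in>UNIV. b i * exp (- real m * q i)) = (\<Sum>i\<in>UNIV. b i * (real m * exp (- real m * q i)))"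
      by (simp add: sum_distrib_left mult.left_commute)
    finally show ?thesis .
  qed
  show ?thesis
  proof (cases "\<forall>i\<in>I. a i < x $ i")
    case True
    have exp_lim: "(\<lambda>m. real m * exp (- real m * c)) \<longlonglongrightarrow> 0" if "c > 0" for c :: real
    proof -
      have "filterlim (\<lambda>m. real m * c) at_top sequentially"
        using that by (intro filterlim_at_top_mult_tendsto_pos[OF tendsto_const _ filterlim_real_sequentially] | simp)+
      from filterlim_compose[OF tendsto_power_div_exp_0[of 1] this]
      have "(\<lambda>m. (real m * c) / exp (real m * c) / c) \<longlonglongrightarrow> 0 / c" using that by (intro tendsto_divide tendsto_const) auto
      then show ?thesis using that by (simp add: exp_minus field_simps)
    qed
    have "(\<lambda>m. \<Sum>i\<in>UNIV. b i * (real m * exp (- real m * q i))) \<longlonglongrightarrow> 0"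
    proof (rule tendsto_null_sum)
      fix i
      show "(\<lambda>m. b i * (real m * exp (- real m * q i))) \<longlonglongrightarrow> 0"
      proof (cases "i \<in> I")
        case i: True
        have "(\<lambda>m. real m * exp (- real m * q i)) \<longlonglongrightarrow> 0" using True q[OF i] i by (intro exp_lim) auto
        then show ?thesis by (rule tendsto_mult_right_zero)
      qed (simp add: b_def)
    qed
    from tendsto_exp[OF tendsto_minus[OF this]] show ?thesis using True by (simp add: eq)
  next
    case False
    then obtain j where j: "j \<in> I" "\<not> a j < x $ j" by blast
    have le: "corner_bump I a (real m) x \<le> exp (- real m)" for m
    proof -
      have "real m * 1 \<le> real m * exp (- real m * q j)"
        using q[OF j(1)] j(2) by (intro mult_left_mono) (auto simp: mult_nonneg_nonpos not_less)
      also have "\<dots> = b j * (real m * exp (- real m * q j))" using j by (simp add: b_def)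
      also have "\<dots> \<le> (\<Sum>i\<in>UNIV. b i * (real m * exp (- real m * q i)))"
        by (rule member_le_sum) (auto simp: b_def)
      finally show ?thesis unfolding eq by simp
    qed
    have "(\<lambda>m. exp (- real m)) \<longlonglongrightarrow> 0"
      by (rule filterlim_compose[OF exp_at_bot]) (simp add: filterlim_uminus_at_bot filterlim_real_sequentially)
    then have "(\<lambda>m. corner_bump I a (real m) x) \<longlonglongrightarrow> 0"
      by (rule tendsto_sandwich[OF always_eventually always_eventually tendsto_const, rotated 2])
         (use le corner_bump_range(1) in auto)
    then show ?thesis using False by simp
  qed
qed

text \<open>
  Indicator functions of these sets are limits of smooth periodic functions. Each set is
  a product of arcs \<open>(a,1)\<close> and full circles. An open arc through 0 would not be an interval of the
  half-open cell, whereas these products lie in it, are closed under intersection and generate the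
  Borel sets.
\<close>

definition corners :: "(real^'n) set set" where
  "corners = {torus_dom \<inter> {x. \<forall>i\<in>I. a i < x $ i} |I a. \<forall>i\<in>I. 0 \<le> a i \<and> a i < 1}"

lemma corners_borel:
  fixes X :: "(real^'n) set"
  assumes "X \<in> corners" shows "X \<in> sets borel"
proof -
  from assms
  obtain I a where X: "X = torus_dom \<inter> {x. \<forall>i\<in>I. a i < x $ i}" by (auto simp: corners_def)
  have eq: "{x::real^'n. \<forall>i\<in>I. a i < x $ i} = (\<Inter>i\<in>I. {x. a i < x $ i})" by auto
  have "open {x::real^'n. \<forall>i\<in>I. a i < x $ i}"
    unfolding eq by (intro open_INT open_Collect_less continuous_intros ballI) auto
  then show ?thesis unfolding X by auto
qed

lemma sets_torus_eq_sigma_corners: "sets (restrict_space borel torus_dom) = sigma_sets torus_dom (corners :: (real^'n) set set)"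
proof -
  let ?st = "(\<lambda>(a, i). {x::real^'n. a < x \<bullet> i}) ` (UNIV \<times> Basis)"
  have G1: "sets (restrict_space borel torus_dom) = (\<inter>) torus_dom ` sigma_sets UNIV ?st"
    unfolding sets_restrict_space by (subst borel_eq_halfspace_greater) simp
  have G2: "(\<inter>) torus_dom ` sigma_sets UNIV ?st = sigma_sets torus_dom ((\<inter>) torus_dom ` ?st)"
  proof (rule sigma_sets_Int)
    have "torus_dom \<in> sets (borel :: (real^'n) measure)" by simp
    then show "torus_dom \<in> sigma_sets UNIV ?st" by (subst (asm) borel_eq_halfspace_greater) simp
  qed simp
  have "sigma_sets torus_dom ((\<inter>) torus_dom ` ?st) = sigma_sets torus_dom corners"
  proof (rule sigma_sets_eqI)
    fix X assume "X \<in> (\<inter>) torus_dom ` ?st"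
    then obtain c i where X: "X = torus_dom \<inter> {x. c < x $ i}" by (auto simp: Basis_vec_def inner_axis)
    show "X \<in> sigma_sets torus_dom corners"
    proof (cases "c < 0")
      case True
      then have "X = torus_dom" unfolding X by (auto simp: torus_dom_def intro: less_le_trans)
      then show ?thesis by (simp add: sigma_sets_top)
    next
      case False
      show ?thesis
      proof (cases "c < 1")
        case True
        then have "X \<in> corners" using False unfolding X corners_def by (auto intro!: exI[of _ "{i}"] exI[of _ "\<lambda>_. c"])
        then show ?thesis by (rule sigma_sets.Basic)
      next
        case False
        have "\<not> c < x $ i" if "x \<in> torus_dom" for x :: "real^'n"
        proof -
          have "x $ i < 1" using that by (simp add: torus_dom_def)
          then show ?thesis using False by linarith
        qed
        then have "X = {}" unfolding X by auto
        then show ?thesis by (simp add: sigma_sets.Empty)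
      qed
    qed
  next
    fix X :: "(real^'n) set" assume X: "X \<in> corners"
    then have "X \<subseteq> torus_dom" by (auto simp: corners_def)
    then have "X \<in> sets (restrict_space borel torus_dom)"
      using corners_borel[OF X] by (auto simp: sets_restrict_space_iff)
    then show "X \<in> sigma_sets torus_dom ((\<inter>) torus_dom ` ?st)" unfolding G1 G2 .
  qed
  then show ?thesis unfolding G1 G2 .
qed

lemma Int_stable_corners: "Int_stable (corners :: (real^'n) set set)"
proof (rule Int_stableI)
  fix X Y :: "(real^'n) set" assume "X \<in> corners" "Y \<in> corners"
  then obtain I a J b where X: "X = torus_dom \<inter> {x. \<forall>i\<in>I. a i < x $ i}" "\<forall>i\<in>I. 0 \<le> a i \<and> a i < 1"
    and Y: "Y = torus_dom \<inter> {x. \<forall>i\<in>J. b i < x $ i}" "\<forall>i\<in>J. 0 \<le> b i \<and> b i < 1" by (auto simp: corners_def)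
  define c where "c i = max (if i \<in> I then a i else 0) (if i \<in> J then b i else 0)" for i
  have "X \<inter> Y = torus_dom \<inter> {x. \<forall>i\<in>I \<union> J. c i < x $ i}"
  proof -
    have "c i < x $ i \<longleftrightarrow> (i \<in> I \<longrightarrow> a i < x $ i) \<and> (i \<in> J \<longrightarrow> b i < x $ i)" if "i \<in> I \<union> J" for i and x :: "real^'n"
      using that X(2) Y(2) by (cases "i \<in> I"; cases "i \<in> J") (auto simp: c_def max_absorb1 max_absorb2)
    then show ?thesis unfolding X(1) Y(1) by auto
  qed
  moreover have "\<forall>i\<in>I \<union> J. 0 \<le> c i \<and> c i < 1" using X(2) Y(2) by (auto simp: c_def)
  ultimately show "X \<inter> Y \<in> corners" unfolding corners_def by blast
qed

lemma torus_probs_eqI: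
  fixes M N :: "(real^'n) measure"
  assumes M: "M \<in> torus_probs" and N: "N \<in> torus_probs"
    and eq: "\<And>I a m. (\<integral>x. corner_bump I a (real m) x \<partial>M) = (\<integral>x. corner_bump I a (real m) x \<partial>N)"
  shows "M = N"
proof -
  have r: "K \<in> radon_measures torus_dom" if "K \<in> torus_probs" for K :: "(real^'n) measure"
    using that by (simp add: torus_probs_def)
  have meas: "emeasure K X = ennreal (lim (\<lambda>m. \<integral>x. corner_bump I a (real m) x \<partial>K))"
    if K: "K \<in> torus_probs" and X: "X = torus_dom \<inter> {x. \<forall>i\<in>I. a i < x $ i}" "\<forall>i\<in>I. 0 \<le> a i \<and> a i < 1" for K :: "(real^'n) measure" and X I a
  proof -
    interpret finite_measure K using r[OF K] by (simp add: radon_measures_def)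
    note space = radon_measures_space[OF r[OF K]]
    have "X \<in> corners" using X by (auto simp: corners_def)
    then have XK: "X \<in> sets K"
      using r[OF K] sets_torus_eq_sigma_corners by (auto simp: radon_measures_def intro: sigma_sets.Basic)
    have "(\<lambda>m. \<integral>x. corner_bump I a (real m) x \<partial>K) \<longlonglongrightarrow> (\<integral>x. indicator X x \<partial>K)"
    proof (rule integral_dominated_convergence[where w="\<lambda>_. 1"])
      show "(\<lambda>x. corner_bump I a (real m) x) \<in> borel_measurable K" for m
        by (rule radon_measures_measurable[OF r[OF K]]) (auto simp: corner_bump_def intro!: continuous_intros)
      show "AE x in K. (\<lambda>m. corner_bump I a (real m) x) \<longlonglongrightarrow> indicator X x"
        using corner_bump_tendsto[of _ I a] X(2) unfolding X(1)
        by (intro AE_I2) (auto simp: space indicator_def)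
      show "AE x in K. norm (corner_bump I a (real m) x) \<le> 1" for m
        by (intro AE_I2) (simp add: corner_bump_range abs_of_nonneg)
    qed (use XK in auto)
    then show ?thesis using XK by (simp add: limI emeasure_eq_measure)
  qed
  show ?thesis
  proof (rule measure_eqI_generator_eq[OF Int_stable_corners, of torus_dom])
    show "corners \<subseteq> Pow (torus_dom :: (real^'n) set)" by (auto simp: corners_def)
    show "emeasure M X = emeasure N X" if "X \<in> corners" for X
      using that meas[OF M] meas[OF N] eq by (auto simp: corners_def)
    show "sets M = sigma_sets torus_dom corners" "sets N = sigma_sets torus_dom corners"
      using r[OF M] r[OF N] sets_torus_eq_sigma_corners by (auto simp: radon_measures_def)
    show "range (\<lambda>_::nat. torus_dom :: (real^'n) set) \<subseteq> corners"
      by (auto simp: corners_def intro!: exI[of _ "{}"])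
    show "emeasure M torus_dom \<noteq> \<infinity>"
      using M radon_measures_space[OF r[OF M]] by (simp add: torus_probs_def)
  qed simp
qed

text \<open>
  For a test function independent of time the transport identity expresses \<open>\<integral>f d\<sigma>\<close> through \<open>\<gamma>\<close> alone.
\<close>

lemma initial_marginal_unique:
  fixes \<sigma> \<sigma>' :: "(real^'n) measure"
  assumes "\<gamma> \<in> transport_from C T z \<sigma>" "\<gamma> \<in> transport_from C T z \<sigma>'" "\<sigma> \<in> torus_probs" "\<sigma>' \<in> torus_probs" "T > 0"
  shows "\<sigma> = \<sigma>'"
proof (rule torus_probs_eqI[OF assms(3,4)])
  fix I :: "'n set" and a and m :: nat
  obtain dw ddw where C: "C21_with {0<..} (\<lambda>x t. corner_bump I a (real m) x) (\<lambda>x t. 0) dw ddw"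
    by (rule corner_bump_C21)
  have p: "Zn_periodic (\<lambda>x. corner_bump I a (real m) x)" by (rule corner_bump_periodic)
  show "(\<integral>x. corner_bump I a (real m) x \<partial>\<sigma>) = (\<integral>x. corner_bump I a (real m) x \<partial>\<sigma>')"
    using transport_from_C21[OF assms(1,3,5) C p zero_less_one] transport_from_C21[OF assms(2,4,5) C p zero_less_one]
    by simp
qed

lemma initial_marginal_eq:
  assumes "\<gamma> \<in> transport_from C T z \<sigma>" "\<sigma> \<in> torus_probs" "T > 0"
  shows "initial_marginal C T z \<gamma> = \<sigma>"
  unfolding initial_marginal_def using assms initial_marginal_unique by blast

section \<open>The lower bound for admissible measures\<close>

lemma C21_with_translate:
  fixes w :: "real^'n \<Rightarrow> real \<Rightarrow> real"
  assumes C: "C21_with I w wt dw ddw"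
  shows "C21_with I (\<lambda>x t. w (x + a) t) (\<lambda>x t. wt (x + a) t) (\<lambda>x t. dw (x + a) t) (\<lambda>x t. ddw (x + a) t)"
proof -
  have shift: "continuous_on (UNIV \<times> I) (\<lambda>(x, t). f (x + a) t)"
    if "continuous_on (UNIV \<times> I) (\<lambda>(x, t). f x t)" for f :: "real^'n \<Rightarrow> real \<Rightarrow> 'z::topological_space"
  proof -
    have "continuous_on (UNIV \<times> I) (\<lambda>p. (\<lambda>(x, t). f x t) (fst p + a, snd p))"
      by (rule continuous_on_compose2[OF that]) (auto intro!: continuous_intros)
    then show ?thesis by (simp add: split_beta)
  qed
  show ?thesis
    unfolding C21_with_def
    using C21_withD[OF C] C21_with_cont[OF C]
    by (auto intro!: shift has_derivative_shift[THEN iffD2])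
qed

lemma phase_continuous:
  fixes f :: "real^'n \<Rightarrow> real \<Rightarrow> 'b::topological_space"
  assumes "continuous_on (UNIV \<times> {0<..}) (\<lambda>(x, t). f x t)" "\<tau> > 0"
  shows "continuous_on (phase C T) (\<lambda>p. f (fst p + a) (snd (snd p) + \<tau>))"
proof -
  have "continuous_on (phase C T) (\<lambda>p. (\<lambda>(x, t). f x t) (fst p + a, snd (snd p) + \<tau>))"
    by (rule continuous_on_compose2[OF assms(1)]) (use assms(2) in \<open>auto simp: phase_def intro!: continuous_intros\<close>)
  then show ?thesis by simp
qed

lemma
  fixes f :: "real^'n \<Rightarrow> real \<Rightarrow> real" and F :: "real^'n \<Rightarrow> real \<Rightarrow> real^'n"
  assumes \<gamma>: "\<gamma> \<in> radon_measures (phase C T)" and \<tau>: "\<tau> > 0"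
  shows phase_integrable: "\<lbrakk>continuous_on (UNIV \<times> {0<..}) (\<lambda>(x, t). f x t); \<And>t. t > 0 \<Longrightarrow> Zn_periodic (\<lambda>x. f x t)\<rbrakk>
      \<Longrightarrow> integrable \<gamma> (\<lambda>p. f (fst p + a) (snd (snd p) + \<tau>))"
    and phase_integrable_inner: "\<lbrakk>continuous_on (UNIV \<times> {0<..}) (\<lambda>(x, t). F x t); \<And>t. t > 0 \<Longrightarrow> Zn_periodic (\<lambda>x. F x t)\<rbrakk>
      \<Longrightarrow> integrable \<gamma> (\<lambda>p. fst (snd p) \<bullet> F (fst p + a) (snd (snd p) + \<tau>))"
proof -
  have J: "{\<tau>..T + \<tau>} \<subseteq> {0<..}" using \<tau> by auto
  {
    assume c: "continuous_on (UNIV \<times> {0<..}) (\<lambda>(x, t). f x t)" and p: "\<And>t. t > 0 \<Longrightarrow> Zn_periodic (\<lambda>x. f x t)"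
    have 1: "continuous_on (UNIV \<times> {\<tau>..T + \<tau>}) (\<lambda>(x, t). f x t)"
      by (rule continuous_on_subset[OF c]) (use J in auto)
    have 2: "Zn_periodic (\<lambda>x. f x t)" if "t \<in> {\<tau>..T + \<tau>}" for t using p J that by auto
    obtain M where M: "\<And>x t. t \<in> {\<tau>..T + \<tau>} \<Longrightarrow> norm (f x t) \<le> M"
      using periodic_bounded[OF 1 compact_Icc 2] by metis
    show "integrable \<gamma> (\<lambda>p. f (fst p + a) (snd (snd p) + \<tau>))"
    proof (rule radon_measures_integrable[OF \<gamma> phase_continuous[OF c \<tau>]])
      show "norm (f (fst p + a) (snd (snd p) + \<tau>)) \<le> M" if "p \<in> phase C T" for p
        using that by (intro M) (auto simp: phase_def)
    qed
  }
  {
    assume c: "continuous_on (UNIV \<times> {0<..}) (\<lambda>(x, t). F x t)" and p: "\<And>t. t > 0 \<Longrightarrow> Zn_periodic (\<lambda>x. F x t)"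
    have 1: "continuous_on (UNIV \<times> {\<tau>..T + \<tau>}) (\<lambda>(x, t). F x t)"
      by (rule continuous_on_subset[OF c]) (use J in auto)
    have 2: "Zn_periodic (\<lambda>x. F x t)" if "t \<in> {\<tau>..T + \<tau>}" for t using p J that by auto
    obtain M where M: "0 \<le> M" "\<And>x t. t \<in> {\<tau>..T + \<tau>} \<Longrightarrow> norm (F x t) \<le> M"
      using periodic_bounded[OF 1 compact_Icc 2] by metis
    show "integrable \<gamma> (\<lambda>p. fst (snd p) \<bullet> F (fst p + a) (snd (snd p) + \<tau>))"
    proof (rule radon_measures_integrable[OF \<gamma>])
      show "continuous_on (phase C T) (\<lambda>p. fst (snd p) \<bullet> F (fst p + a) (snd (snd p) + \<tau>))"
        by (intro continuous_intros phase_continuous[OF c \<tau>])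
      show "norm (fst (snd p) \<bullet> F (fst p + a) (snd (snd p) + \<tau>)) \<le> C * M" if "p \<in> phase C T" for p
      proof -
        have "norm (fst (snd p) \<bullet> F (fst p + a) (snd (snd p) + \<tau>)) \<le> norm (fst (snd p)) * norm (F (fst p + a) (snd (snd p) + \<tau>))"
          unfolding real_norm_def by (rule Cauchy_Schwarz_ineq2)
        also have "\<dots> \<le> C * M"
          using that M by (intro mult_mono) (auto simp: phase_def intro: order_trans[OF norm_ge_zero])
        finally show ?thesis .
      qed
    qed
  }
qed

lemma (in finite_measure) abs_integral_le_mass:
  fixes f :: "'a \<Rightarrow> real"
  assumes "integrable M f" "\<And>x. x \<in> space M \<Longrightarrow> \<bar>f x\<bar> \<le> B"
  shows "\<bar>integral\<^sup>L M f\<bar> \<le> B * measure M (space M)"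
proof -
  have "\<bar>integral\<^sup>L M f\<bar> \<le> (\<integral>x. \<bar>f x\<bar> \<partial>M)" by (rule integral_abs_bound)
  also have "\<dots> \<le> (\<integral>x. B \<partial>M)" using assms by (intro integral_mono) auto
  finally show ?thesis by (simp add: mult.commute)
qed

text \<open>
  The function \<open>F(a) = \<integral>w(x+a,t+\<tau>) d\<gamma>\<close> has Lipschitz constant \<open>C m\<close>, where \<open>m\<close> is the mass of \<open>\<gamma>\<close>. With
  \<open>K = (C m + 1)/\<eta>\<close> the value of \<open>F(a) - K\<bar>a\<bar>\<^sup>2\<close> on the sphere of radius \<open>\<eta>\<close> is below its value at 0, so
  the maximum over the ball is interior and the second differences of \<open>F\<close> there are at most those of
  \<open>K\<bar>a\<bar>\<^sup>2\<close>. The limit of second difference quotients gives \<open>2K\<close> for each diagonal second derivative. The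
  bound does not involve the second derivatives of \<open>w\<close>.
\<close>

lemma translation_laplacian_bound:
  fixes w :: "real^'n \<Rightarrow> real \<Rightarrow> real"
  assumes \<gamma>: "\<gamma> \<in> radon_measures (phase C T)" and \<tau>: "\<tau> > 0" and \<eta>: "\<eta> > 0" and "C \<ge> 0"
    and w: "CT {0..} w" and C21: "C21_with {0<..} w wt dw ddw"
    and bd: "\<And>x t. t > 0 \<Longrightarrow> \<bar>wt x t\<bar> \<le> C" "\<And>x t. t > 0 \<Longrightarrow> norm (dw x t) \<le> C"
  obtains a where "norm a \<le> \<eta>"
    "(\<integral>p. (\<Sum>i\<in>UNIV. ddw (fst p + a) (snd (snd p) + \<tau>) $ i $ i) \<partial>\<gamma>)
      \<le> CARD('n) * (2 * ((C * measure \<gamma> (space \<gamma>) + 1) / \<eta>))"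
proof -
  interpret finite_measure \<gamma> using \<gamma> by (simp add: radon_measures_def)
  note space = radon_measures_space[OF \<gamma>]
  define m where "m = measure \<gamma> (space \<gamma>)"
  define K where "K = (C * m + 1) / \<eta>"
  have m: "m \<ge> 0" by (simp add: m_def)
  have cw: "continuous_on (UNIV \<times> {0<..}) (\<lambda>(x, t). w x t)"
    by (rule C21_with_continuous(2)[OF C21]) auto
  have pw: "Zn_periodic (\<lambda>x. w x t)" if "t > 0" for t using w that by (auto simp: CT_def)
  have pddw: "Zn_periodic (\<lambda>x. ddw x t $ i $ i)" if "t > 0" for t i
    using C21_with_periodic(3)[OF C21 pw, of t] that by (auto simp: Zn_periodic_def)
  have cddw: "continuous_on (UNIV \<times> {0<..}) (\<lambda>(x, t). ddw x t $ i $ i)" for i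
    using C21_with_cont(3)[OF C21] unfolding split_beta by (intro continuous_intros)
  define F where "F y = (\<integral>p. w (fst p + y) (snd (snd p) + \<tau>) \<partial>\<gamma>)" for y
  have int: "integrable \<gamma> (\<lambda>p. w (fst p + y) (snd (snd p) + \<tau>))" for y
    by (rule phase_integrable[OF \<gamma> \<tau> cw pw])
  have F_lip: "\<bar>F y - F y'\<bar> \<le> C * m * norm (y - y')" for y y'
  proof -
    have "F y - F y' = (\<integral>p. w (fst p + y) (snd (snd p) + \<tau>) - w (fst p + y') (snd (snd p) + \<tau>) \<partial>\<gamma>)"
      unfolding F_def by (rule Bochner_Integration.integral_diff[OF int int, symmetric])
    also have "\<bar>\<dots>\<bar> \<le> (C * norm (y - y')) * measure \<gamma> (space \<gamma>)"
    proof (rule abs_integral_le_mass)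
      show "\<bar>w (fst p + y) (snd (snd p) + \<tau>) - w (fst p + y') (snd (snd p) + \<tau>)\<bar> \<le> C * norm (y - y')" if "p \<in> space \<gamma>" for p
        using viscous_lipschitz(2)[OF w C21 bd, of "snd (snd p) + \<tau>" "fst p + y" "fst p + y'"] that \<tau>
        by (auto simp: space phase_def)
    qed (intro Bochner_Integration.integrable_diff int)
    finally show ?thesis by (simp add: m_def mult_ac)
  qed
  have cF: "continuous_on S F" for S
  proof (rule continuous_on_subset[OF lipschitz_on_continuous_on])
    show "(C * m)-lipschitz_on UNIV F"
      using F_lip m \<open>C \<ge> 0\<close> by (intro lipschitz_onI) (auto simp: dist_norm)
  qed auto
  have "\<exists>a\<in>cball 0 \<eta>. \<forall>y\<in>cball 0 \<eta>. F y - K * (norm y)\<^sup>2 \<le> F a - K * (norm a)\<^sup>2"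
    using \<eta> by (intro continuous_attains_sup continuous_intros cF) auto
  then obtain a where a: "norm a \<le> \<eta>" "\<And>y. norm y \<le> \<eta> \<Longrightarrow> F y - K * (norm y)\<^sup>2 \<le> F a - K * (norm a)\<^sup>2"
    by auto
  have "norm a < \<eta>"
  proof (rule ccontr)
    assume "\<not> ?thesis"
    then have na: "norm a = \<eta>" using a(1) by simp
    have "F 0 \<le> F a - K * \<eta>\<^sup>2" using a(2)[of 0] \<eta> na by simp
    moreover have "F a - F 0 \<le> C * m * \<eta>" using F_lip[of a 0] na by simp
    moreover have "K * \<eta>\<^sup>2 = C * m * \<eta> + \<eta>" using \<eta> by (simp add: K_def power2_eq_square field_simps)
    ultimately show False using \<eta> by linarith
  qed
  define r where "r k = (\<eta> - norm a) / real (Suc k)" for k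
  have r: "0 < r k" "norm a + r k \<le> \<eta>" for k
    using \<open>norm a < \<eta>\<close> mult_left_mono[of "norm a" \<eta> "real k"] by (auto simp: r_def field_simps)
  have rlim: "r \<longlonglongrightarrow> 0"
    using tendsto_mult_right_zero[OF LIMSEQ_inverse_real_of_nat, of "\<eta> - norm a"] by (simp add: r_def[abs_def] divide_inverse)
  have diag: "(\<integral>p. ddw (fst p + a) (snd (snd p) + \<tau>) $ i $ i \<partial>\<gamma>) \<le> 2 * K" for i
  proof -
    let ?e = "axis i 1 :: real^'n"
    \<comment> \<open>Symmetric second difference quotients, with steps small enough to stay in the ball of radius \<open>\<eta>\<close>.\<close>
    define Q where "Q k p = (w (fst p + (a + r k *\<^sub>R ?e)) (snd (snd p) + \<tau>) + w (fst p + (a - r k *\<^sub>R ?e)) (snd (snd p) + \<tau>)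
        - 2 * w (fst p + a) (snd (snd p) + \<tau>)) / (r k)\<^sup>2" for k and p :: "(real^'n) \<times> (real^'n) \<times> real"
    have Q_int: "integrable \<gamma> (Q k)" for k
      unfolding Q_def using int by (intro integrable_divide Bochner_Integration.integrable_diff Bochner_Integration.integrable_add integrable_mult_right)
    have Q_le: "(\<integral>p. Q k p \<partial>\<gamma>) \<le> 2 * K" for k
    proof -
      have n: "norm (a + r k *\<^sub>R ?e) \<le> \<eta>" "norm (a - r k *\<^sub>R ?e) \<le> \<eta>"
        using r[of k] norm_triangle_ineq[of a "r k *\<^sub>R ?e"] norm_triangle_ineq4[of a "r k *\<^sub>R ?e"] by auto
      have "(\<integral>p. Q k p \<partial>\<gamma>) = (F (a + r k *\<^sub>R ?e) + F (a - r k *\<^sub>R ?e) - 2 * F a) / (r k)\<^sup>2"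
        unfolding Q_def F_def using int by simp
      also have "\<dots> \<le> (K * ((norm (a + r k *\<^sub>R ?e))\<^sup>2 + (norm (a - r k *\<^sub>R ?e))\<^sup>2 - 2 * (norm a)\<^sup>2)) / (r k)\<^sup>2"
        using a(2)[OF n(1)] a(2)[OF n(2)] by (intro divide_right_mono) (auto simp: algebra_simps)
      also have "(norm (a + r k *\<^sub>R ?e))\<^sup>2 + (norm (a - r k *\<^sub>R ?e))\<^sup>2 - 2 * (norm a)\<^sup>2 = 2 * (r k)\<^sup>2"
        unfolding power2_norm_eq_inner
        by (simp add: inner_diff inner_add inner_commute algebra_simps power2_eq_square inner_axis_axis)
      finally show ?thesis using r[of k] by simp
    qed
    have 1: "continuous_on (UNIV \<times> {\<tau>..T + \<tau>}) (\<lambda>(x, t). ddw x t $ i $ i)"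
      by (rule continuous_on_subset[OF cddw]) (use \<tau> in auto)
    have 2: "Zn_periodic (\<lambda>x. ddw x t $ i $ i)" if "t \<in> {\<tau>..T + \<tau>}" for t using pddw \<tau> that by auto
    obtain B where B: "\<And>x t. t \<in> {\<tau>..T + \<tau>} \<Longrightarrow> norm (ddw x t $ i $ i) \<le> B"
      using periodic_bounded[OF 1 compact_Icc 2] by metis
    have "(\<lambda>k. \<integral>p. Q k p \<partial>\<gamma>) \<longlonglongrightarrow> (\<integral>p. ddw (fst p + a) (snd (snd p) + \<tau>) $ i $ i \<partial>\<gamma>)"
    proof (rule integral_dominated_convergence[where w="\<lambda>_. B"])
      show "(\<lambda>p. ddw (fst p + a) (snd (snd p) + \<tau>) $ i $ i) \<in> borel_measurable \<gamma>"
        using phase_integrable[OF \<gamma> \<tau> cddw pddw] by auto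
      show "Q k \<in> borel_measurable \<gamma>" for k using Q_int by auto
      have Q_eq: "\<exists>s>0. s < r k \<and> Q k p = (ddw (fst p + a + s *\<^sub>R ?e) (snd (snd p) + \<tau>) $ i $ i
          + ddw (fst p + a - s *\<^sub>R ?e) (snd (snd p) + \<tau>) $ i $ i) / 2" if "p \<in> space \<gamma>" for k p
      proof -
        have t: "snd (snd p) + \<tau> \<in> {0<..}" using that \<tau> by (auto simp: space phase_def)
        obtain s where s: "0 < s" "s < r k"
          "w (fst p + a + r k *\<^sub>R ?e) (snd (snd p) + \<tau>) + w (fst p + a - r k *\<^sub>R ?e) (snd (snd p) + \<tau>)
             - 2 * w (fst p + a) (snd (snd p) + \<tau>)
           = (r k)\<^sup>2 / 2 * (ddw (fst p + a + s *\<^sub>R ?e) (snd (snd p) + \<tau>) $ i $ i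
                + ddw (fst p + a - s *\<^sub>R ?e) (snd (snd p) + \<tau>) $ i $ i)"
          using second_difference[OF C21 t r(1)[of k], of "fst p + a" i] .
        have "Q k p = (ddw (fst p + a + s *\<^sub>R ?e) (snd (snd p) + \<tau>) $ i $ i
                + ddw (fst p + a - s *\<^sub>R ?e) (snd (snd p) + \<tau>) $ i $ i) / 2"
          unfolding Q_def add.assoc[symmetric] add_diff_eq s(3) using r(1)[of k] by simp
        with s(1,2) show ?thesis by blast
      qed
      show "AE p in \<gamma>. norm (Q k p) \<le> B" for k
      proof (rule AE_I2)
        fix p assume p: "p \<in> space \<gamma>"
        have t: "snd (snd p) + \<tau> \<in> {\<tau>..T + \<tau>}" using p by (auto simp: space phase_def)
        obtain s where s: "Q k p = (ddw (fst p + a + s *\<^sub>R ?e) (snd (snd p) + \<tau>) $ i $ i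
          + ddw (fst p + a - s *\<^sub>R ?e) (snd (snd p) + \<tau>) $ i $ i) / 2" using Q_eq[OF p] by blast
        show "norm (Q k p) \<le> B"
          unfolding s using B[OF t, of "fst p + a + s *\<^sub>R ?e"] B[OF t, of "fst p + a - s *\<^sub>R ?e"] by simp
      qed
      show "AE p in \<gamma>. (\<lambda>k. Q k p) \<longlonglongrightarrow> ddw (fst p + a) (snd (snd p) + \<tau>) $ i $ i"
      proof (rule AE_I2)
        fix p assume p: "p \<in> space \<gamma>"
        define q where "q s = ddw (fst p + a + s *\<^sub>R ?e) (snd (snd p) + \<tau>) $ i $ i" for s
        have "\<exists>s. \<forall>k. 0 < s k \<and> s k < r k \<and> Q k p = (q (s k) + q (- s k)) / 2"
          using Q_eq[OF p] unfolding q_def by (intro choice allI) auto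
        then obtain s where s: "\<And>k. 0 < s k" "\<And>k. s k < r k" "\<And>k. Q k p = (q (s k) + q (- s k)) / 2" by blast
        have "s \<longlonglongrightarrow> 0"
          by (rule tendsto_sandwich[OF always_eventually always_eventually tendsto_const rlim])
             (use less_imp_le[OF s(1)] less_imp_le[OF s(2)] in auto)
        have "continuous_on UNIV (\<lambda>s. (\<lambda>(x, t). ddw x t $ i $ i) (fst p + a + s *\<^sub>R ?e, snd (snd p) + \<tau>))"
          by (rule continuous_on_compose2[OF cddw]) (use p \<tau> in \<open>auto simp: space phase_def intro!: continuous_intros\<close>)
        then have "isCont q 0" by (simp add: q_def[abs_def] continuous_on_eq_continuous_at)
        then have "(\<lambda>k. (q (s k) + q (- s k)) / 2) \<longlonglongrightarrow> (q 0 + q 0) / 2"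
          using \<open>s \<longlonglongrightarrow> 0\<close> tendsto_minus[OF \<open>s \<longlonglongrightarrow> 0\<close>]
          by (intro tendsto_intros isCont_tendsto_compose[of 0 q]) auto
        then show "(\<lambda>k. Q k p) \<longlonglongrightarrow> ddw (fst p + a) (snd (snd p) + \<tau>) $ i $ i"
          by (simp add: s(3) q_def)
      qed
    qed simp
    then show ?thesis by (rule LIMSEQ_le_const2) (use Q_le in auto)
  qed
  have "(\<integral>p. (\<Sum>i\<in>UNIV. ddw (fst p + a) (snd (snd p) + \<tau>) $ i $ i) \<partial>\<gamma>)
      = (\<Sum>i\<in>UNIV. \<integral>p. ddw (fst p + a) (snd (snd p) + \<tau>) $ i $ i \<partial>\<gamma>)"
    by (intro Bochner_Integration.integral_sum phase_integrable[OF \<gamma> \<tau> cddw pddw])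
  also have "\<dots> \<le> CARD('n) * (2 * K)" using diag by (intro sum_bounded_above) auto
  finally show ?thesis using a(1) that[of a] unfolding K_def m_def by blast
qed

text \<open>
  A translate of a viscous solution is used as test function. Its viscous term is at most \<open>\<epsilon>B\<close> with \<open>B\<close>
  independent of \<open>\<epsilon>\<close>, and the remaining integrand is \<open>v\<cdot>p - H(x+a,p)\<close>, which exceeds \<open>L(x,v)\<close> by at most
  the oscillation of \<open>H\<close>. The one parameter \<open>r\<close> bounds the time shift, the length of the translation, the
  oscillation of \<open>H\<close>, the viscous term and the distance of \<open>w(z,T)\<close> from \<open>U\<close>.
\<close>

lemma transport_lower_bound:
  fixes H :: "real^'n \<Rightarrow> real^'n \<Rightarrow> real" and g :: "real^'n \<Rightarrow> real"
  assumes cH: "continuous_on UNIV (\<lambda>(x, p). H x p)" and pH: "\<And>p. Zn_periodic (\<lambda>x. H x p)"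
    and \<gamma>: "\<gamma> \<in> transport_from C T z \<sigma>\<^sub>0" and \<sigma>0: "\<sigma>\<^sub>0 \<in> torus_probs" and T: "T > 0" and "C \<ge> 0"
    and approx: "\<And>\<kappa>. \<kappa> > 0 \<Longrightarrow> \<exists>\<epsilon>0>0. \<forall>\<epsilon>. 0 < \<epsilon> \<longrightarrow> \<epsilon> < \<epsilon>0 \<longrightarrow>
        (\<exists>w wt dw ddw. bounded_viscous_solution C \<epsilon> H g w wt dw ddw \<and> \<bar>w z T - U\<bar> \<le> \<kappa>)"
  shows "ereal U \<le> ereal (\<integral>x. g x \<partial>\<sigma>\<^sub>0) + ereal_integral \<gamma> (\<lambda>(x, v, t). legendre H x v)"
proof -
  have \<gamma>r: "\<gamma> \<in> radon_measures (phase C T)" using \<gamma> by (simp add: transport_from_def)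
  have \<sigma>r: "\<sigma>\<^sub>0 \<in> radon_measures torus_dom" using \<sigma>0 by (simp add: torus_probs_def)
  interpret \<gamma>: finite_measure \<gamma> using \<gamma>r by (simp add: radon_measures_def)
  interpret \<sigma>: finite_measure \<sigma>\<^sub>0 using \<sigma>r by (simp add: radon_measures_def)
  note space = radon_measures_space[OF \<gamma>r] radon_measures_space[OF \<sigma>r]
  have \<sigma>1: "measure \<sigma>\<^sub>0 (space \<sigma>\<^sub>0) = 1" using \<sigma>0 by (simp add: torus_probs_def measure_def)
  define m where "m = measure \<gamma> (space \<gamma>)"
  let ?L = "ereal_integral \<gamma> (\<lambda>(x, v, t). legendre H x v)"
  have main: "ereal (U - (\<integral>x. g x \<partial>\<sigma>\<^sub>0) - r * (2 + 4 * C + m)) \<le> ?L" if r: "r > 0" for r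
  proof -
    have cH': "continuous_on (UNIV \<times> cball 0 C) (\<lambda>(x, p). H x p)"
      using cH by (rule continuous_on_subset) auto
    obtain d where d: "d > 0" "\<And>x x' p p'. p \<in> cball 0 C \<Longrightarrow> p' \<in> cball 0 C \<Longrightarrow> dist x x' < d \<Longrightarrow>
        dist p p' < d \<Longrightarrow> dist (H x p) (H x' p') < r"
      using periodic_uniformly_continuous[OF cH' compact_cball pH r] by metis
    \<comment> \<open>\<open>\<eta>\<close> bounds the translation and \<open>\<epsilon>\<close> is chosen after it, since the bound \<open>B\<close> on the Laplacian is of order
      \<open>1/\<eta>\<close>.\<close>
    define \<eta> where "\<eta> = min (d / 2) r"
    have \<eta>: "\<eta> > 0" "\<eta> < d" "\<eta> \<le> r" using d(1) r by (auto simp: \<eta>_def)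
    define B where "B = CARD('n) * (2 * ((C * m + 1) / \<eta>))"
    have "B > 0" using \<eta> \<open>C \<ge> 0\<close>
      unfolding B_def m_def by (intro mult_pos_pos divide_pos_pos add_nonneg_pos mult_nonneg_nonneg) auto
    obtain \<epsilon>0 where \<epsilon>0: "\<epsilon>0 > 0" "\<And>\<epsilon>. 0 < \<epsilon> \<Longrightarrow> \<epsilon> < \<epsilon>0 \<Longrightarrow>
        \<exists>w wt dw ddw. bounded_viscous_solution C \<epsilon> H g w wt dw ddw \<and> \<bar>w z T - U\<bar> \<le> r"
      using approx[OF r] by blast
    define \<epsilon> where "\<epsilon> = min (\<epsilon>0 / 2) (r / B)"
    have \<epsilon>: "0 < \<epsilon>" "\<epsilon> < \<epsilon>0" "\<epsilon> * B \<le> r"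
    proof -
      show "0 < \<epsilon>" "\<epsilon> < \<epsilon>0" using \<epsilon>0(1) r \<open>B > 0\<close> by (auto simp: \<epsilon>_def)
      have "\<epsilon> * B \<le> r / B * B" using \<open>B > 0\<close> by (intro mult_right_mono) (auto simp: \<epsilon>_def)
      then show "\<epsilon> * B \<le> r" using \<open>B > 0\<close> by simp
    qed
    obtain w wt dw ddw where sol: "bounded_viscous_solution C \<epsilon> H g w wt dw ddw" and wU: "\<bar>w z T - U\<bar> \<le> r"
      using \<epsilon>0(2)[OF \<epsilon>(1,2)] by blast
    note w = bounded_viscous_solutionD(1)[OF sol] and w0 = bounded_viscous_solutionD(2)[OF sol]
      and C21 = bounded_viscous_solutionD(3)[OF sol] and eq = bounded_viscous_solutionD(4)[OF sol]
      and bd = bounded_viscous_solutionD(5,6)[OF sol]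
    have pw: "Zn_periodic (\<lambda>x. w x t)" if "t \<ge> 0" for t using w that by (auto simp: CT_def)
    have pers: "Zn_periodic (\<lambda>x. wt x t)" "Zn_periodic (\<lambda>x. dw x t)" "Zn_periodic (\<lambda>x. ddw x t)" if "t > 0" for t
      using C21_with_periodic[OF C21, of t] pw that by auto
    note lip = viscous_lipschitz[OF w C21 bd]
    obtain a where a: "norm a \<le> \<eta>"
      "(\<integral>p. (\<Sum>i\<in>UNIV. ddw (fst p + a) (snd (snd p) + r) $ i $ i) \<partial>\<gamma>) \<le> B"
      using translation_laplacian_bound[OF \<gamma>r r \<eta>(1) \<open>C \<ge> 0\<close> w C21 bd] unfolding B_def m_def by blast
    define f1 where "f1 p = wt (fst p + a) (snd (snd p) + r) + fst (snd p) \<bullet> dw (fst p + a) (snd (snd p) + r)" for p :: "(real^'n) \<times> (real^'n) \<times> real"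
    define f2 where "f2 p = (\<Sum>i\<in>UNIV. ddw (fst p + a) (snd (snd p) + r) $ i $ i)" for p :: "(real^'n) \<times> (real^'n) \<times> real"
    have int1: "integrable \<gamma> f1" unfolding f1_def
      by (intro Bochner_Integration.integrable_add phase_integrable[OF \<gamma>r r] phase_integrable_inner[OF \<gamma>r r]
            C21_with_cont[OF C21] pers)
    have cddw: "continuous_on (UNIV \<times> {0<..}) (\<lambda>(x, t). ddw x t $ i $ i)" for i
      using C21_with_cont(3)[OF C21] unfolding split_beta by (intro continuous_intros)
    have int2: "integrable \<gamma> f2" unfolding f2_def
    proof (intro Bochner_Integration.integrable_sum phase_integrable[OF \<gamma>r r] cddw)
      show "Zn_periodic (\<lambda>x. ddw x t $ i $ i)" if "t > 0" for t i
        using pers(3)[OF that] by (simp add: Zn_periodic_def)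
    qed
    have "ereal (\<integral>p. f1 p - \<epsilon> * f2 p - r \<partial>\<gamma>) \<le> ?L"
    proof (rule ereal_integral_mono_real)
      show "integrable \<gamma> (\<lambda>p. f1 p - \<epsilon> * f2 p - r)"
        by (intro Bochner_Integration.integrable_diff integrable_mult_right int1 int2 \<gamma>.integrable_const)
      fix p assume p: "p \<in> space \<gamma>"
      obtain x v t where [simp]: "p = (x, v, t)" by (cases p)
      have t: "t + r > 0" using p r by (simp add: space phase_def)
      let ?q = "dw (x + a) (t + r)"
      have "dist (H (x + a) ?q) (H x ?q) < r"
        using bd(2)[OF t, of "x + a"] a(1) \<eta> d(1) by (intro d(2)) (auto simp: dist_norm)
      then have "f1 p - \<epsilon> * f2 p - r \<le> v \<bullet> ?q - H x ?q"
        using eq[OF t, of "x + a"] unfolding f1_def f2_def dist_real_def by simp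
      then have "ereal (f1 p - \<epsilon> * f2 p - r) \<le> ereal (v \<bullet> ?q - H x ?q)" by simp
      also have "\<dots> \<le> legendre H x v" by (rule legendre_ge)
      finally show "ereal (f1 p - \<epsilon> * f2 p - r) \<le> (\<lambda>(x, v, t). legendre H x v) p" by simp
    qed
    moreover have "U - (\<integral>x. g x \<partial>\<sigma>\<^sub>0) - r * (2 + 4 * C + m) \<le> (\<integral>p. f1 p - \<epsilon> * f2 p - r \<partial>\<gamma>)"
    proof -
      have "(\<integral>p. f1 p - \<epsilon> * f2 p - r \<partial>\<gamma>) = (\<integral>p. f1 p \<partial>\<gamma>) - \<epsilon> * (\<integral>p. f2 p \<partial>\<gamma>) - r * m"
        using int1 int2 by (simp add: m_def)
      moreover have "\<epsilon> * (\<integral>p. f2 p \<partial>\<gamma>) \<le> r"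
      proof -
        have "\<epsilon> * (\<integral>p. f2 p \<partial>\<gamma>) \<le> \<epsilon> * B" using a(2) \<epsilon>(1) unfolding f2_def by (intro mult_left_mono) auto
        then show ?thesis using \<epsilon>(3) by linarith
      qed
      moreover have "(\<integral>p. f1 p \<partial>\<gamma>) = w (z + a) (T + r) - (\<integral>x. w (x + a) r \<partial>\<sigma>\<^sub>0)"
        using transport_from_C21[OF \<gamma> \<sigma>0 T C21_with_translate[OF C21, of a] Zn_periodic_translate[OF pw] r]
        unfolding f1_def by (simp add: case_prod_unfold)
      moreover have "\<bar>w (z + a) (T + r) - w z T\<bar> \<le> 2 * C * r"
      proof -
        have "C * norm a \<le> C * r" using a(1) \<eta>(3) \<open>C \<ge> 0\<close> by (intro mult_left_mono) auto
        then show ?thesis using lip(1)[of T "T + r" z] lip(2)[of "T + r" "z + a" z] T r by simp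
      qed
      moreover have "(\<integral>x. w (x + a) r \<partial>\<sigma>\<^sub>0) \<le> (\<integral>x. g x \<partial>\<sigma>\<^sub>0) + 2 * C * r"
      proof -
        have lip': "\<bar>w (x + a) r - g x\<bar> \<le> 2 * C * r" for x
        proof -
          have "C * norm a \<le> C * r" using a(1) \<eta>(3) \<open>C \<ge> 0\<close> by (intro mult_left_mono) auto
          then show ?thesis using lip(1)[of 0 r x] lip(2)[of r "x + a" x] r w0[of x] by simp
        qed
        have cw: "continuous_on (UNIV \<times> {0..}) (\<lambda>(x, t). w x t)" using w by (simp add: CT_def)
        have cr: "continuous_on torus_dom (\<lambda>x. w (x + b) s)" "integrable \<sigma>\<^sub>0 (\<lambda>x. w (x + b) s)" if "s \<ge> 0" for b s
        proof -
          have "continuous_on torus_dom (\<lambda>x. (\<lambda>(x, t). w x t) (x + b, s))"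
            by (rule continuous_on_compose2[OF cw]) (use that in \<open>auto intro!: continuous_intros\<close>)
          then show 1: "continuous_on torus_dom (\<lambda>x. w (x + b) s)" by simp
          have 2: "continuous_on (UNIV \<times> {s}) (\<lambda>(x, t). w x t)"
            by (rule continuous_on_subset[OF cw]) (use that in auto)
          have 3: "Zn_periodic (\<lambda>x. w x t)" if "t \<in> {s}" for t using pw \<open>s \<ge> 0\<close> that by simp
          obtain M where M: "\<And>x t. t \<in> {s} \<Longrightarrow> norm (w x t) \<le> M"
            using periodic_bounded[OF 2 _ 3] by (metis compact_sing)
          show "integrable \<sigma>\<^sub>0 (\<lambda>x. w (x + b) s)"
          proof (rule radon_measures_integrable[OF \<sigma>r 1])
            show "norm (w (x + b) s) \<le> M" for x by (rule M) simp
          qed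
        qed
        have ig: "integrable \<sigma>\<^sub>0 g" using cr(2)[of 0 0] by (simp add: w0)
        have "(\<integral>x. w (x + a) r \<partial>\<sigma>\<^sub>0) - (\<integral>x. g x \<partial>\<sigma>\<^sub>0) = (\<integral>x. w (x + a) r - g x \<partial>\<sigma>\<^sub>0)"
          by (rule Bochner_Integration.integral_diff[symmetric]) (use cr(2) r ig in auto)
        also have "\<bar>\<dots>\<bar> \<le> (2 * C * r) * measure \<sigma>\<^sub>0 (space \<sigma>\<^sub>0)"
          by (rule \<sigma>.abs_integral_le_mass) (use cr(2) r ig lip' in auto)
        finally show ?thesis unfolding \<sigma>1 by simp
      qed
      moreover note wU
      ultimately show ?thesis by (simp add: algebra_simps)
    qed
    ultimately show ?thesis by (meson ereal_less_eq(3) order_trans)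
  qed
  have "ereal (U - (\<integral>x. g x \<partial>\<sigma>\<^sub>0)) \<le> ?L"
  proof (rule ereal_le_epsilon2)
    fix e :: real assume "e > 0"
    define r where "r = e / (2 + 4 * C + m)"
    have pos: "2 + 4 * C + m > 0" using \<open>C \<ge> 0\<close> by (auto simp: m_def intro!: add_pos_nonneg)
    then have "r > 0" using \<open>e > 0\<close> by (simp add: r_def)
    have re: "r * (2 + 4 * C + m) = e" using pos by (simp add: r_def)
    have "ereal (U - (\<integral>x. g x \<partial>\<sigma>\<^sub>0)) = ereal (U - (\<integral>x. g x \<partial>\<sigma>\<^sub>0) - e) + ereal e" by simp
    also have "\<dots> \<le> ?L + ereal e" using main[OF \<open>r > 0\<close>] unfolding re by (rule add_right_mono)
    finally show "ereal (U - (\<integral>x. g x \<partial>\<sigma>\<^sub>0)) \<le> ?L + ereal e" .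
  qed
  then have "ereal (\<integral>x. g x \<partial>\<sigma>\<^sub>0) + ereal (U - (\<integral>x. g x \<partial>\<sigma>\<^sub>0)) \<le> ereal (\<integral>x. g x \<partial>\<sigma>\<^sub>0) + ?L"
    by (rule add_left_mono)
  then show ?thesis by simp
qed

section \<open>Passage to the limit in the adjoint measures\<close>

text \<open>
  The densities describe \<open>\<nu>\<close> for \<open>0 \<le> t < T\<close>; changing the two endpoints of the time interval does not
  affect the integral.
\<close>

lemma mu_integral_eq:
  fixes w :: "real^'n \<Rightarrow> real \<Rightarrow> real"
  assumes \<mu>: "is_mu C T \<nu> \<mu>" and \<nu>: "\<And>t. t \<in> {0..<T} \<Longrightarrow> is_nu C w \<sigma> t (\<nu> t)"
    and \<psi>: "CT (UNIV \<times> {0..T}) (\<lambda>x (p, t). \<psi> x p t)"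
    and dw: "\<And>x t. t \<in> {0<..<T} \<Longrightarrow> grad (\<lambda>y. w y t) x = dw x t"
  shows "(\<integral>(x, p, t). \<psi> x p t \<partial>\<mu>) = (LINT t:{0<..<T}|lborel. LINT x:torus_dom|lborel. \<psi> x (dw x t) t * \<sigma> x t)"
proof -
  have c\<psi>: "continuous_on (UNIV \<times> UNIV \<times> {0..T}) (\<lambda>(x, p, t). \<psi> x p t)" using \<psi> by (simp add: CT_def)
  have p\<psi>: "Zn_periodic (\<lambda>x. \<psi> x p t)" if "t \<in> {0..T}" for p t using \<psi> that by (auto simp: CT_def)
  have "CT (cball 0 C \<times> {0..T}) (\<lambda>x (p, t). \<psi> x p t)"
    using \<psi> unfolding CT_def by (auto elim!: continuous_on_subset)
  then have "(\<integral>(x, p, t). \<psi> x p t \<partial>\<mu>) = (LINT t:{0..T}|lborel. (\<integral>(x, p). \<psi> x p t \<partial>\<nu> t))"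
    using \<mu> unfolding is_mu_def by blast
  also have "\<dots> = (LINT t:{0<..<T}|lborel. LINT x:torus_dom|lborel. \<psi> x (dw x t) t * \<sigma> x t)"
    unfolding set_lebesgue_integral_def[of _ "{0..T}"] set_lebesgue_integral_def[of _ "{0<..<T}"]
  proof (rule integral_discrete_difference[of "{0, T}"])
    fix t assume t: "t \<notin> {0, T}"
    have "(\<integral>(x, p). \<psi> x p t \<partial>\<nu> t) = (LINT x:torus_dom|lborel. \<psi> x (dw x t) t * \<sigma> x t)" if "t \<in> {0<..<T}"
    proof -
      have "continuous_on (UNIV \<times> UNIV) (\<lambda>q. (\<lambda>(x, p, t). \<psi> x p t) (fst q, snd q, t))"
        by (rule continuous_on_compose2[OF c\<psi>]) (use that in \<open>auto intro!: continuous_intros\<close>)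
      then have "CT UNIV (\<lambda>x p. \<psi> x p t)" using p\<psi>[of t] that by (simp add: CT_def split_beta)
      then have "(\<integral>(x, p). \<psi> x p t \<partial>\<nu> t) = (LINT x:torus_dom|lborel. \<psi> x (grad (\<lambda>y. w y t) x) t * \<sigma> x t)"
        using \<nu>[of t] that unfolding is_nu_def by auto
      then show ?thesis by (simp add: dw[OF that])
    qed
    then show "indicator {0..T} t *\<^sub>R (\<integral>(x, p). \<psi> x p t \<partial>\<nu> t)
      = indicator {0<..<T} t *\<^sub>R (LINT x:torus_dom|lborel. \<psi> x (dw x t) t * \<sigma> x t)"
      using t by (auto simp: indicator_def)
  qed auto
  finally show ?thesis .
qed

text \<open>
  Test functions are differentiable within the closed strip. Their derivatives there are expressed
  through partial derivatives, continuous up to the boundary, which are the classical ones in the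
  interior. The Laplacian \<open>L\<close> appears as a function of its own, continuous
  up to the boundary and hence bounded.
\<close>

lemma C2_on_strip:
  fixes \<phi> :: "real^'n \<Rightarrow> real \<Rightarrow> real"
  assumes \<phi>: "C2_on (\<lambda>(x, t). \<phi> x t) (UNIV \<times> {0..T})" and per: "\<And>t. t \<in> {0..T} \<Longrightarrow> Zn_periodic (\<lambda>x. \<phi> x t)" and T: "T > 0"
  obtains \<phi>t d\<phi> L where
    "CT {0..T} \<phi>" "CT {0..T} \<phi>t" "continuous_on (UNIV \<times> {0..T}) (\<lambda>(x, t). d\<phi> x t)"
    "\<And>t. t \<in> {0..T} \<Longrightarrow> Zn_periodic (\<lambda>x. d\<phi> x t)" "CT {0..T} L"
    "\<And>x t. t \<in> {0..T} \<Longrightarrow> vector_derivative (\<phi> x) (at t within {0..T}) = \<phi>t x t"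
    "\<And>x t. t \<in> {0..T} \<Longrightarrow> grad (\<lambda>y. \<phi> y t) x = d\<phi> x t"
    "\<exists>dd\<phi>. C21_with {0<..<T} \<phi> \<phi>t d\<phi> dd\<phi> \<and> (\<forall>x t. L x t = (\<Sum>i\<in>UNIV. dd\<phi> x t $ i $ i))"
proof -
  let ?S = "UNIV \<times> {0..T} :: ((real^'n) \<times> real) set"
  obtain f' where f': "\<And>p. p \<in> ?S \<Longrightarrow> ((\<lambda>(x, t). \<phi> x t) has_derivative blinfun_apply (f' p)) (at p within ?S)" and "C1_on f' ?S"
    using \<phi> unfolding C2_on_def by blast
  then obtain f'' where f'': "\<And>p. p \<in> ?S \<Longrightarrow> (f' has_derivative blinfun_apply (f'' p)) (at p within ?S)" and cf'': "continuous_on ?S f''"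
    unfolding C1_on_def by blast
  have cf': "continuous_on ?S f'" by (rule has_derivative_continuous_on[OF f''])
  have c\<phi>: "continuous_on ?S (\<lambda>(x, t). \<phi> x t)" by (rule has_derivative_continuous_on[OF f'])
  define \<phi>t where "\<phi>t x t = f' (x, t) (0, 1)" for x t
  define d\<phi> where "d\<phi> x t = (\<chi> i. f' (x, t) (axis i 1, 0))" for x t
  define dd\<phi> where "dd\<phi> x t = (\<chi> i. grad (\<lambda>y. d\<phi> y t $ i) x)" for x t
  have dx: "((\<lambda>y. F (y, t)) has_derivative (\<lambda>h. F' (x, t) (h, 0))) (at x)"
    if "\<And>p. p \<in> ?S \<Longrightarrow> (F has_derivative F' p) (at p within ?S)" "t \<in> {0..T}" for F :: "(real^'n) \<times> real \<Rightarrow> 'z::real_normed_vector" and F' x t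
  proof (rule has_derivative_in_compose2[OF that(1), where s=UNIV])
    show "((\<lambda>y. (y, t)) has_derivative (\<lambda>h. (h, 0))) (at x)" by (auto intro!: derivative_eq_intros)
  qed (use that in auto)
  have D\<phi>: "((\<lambda>y. \<phi> y t) has_derivative (\<lambda>h. f' (x, t) (h, 0))) (at x)" if "t \<in> {0..T}" for x t
    using dx[OF f' that] by simp
  have grad\<phi>: "grad (\<lambda>y. \<phi> y t) x = d\<phi> x t" if "t \<in> {0..T}" for x t
    unfolding grad_def d\<phi>_def frechet_derivative_at[OF D\<phi>[OF that], symmetric] ..
  have Dt: "(\<phi> x has_vector_derivative \<phi>t x t) (at t within {0..T})" if "t \<in> {0..T}" for x t
  proof -
    have "((\<lambda>s. (x, s)) has_derivative (\<lambda>k. (0, k))) (at t within {0..T})" by (auto intro!: derivative_eq_intros)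
    from has_derivative_in_compose2[OF f' _ that this]
    have "(\<phi> x has_derivative (\<lambda>k. f' (x, t) (0, k))) (at t within {0..T})" by auto
    moreover have "f' (x, t) (0, k) = k *\<^sub>R f' (x, t) (0, 1)" for k
    proof -
      have "f' (x, t) (0, k) = f' (x, t) (k *\<^sub>R (0, 1))" by simp
      also have "\<dots> = k *\<^sub>R f' (x, t) (0, 1)" by (rule blinfun.scaleR_right)
      finally show ?thesis .
    qed
    then have "(\<lambda>k. blinfun_apply (f' (x, t)) (0, k)) = (\<lambda>k. k *\<^sub>R \<phi>t x t)"
      unfolding \<phi>t_def by (intro ext)
    ultimately show ?thesis unfolding has_vector_derivative_def by simp
  qed
  have vd: "vector_derivative (\<phi> x) (at t within {0..T}) = \<phi>t x t" if "t \<in> {0..T}" for x t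
    by (rule vector_derivative_within_closed_interval[OF T that Dt[OF that]])
  have Di: "((\<lambda>y. d\<phi> y t $ i) has_derivative (\<lambda>h. f'' (x, t) (h, 0) (axis i 1, 0))) (at x)" if "t \<in> {0..T}" for x t i
    unfolding d\<phi>_def using bounded_linear.has_derivative[OF blinfun.bounded_linear_left dx[OF f'' that]] by simp
  have dd_eq: "dd\<phi> x t = (\<chi> i j. f'' (x, t) (axis j 1, 0) (axis i 1, 0))" if "t \<in> {0..T}" for x t
    unfolding dd\<phi>_def grad_def frechet_derivative_at[OF Di[OF that], symmetric] by simp
  have Dd: "((\<lambda>y. d\<phi> y t) has_derivative (\<lambda>h. dd\<phi> x t *v h)) (at x)" if "t \<in> {0..T}" for x t
  proof (subst has_derivative_componentwise_within, intro ballI)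
    fix b :: "real^'n" assume "b \<in> Basis"
    then obtain i where b: "b = axis i 1" by (auto simp: Basis_vec_def)
    have "((\<lambda>y. d\<phi> y t $ i) has_derivative (\<lambda>h. grad (\<lambda>y. d\<phi> y t $ i) x \<bullet> h)) (at x)"
      by (rule has_derivative_grad[OF Di[OF that]])
    moreover have "(dd\<phi> x t *v h) $ i = grad (\<lambda>y. d\<phi> y t $ i) x \<bullet> h" for h
      by (simp add: dd\<phi>_def matrix_vector_mult_def inner_vec_def)
    ultimately show "((\<lambda>y. d\<phi> y t \<bullet> b) has_derivative (\<lambda>h. (dd\<phi> x t *v h) \<bullet> b)) (at x)"
      by (simp add: b inner_axis)
  qed
  have pd: "Zn_periodic (\<lambda>x. d\<phi> x t)" if "t \<in> {0..T}" for t
  proof -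
    have "d\<phi> (x + k) t = d\<phi> x t" if k: "\<forall>i. k $ i \<in> \<int>" for x k
    proof -
      have "(\<lambda>y. \<phi> (y + k) t) = (\<lambda>y. \<phi> y t)" using per[OF \<open>t \<in> {0..T}\<close>] k by (auto simp: Zn_periodic_def)
      moreover have "((\<lambda>y. \<phi> (y + k) t) has_derivative (\<lambda>h. d\<phi> (x + k) t \<bullet> h)) (at x)"
        using has_derivative_grad[OF D\<phi>[OF \<open>t \<in> {0..T}\<close>, of "x + k"]] unfolding grad\<phi>[OF \<open>t \<in> {0..T}\<close>]
        by (simp add: has_derivative_shift[of "\<lambda>y. \<phi> y t"])
      ultimately show ?thesis using grad_eqI grad\<phi>[OF \<open>t \<in> {0..T}\<close>] by metis
    qed
    then show ?thesis by (simp add: Zn_periodic_def)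
  qed
  have pdd: "Zn_periodic (\<lambda>x. dd\<phi> x t)" if "t \<in> {0..T}" for t
  proof -
    have "dd\<phi> (x + k) t = dd\<phi> x t" if k: "\<forall>i. k $ i \<in> \<int>" for x k
    proof -
      have eq: "(\<lambda>y. d\<phi> (y + k) t $ i) = (\<lambda>y. d\<phi> y t $ i)" for i
        using pd[OF \<open>t \<in> {0..T}\<close>] k by (auto simp: Zn_periodic_def)
      have "grad (\<lambda>y. d\<phi> y t $ i) (x + k) = grad (\<lambda>y. d\<phi> y t $ i) x" for i
      proof -
        have "((\<lambda>y. d\<phi> (y + k) t $ i) has_derivative (\<lambda>h. grad (\<lambda>y. d\<phi> y t $ i) (x + k) \<bullet> h)) (at x)"
          using has_derivative_grad[OF Di[OF \<open>t \<in> {0..T}\<close>, of i "x + k"]]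
          by (simp add: has_derivative_shift[of "\<lambda>y. d\<phi> y t $ i"])
        then show ?thesis unfolding eq using grad_eqI by metis
      qed
      then show ?thesis by (simp add: dd\<phi>_def)
    qed
    then show ?thesis by (simp add: Zn_periodic_def)
  qed
  have pt: "Zn_periodic (\<lambda>x. \<phi>t x t)" if t: "t \<in> {0..T}" for t
  proof -
    have "\<phi>t (x + k) t = \<phi>t x t" if k: "\<forall>i. k $ i \<in> \<int>" for x k
    proof -
      have "(\<phi> x has_vector_derivative \<phi>t (x + k) t) (at t within {0..T})"
        by (rule has_vector_derivative_transform[OF t _ Dt[OF t, of "x + k"]])
           (use per k in \<open>auto simp: Zn_periodic_def\<close>)
      then show ?thesis using vd[OF t, of x] vector_derivative_within_closed_interval[OF T t] by metis
    qed
    then show ?thesis by (simp add: Zn_periodic_def)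
  qed
  have c: "continuous_on ?S (\<lambda>(x, t). \<phi>t x t)" "continuous_on ?S (\<lambda>(x, t). d\<phi> x t)"
    unfolding \<phi>t_def d\<phi>_def split_beta by (auto intro!: continuous_intros cf')
  have cdd: "continuous_on ?S (\<lambda>(x, t). dd\<phi> x t)"
  proof -
    have "continuous_on ?S (\<lambda>p. \<chi> i j. f'' p (axis j 1, 0) (axis i 1, 0))"
      by (intro continuous_intros cf'')
    then show ?thesis by (rule continuous_on_cong[THEN iffD1, rotated -1]) (auto simp: dd_eq)
  qed
  have C21: "C21_with {0<..<T} \<phi> \<phi>t d\<phi> dd\<phi>"
    unfolding C21_with_def
  proof (intro conjI allI ballI)
    fix x t assume t: "t \<in> {0<..<T}"
    then have t': "t \<in> {0..T}" and "t \<in> interior {0..T}" by auto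
    show "(\<phi> x has_real_derivative \<phi>t x t) (at t)"
      using Dt[OF t', of x] at_within_interior[OF \<open>t \<in> interior {0..T}\<close>]
      by (simp add: has_real_derivative_iff_has_vector_derivative)
    show "((\<lambda>y. \<phi> y t) has_derivative (\<bullet>) (d\<phi> x t)) (at x)"
      using has_derivative_grad[OF D\<phi>[OF t', of x]] unfolding grad\<phi>[OF t'] .
    show "((\<lambda>y. d\<phi> y t) has_derivative (*v) (dd\<phi> x t)) (at x)" by (rule Dd[OF t'])
  qed (rule continuous_on_subset[OF c(1)] continuous_on_subset[OF c(2)] continuous_on_subset[OF cdd]; auto)+
  define L where "L x t = (\<Sum>i\<in>UNIV. dd\<phi> x t $ i $ i)" for x t
  have "CT {0..T} L"
    unfolding CT_def
  proof
    show "continuous_on ?S (\<lambda>(x, t). L x t)"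
      unfolding L_def using cdd unfolding split_beta by (intro continuous_intros)
    show "\<forall>t\<in>{0..T}. Zn_periodic (\<lambda>x. L x t)" using pdd by (auto simp: L_def Zn_periodic_def)
  qed
  with c pt pd per c\<phi> vd grad\<phi> C21 show ?thesis
    by (intro that[of \<phi>t d\<phi> L]) (auto simp: CT_def L_def)
qed

lemma CT_phase_bounded:
  fixes \<psi> :: "real^'n \<Rightarrow> real^'n \<Rightarrow> real \<Rightarrow> real"
  assumes "CT (cball 0 C \<times> {0..T}) (\<lambda>x (p, t). \<psi> x p t)"
  obtains B where "0 \<le> B" "\<And>x p t. norm p \<le> C \<Longrightarrow> t \<in> {0..T} \<Longrightarrow> \<bar>\<psi> x p t\<bar> \<le> B"
proof -
  have c: "continuous_on (UNIV \<times> cball 0 C \<times> {0..T}) (\<lambda>(x, y). (\<lambda>(p, t). \<psi> x p t) y)"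
    and p: "Zn_periodic (\<lambda>x. (\<lambda>(p, t). \<psi> x p t) y)" if "y \<in> cball 0 C \<times> {0..T}" for y
    using assms that by (auto simp: CT_def)
  show ?thesis
  proof (cases "cball (0::real^'n) C \<times> {0..T} = {}")
    case True
    then show ?thesis by (intro that[of 0]) (auto dest: order_trans[OF norm_ge_zero])
  next
    case False
    then have "continuous_on (UNIV \<times> cball 0 C \<times> {0..T}) (\<lambda>(x, y). (\<lambda>(p, t). \<psi> x p t) y)" using c by blast
    from periodic_bounded[OF this _ p] obtain B where "0 \<le> B"
      "\<And>x y. y \<in> cball 0 C \<times> {0..T} \<Longrightarrow> norm ((\<lambda>(p, t). \<psi> x p t) y) \<le> B"
      by (metis compact_Times compact_cball compact_Icc)
    then show ?thesis by (intro that[of B]) fastforce+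
  qed
qed

lemma CT_phase_continuous:
  fixes \<psi> :: "real^'n \<Rightarrow> real^'n \<Rightarrow> real \<Rightarrow> real"
  assumes "CT (cball 0 C \<times> {0..T}) (\<lambda>x (p, t). \<psi> x p t)"
  shows "continuous_on (phase C T) (\<lambda>(x, p, t). \<psi> x p t)"
proof -
  have "continuous_on (UNIV \<times> cball 0 C \<times> {0..T}) (\<lambda>(x, p, t). \<psi> x p t)"
    using assms by (simp add: CT_def)
  then show ?thesis by (rule continuous_on_subset) (auto simp: phase_def)
qed

lemma CT_phase_integrable:
  fixes \<psi> :: "real^'n \<Rightarrow> real^'n \<Rightarrow> real \<Rightarrow> real"
  assumes "M \<in> radon_measures (phase C T)" "CT (cball 0 C \<times> {0..T}) (\<lambda>x (p, t). \<psi> x p t)"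
  shows "integrable M (\<lambda>(x, p, t). \<psi> x p t)"
proof -
  obtain B where B: "\<And>x p t. norm p \<le> C \<Longrightarrow> t \<in> {0..T} \<Longrightarrow> \<bar>\<psi> x p t\<bar> \<le> B"
    using CT_phase_bounded[OF assms(2)] by metis
  show ?thesis
  proof (rule radon_measures_integrable[OF assms(1) CT_phase_continuous[OF assms(2)]])
    show "norm ((\<lambda>(x, p, t). \<psi> x p t) q) \<le> B" if "q \<in> phase C T" for q
      using that B by (auto simp: phase_def)
  qed
qed

lemma CT_const_time:
  fixes \<psi> :: "real^'n \<Rightarrow> real^'n \<Rightarrow> real"
  assumes "CT UNIV \<psi>"
  shows "CT (UNIV \<times> {0..T}) (\<lambda>x (p, t). \<psi> x p)"
proof -
  have "continuous_on UNIV (\<lambda>(x, p). \<psi> x p)" using assms by (simp add: CT_def)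
  then have "continuous_on (UNIV \<times> UNIV \<times> {0..T}) (\<lambda>q. (\<lambda>(x, p). \<psi> x p) (fst q, fst (snd q)))"
    by (rule continuous_on_compose2) (auto intro!: continuous_intros)
  then show ?thesis using assms by (simp add: CT_def case_prod_unfold)
qed

lemma CT_restrict_ball: "CT (UNIV \<times> {0..T}) f \<Longrightarrow> CT (cball 0 C \<times> {0..T}) f"
  unfolding CT_def by (auto elim!: continuous_on_subset)

lemma periodic_hamiltonian:
  fixes H :: "real^'n \<Rightarrow> real^'n \<Rightarrow> real"
  assumes "\<And>p. Zn_periodic (\<lambda>x. H x p)" "\<forall>i. k $ i \<in> \<int>"
  shows "H (x + k) = H x"
  using assms by (auto simp: Zn_periodic_def)

lemma CT_velocity:
  fixes H :: "real^'n \<Rightarrow> real^'n \<Rightarrow> real"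
  assumes H: "C2_on (\<lambda>(x, p). H x p) UNIV" "\<And>p. Zn_periodic (\<lambda>x. H x p)" and \<psi>: "CT (UNIV \<times> J) (\<lambda>x (v, t). \<psi> x v t)"
  shows "CT (UNIV \<times> J) (\<lambda>x (p, t). \<psi> x (grad (H x) p) t)"
  unfolding CT_def
proof
  have c: "continuous_on (UNIV \<times> UNIV \<times> J) (\<lambda>(x, v, t). \<psi> x v t)" using \<psi> by (simp add: CT_def)
  have g: "continuous_on (UNIV \<times> UNIV \<times> J) (\<lambda>q. grad (H (fst q)) (fst (snd q)))"
  proof -
    have "continuous_on (UNIV \<times> UNIV \<times> J) (\<lambda>q. (\<lambda>(x, p). grad (H x) p) (fst q, fst (snd q)))"
      by (rule continuous_on_compose2[OF C2_on_hamiltonian_grad_continuous[OF H(1)]]) (auto intro!: continuous_intros)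
    then show ?thesis by simp
  qed
  have "continuous_on (UNIV \<times> UNIV \<times> J) (\<lambda>q. (\<lambda>(x, v, t). \<psi> x v t) (fst q, grad (H (fst q)) (fst (snd q)), snd (snd q)))"
    by (rule continuous_on_compose2[OF c]) (auto intro!: continuous_intros g)
  then show "continuous_on (UNIV \<times> UNIV \<times> J) (\<lambda>(x, p, t). \<psi> x (grad (H x) p) t)" by (simp add: case_prod_unfold)
  show "\<forall>y\<in>UNIV \<times> J. Zn_periodic (\<lambda>x. case y of (p, t) \<Rightarrow> \<psi> x (grad (H x) p) t)"
  proof
    fix y :: "(real^'n) \<times> 'a" assume "y \<in> UNIV \<times> J"
    then obtain p t where y: "y = (p, t)" "t \<in> J" by auto
    have "Zn_periodic (\<lambda>x. \<psi> x v t)" for v using \<psi> y(2) by (auto simp: CT_def)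
    then show "Zn_periodic (\<lambda>x. case y of (p, t) \<Rightarrow> \<psi> x (grad (H x) p) t)"
      using periodic_hamiltonian[of H, OF H(2)] unfolding Zn_periodic_def y by simp
  qed
qed

text \<open>
  The value \<open>L(x,D\<^sub>pH(x,p))\<close> for convex \<open>H\<close>. Written through \<open>H\<close>, it is finite and continuous.
\<close>

definition action_density :: "(real^'n \<Rightarrow> real^'n \<Rightarrow> real) \<Rightarrow> real^'n \<Rightarrow> real^'n \<Rightarrow> real" where
  "action_density H x p = grad (H x) p \<bullet> p - H x p"

lemma CT_action_density:
  fixes H :: "real^'n \<Rightarrow> real^'n \<Rightarrow> real"
  assumes H: "C2_on (\<lambda>(x, p). H x p) UNIV" "\<And>p. Zn_periodic (\<lambda>x. H x p)"
  shows "CT UNIV (action_density H)"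
  using C2_on_hamiltonian_continuous[OF H(1)] C2_on_hamiltonian_grad_continuous[OF H(1)] periodic_hamiltonian[of H, OF H(2)]
  unfolding CT_def action_density_def split_beta Zn_periodic_def
  by (auto intro!: continuous_intros)

text \<open>
  The hypothesis on \<open>\<gamma>\<close> covers continuous integrands only. It is applied to the increasing continuous
  approximations of \<open>L\<close>. On the side of \<open>\<mu>\<close> their compositions with the velocity lie between the first one
  and the continuous limit \<open>D\<^sub>pH\<cdot>p - H\<close>, so the integrals converge; on the side of \<open>\<gamma>\<close> monotone convergence
  applies, with no prior information on where \<open>L\<close> is finite.
\<close>

lemma legendre_integral:
  fixes H :: "real^'n \<Rightarrow> real^'n \<Rightarrow> real"
  assumes H: "C2_on (\<lambda>(x, p). H x p) UNIV" "\<And>p. Zn_periodic (\<lambda>x. H x p)" and conv: "\<And>x. convex_on UNIV (H x)"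
    and \<mu>: "\<mu> \<in> radon_measures (phase C T)" and \<gamma>: "\<gamma> \<in> radon_measures (phase C T)"
    and push: "\<And>\<psi>. CT UNIV \<psi> \<Longrightarrow> (\<integral>(x, p, t). \<psi> x (grad (H x) p) \<partial>\<mu>) = (\<integral>(x, v, t). \<psi> x v \<partial>\<gamma>)"
  shows "ereal_integral \<gamma> (\<lambda>(x, v, t). legendre H x v) = ereal (\<integral>(x, p, t). action_density H x p \<partial>\<mu>)"
proof -
  note cH = C2_on_hamiltonian_continuous[OF H(1)]
  interpret \<mu>: finite_measure \<mu> using \<mu> by (simp add: radon_measures_def)
  note space = radon_measures_space[OF \<mu>] radon_measures_space[OF \<gamma>]
  obtain f where f: "\<And>m. continuous_on UNIV (\<lambda>(x, v). f m x v)" "\<And>m v. Zn_periodic (\<lambda>x. f m x v)"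
    and mono: "\<And>m x v. f m x v \<le> f (Suc m) x v" and lim: "\<And>x v. (\<lambda>m. ereal (f m x v)) \<longlonglongrightarrow> legendre H x v"
    using legendre_approx[OF cH H(2)] by metis
  have CTf: "CT UNIV (f m)" for m using f by (simp add: CT_def)
  have CTg: "CT (UNIV \<times> {0..T}) (\<lambda>x (p, t). f m x (grad (H x) p))" for m
    by (rule CT_velocity[OF H CT_const_time[OF CTf]])
  have CTa: "CT (UNIV \<times> {0..T}) (\<lambda>x (p, t). action_density H x p)"
    by (rule CT_const_time[OF CT_action_density[OF H]])
  have leg: "legendre H x (grad (H x) p) = ereal (action_density H x p)" for x p
    unfolding action_density_def by (rule legendre_grad[OF conv C2_on_hamiltonian_deriv[OF H(1)]])
  have ub: "f m x (grad (H x) p) \<le> action_density H x p" for m x p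
  proof -
    have "ereal (f m x (grad (H x) p)) \<le> legendre H x (grad (H x) p)"
      by (rule incseq_le[OF _ lim]) (auto intro!: incseq_SucI mono)
    then show ?thesis by (simp add: leg)
  qed
  have lb: "f 0 x v \<le> f m x v" for m x v
    using lift_Suc_mono_le[of "\<lambda>m. f m x v" 0 m] mono by auto
  obtain B0 where B0: "\<And>x p t. norm p \<le> C \<Longrightarrow> t \<in> {0..T} \<Longrightarrow> \<bar>f 0 x (grad (H x) p)\<bar> \<le> B0"
    using CT_phase_bounded[OF CT_restrict_ball[OF CTg[of 0]]] by metis
  obtain B1 where B1: "\<And>x p t. norm p \<le> C \<Longrightarrow> t \<in> {0..T} \<Longrightarrow> \<bar>action_density H x p\<bar> \<le> B1"
    using CT_phase_bounded[OF CT_restrict_ball[OF CTa]] by metis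
  have L: "(\<lambda>m. \<integral>(x, p, t). f m x (grad (H x) p) \<partial>\<mu>) \<longlonglongrightarrow> (\<integral>(x, p, t). action_density H x p \<partial>\<mu>)"
  proof (rule integral_dominated_convergence[where w="\<lambda>_. B0 + B1"])
    show "(\<lambda>(x, p, t). action_density H x p) \<in> borel_measurable \<mu>"
      by (rule borel_measurable_integrable[OF CT_phase_integrable[OF \<mu> CT_restrict_ball[OF CTa]]])
    show "(\<lambda>(x, p, t). f m x (grad (H x) p)) \<in> borel_measurable \<mu>" for m
      by (rule borel_measurable_integrable[OF CT_phase_integrable[OF \<mu> CT_restrict_ball[OF CTg]]])
    show "AE q in \<mu>. (\<lambda>m. (\<lambda>(x, p, t). f m x (grad (H x) p)) q) \<longlonglongrightarrow> (\<lambda>(x, p, t). action_density H x p) q"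
    proof (rule AE_I2)
      fix q :: "(real^'n) \<times> (real^'n) \<times> real"
      obtain x p t where q: "q = (x, p, t)" by (cases q)
      show "(\<lambda>m. (\<lambda>(x, p, t). f m x (grad (H x) p)) q) \<longlonglongrightarrow> (\<lambda>(x, p, t). action_density H x p) q"
        using lim[of x "grad (H x) p"] unfolding q leg by simp
    qed
    show "AE q in \<mu>. norm ((\<lambda>(x, p, t). f m x (grad (H x) p)) q) \<le> B0 + B1" for m
    proof (rule AE_I2)
      fix q assume "q \<in> space \<mu>"
      then obtain x p t where q: "q = (x, p, t)" "norm p \<le> C" "t \<in> {0..T}" by (auto simp: space phase_def)
      show "norm ((\<lambda>(x, p, t). f m x (grad (H x) p)) q) \<le> B0 + B1"
        using B0[OF q(2,3), of x] B1[OF q(2,3), of x] ub[of m x p] lb[of x "grad (H x) p" m] unfolding q by simp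
    qed
  qed simp
  show ?thesis
  proof (rule ereal_integral_monotone_limit)
    show "integrable \<gamma> (\<lambda>(x, v, t). f m x v)" for m
      by (rule CT_phase_integrable[OF \<gamma> CT_restrict_ball[OF CT_const_time[OF CTf]]])
    show "(\<lambda>m. \<integral>(x, v, t). f m x v \<partial>\<gamma>) \<longlonglongrightarrow> (\<integral>(x, p, t). action_density H x p \<partial>\<mu>)"
      using L unfolding push[OF CTf] .
  qed (use mono lim in auto)
qed

text \<open>
  The density has mass 1 at each time, so a bounded perturbation of the integrand changes the integral
  by at most its bound times the length of the interval.
\<close>

lemma adjoint_time_integral:
  fixes f h :: "real^'n \<Rightarrow> real \<Rightarrow> real"
  assumes adj: "adjoint_solution \<epsilon> H W z T \<sigma>" and T: "T > 0"
    and f: "continuous_on (UNIV \<times> {0<..<T}) (\<lambda>(x, t). f x t)" "\<And>x t. t \<in> {0<..<T} \<Longrightarrow> \<bar>f x t\<bar> \<le> K"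
    and h: "continuous_on (UNIV \<times> {0<..<T}) (\<lambda>(x, t). h x t)" "\<And>x t. t \<in> {0<..<T} \<Longrightarrow> \<bar>h x t\<bar> \<le> K'"
  shows "\<bar>(LINT t:{0<..<T}|lborel. LINT x:torus_dom|lborel. (f x t - c * h x t) * \<sigma> x t)
      - (LINT t:{0<..<T}|lborel. LINT x:torus_dom|lborel. f x t * \<sigma> x t)\<bar> \<le> \<bar>c\<bar> * (K' * T)"
proof -
  let ?I = "{0<..<T}"
  have c\<sigma>: "continuous_on (UNIV \<times> {0..<T}) (\<lambda>(x, t). \<sigma> x t)" and \<sigma>0: "t \<in> {0..<T} \<Longrightarrow> \<sigma> x t \<ge> 0"
    and \<sigma>1: "t \<in> {0..<T} \<Longrightarrow> (LINT x:torus_dom|lborel. \<sigma> x t) = 1" for x t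
    using adj by (auto simp: adjoint_solution_def CT_def)
  have c\<sigma>I: "continuous_on (UNIV \<times> ?I) (\<lambda>(x, t). \<sigma> x t)"
    using c\<sigma> by (rule continuous_on_subset) auto
  have \<sigma>i: "integral unit_box (\<lambda>x. \<sigma> x t) = 1" if "t \<in> {0..<T}" for t
    using \<sigma>1[OF that] LINT_torus_eq_integral[OF continuous_on_slice[OF c\<sigma> that]] by simp
  have slice: "set_integrable lborel ?I (\<lambda>t. LINT x:torus_dom|lborel. F x t * \<sigma> x t)"
    "\<And>t. t \<in> ?I \<Longrightarrow> set_integrable lborel torus_dom (\<lambda>x. F x t * \<sigma> x t)"
    "\<And>t. t \<in> ?I \<Longrightarrow> \<bar>LINT x:torus_dom|lborel. F x t * \<sigma> x t\<bar> \<le> B"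
    if F: "continuous_on (UNIV \<times> ?I) (\<lambda>(x, t). F x t)" "\<And>x t. t \<in> ?I \<Longrightarrow> \<bar>F x t\<bar> \<le> B" for F :: "real^'n \<Rightarrow> real \<Rightarrow> real" and B
  proof -
    have cF: "continuous_on (UNIV \<times> ?I) (\<lambda>(x, t). F x t * \<sigma> x t)"
      unfolding split_beta using F(1) c\<sigma>I by (intro continuous_intros) (auto simp: split_beta)
    show 1: "set_integrable lborel torus_dom (\<lambda>x. F x t * \<sigma> x t)" if "t \<in> ?I" for t
      by (rule set_integrable_torus[OF continuous_on_slice[OF cF that]])
    have eq: "(LINT x:torus_dom|lborel. F x t * \<sigma> x t) = integral unit_box (\<lambda>x. F x t * \<sigma> x t)" if "t \<in> ?I" for t
      by (rule LINT_torus_eq_integral[OF continuous_on_slice[OF cF that]])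
    show 2: "\<bar>LINT x:torus_dom|lborel. F x t * \<sigma> x t\<bar> \<le> B" if "t \<in> ?I" for t
      unfolding eq[OF that] using that
      by (intro abs_integral_density_le continuous_on_slice[OF F(1)] continuous_on_slice[OF c\<sigma>I] \<sigma>i \<sigma>0 F(2)) auto
    have c: "continuous_on ?I (\<lambda>t. LINT x:torus_dom|lborel. F x t * \<sigma> x t)"
      by (rule continuous_on_cong[THEN iffD1, OF refl _ continuous_on_integral_slice[OF cF]]) (simp add: eq)
    show "set_integrable lborel ?I (\<lambda>t. LINT x:torus_dom|lborel. F x t * \<sigma> x t)"
      unfolding set_integrable_def
    proof (rule Bochner_Integration.integrable_bound[where f="\<lambda>t. B * indicator ?I t"])
      show "integrable lborel (\<lambda>t. B * indicator ?I t)"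
        using T by (intro integrable_mult_right integrable_real_indicator) auto
      show "(\<lambda>t. indicator ?I t *\<^sub>R (LINT x:torus_dom|lborel. F x t * \<sigma> x t)) \<in> borel_measurable lborel"
        using borel_measurable_continuous_on_indicator[OF _ c] by simp
      show "AE t in lborel. norm (indicator ?I t *\<^sub>R (LINT x:torus_dom|lborel. F x t * \<sigma> x t)) \<le> norm (B * indicator ?I t)"
        using 2 by (intro AE_I2) (auto simp: indicator_def intro: order_trans[OF _ abs_ge_self])
    qed
  qed
  have sf: "set_integrable lborel ?I (\<lambda>t. LINT x:torus_dom|lborel. f x t * \<sigma> x t)" by (rule slice(1)[OF f])
  have sf': "set_integrable lborel torus_dom (\<lambda>x. f x t * \<sigma> x t)" if "t \<in> ?I" for t by (rule slice(2)[OF f]) (use that in auto)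
  have sh: "set_integrable lborel ?I (\<lambda>t. LINT x:torus_dom|lborel. h x t * \<sigma> x t)" by (rule slice(1)[OF h])
  have sh': "set_integrable lborel torus_dom (\<lambda>x. h x t * \<sigma> x t)" "\<bar>LINT x:torus_dom|lborel. h x t * \<sigma> x t\<bar> \<le> K'"
    if "t \<in> ?I" for t by (rule slice(2)[OF h] slice(3)[OF h]; use that in simp)+
  have "(LINT t:?I|lborel. LINT x:torus_dom|lborel. (f x t - c * h x t) * \<sigma> x t)
     = (LINT t:?I|lborel. (LINT x:torus_dom|lborel. f x t * \<sigma> x t) - c * (LINT x:torus_dom|lborel. h x t * \<sigma> x t))"
  proof (rule set_lebesgue_integral_cong)
    show "\<forall>t. t \<in> ?I \<longrightarrow> (LINT x:torus_dom|lborel. (f x t - c * h x t) * \<sigma> x t)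
        = (LINT x:torus_dom|lborel. f x t * \<sigma> x t) - c * (LINT x:torus_dom|lborel. h x t * \<sigma> x t)"
    proof (intro allI impI)
      fix t assume t: "t \<in> ?I"
      have "(LINT x:torus_dom|lborel. (f x t - c * h x t) * \<sigma> x t)
          = (LINT x:torus_dom|lborel. f x t * \<sigma> x t - c * (h x t * \<sigma> x t))"
        by (simp add: left_diff_distrib mult.assoc)
      then show "(LINT x:torus_dom|lborel. (f x t - c * h x t) * \<sigma> x t)
        = (LINT x:torus_dom|lborel. f x t * \<sigma> x t) - c * (LINT x:torus_dom|lborel. h x t * \<sigma> x t)"
        using sf'[OF t] sh'(1)[OF t] by (simp add: set_integral_diff)
    qed
  qed simp
  also have "\<dots> = (LINT t:?I|lborel. LINT x:torus_dom|lborel. f x t * \<sigma> x t) - c * (LINT t:?I|lborel. LINT x:torus_dom|lborel. h x t * \<sigma> x t)"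
    using sf sh by (simp add: set_integral_diff)
  finally have "\<bar>(LINT t:?I|lborel. LINT x:torus_dom|lborel. (f x t - c * h x t) * \<sigma> x t)
      - (LINT t:?I|lborel. LINT x:torus_dom|lborel. f x t * \<sigma> x t)\<bar> = \<bar>c\<bar> * \<bar>LINT t:?I|lborel. LINT x:torus_dom|lborel. h x t * \<sigma> x t\<bar>"
    by (simp add: abs_mult)
  also have "\<dots> \<le> \<bar>c\<bar> * (K' * T)"
  proof (rule mult_left_mono)
    have "norm (LINT t:?I|lborel. LINT x:torus_dom|lborel. h x t * \<sigma> x t) \<le> (LINT t:?I|lborel. norm (LINT x:torus_dom|lborel. h x t * \<sigma> x t))"
      by (rule set_integral_norm_bound[OF sh])
    also have "\<dots> \<le> (LINT t:?I|lborel. K')"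
    proof (rule set_integral_mono)
      show "set_integrable lborel ?I (\<lambda>t. norm (LINT x:torus_dom|lborel. h x t * \<sigma> x t))"
        by (rule set_integrable_norm[OF sh])
      show "set_integrable lborel ?I (\<lambda>t. K')"
        unfolding set_integrable_def using T by (intro integrable_scaleR_left integrable_real_indicator) auto
    qed (use sh'(2) in auto)
    also have "\<dots> = K' * T" using T by (simp add: set_lebesgue_integral_def)
    finally show "\<bar>LINT t:?I|lborel. LINT x:torus_dom|lborel. h x t * \<sigma> x t\<bar> \<le> K' * T" by simp
  qed simp
  finally show ?thesis .
qed

lemma viscous_solution_bounded:
  fixes w :: "real^'n \<Rightarrow> real \<Rightarrow> real"
  assumes sol: "viscous_solution \<epsilon> H g w" and bd: "derivative_bound C w"
  obtains wt dw ddw where "bounded_viscous_solution C \<epsilon> H g w wt dw ddw"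
proof -
  obtain wt dw ddw where C21: "C21_with {0<..} w wt dw ddw"
    using sol unfolding viscous_solution_def C21_on_iff by blast
  have "bounded_viscous_solution C \<epsilon> H g w wt dw ddw"
    unfolding bounded_viscous_solution_def
    using sol C21 derivative_bound_C21[OF bd C21] C21_with_eq[OF C21]
    by (auto simp: viscous_solution_def)
  then show ?thesis by (rule that)
qed

lemma C21_with_subset: "C21_with I w wt dw ddw \<Longrightarrow> J \<subseteq> I \<Longrightarrow> C21_with J w wt dw ddw"
  unfolding C21_with_def by (auto elim!: continuous_on_subset)

lemma drift_continuous:
  fixes H :: "real^'n \<Rightarrow> real^'n \<Rightarrow> real"
  assumes H: "C2_on (\<lambda>(x, p). H x p) UNIV" and C21: "C21_with {0<..} w wt dw ddw"
  shows "continuous_on (UNIV \<times> {0<..<T}) (\<lambda>(x, t). grad (H x) (dw x t))"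
proof -
  have c: "continuous_on (UNIV \<times> {0<..<T}) (\<lambda>(x, t). dw x t)"
    by (rule continuous_on_subset[OF C21_with_cont(2)[OF C21]]) auto
  have "continuous_on (UNIV \<times> {0<..<T}) (\<lambda>q. (\<lambda>(x, p). grad (H x) p) (fst q, dw (fst q) (snd q)))"
    by (rule continuous_on_compose2[OF C2_on_hamiltonian_grad_continuous[OF H]])
       (use c in \<open>auto intro!: continuous_intros simp: split_beta\<close>)
  then show ?thesis by (simp add: case_prod_unfold)
qed

text \<open>
  Duality with \<open>\<phi> = w\<close>: by the viscous equation the integrand no longer contains second derivatives.
\<close>

lemma action_identity:
  fixes H :: "real^'n \<Rightarrow> real^'n \<Rightarrow> real"
  assumes H: "C2_on (\<lambda>(x, p). H x p) UNIV" "\<And>p. Zn_periodic (\<lambda>x. H x p)" and T: "T > 0"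
    and sol: "bounded_viscous_solution C \<epsilon> H g w wt dw ddw"
    and adj: "adjoint_solution \<epsilon> H w z T \<sigma>"
    and \<nu>: "\<And>t. t \<in> {0..<T} \<Longrightarrow> is_nu C w \<sigma> t (\<nu> t)" and \<mu>: "is_mu C T \<nu> \<mu>"
  shows "w z T - (LINT x:torus_dom|lborel. g x * \<sigma> x 0) = (\<integral>(x, p, t). action_density H x p \<partial>\<mu>)"
proof -
  note D = bounded_viscous_solutionD[OF sol]
  have C21: "C21_with {0<..<T} w wt dw ddw" by (rule C21_with_subset[OF D(3)]) auto
  have CTw: "CT {0..T} w" using D(1) unfolding CT_def by (auto elim!: continuous_on_subset)
  have CTa: "CT (UNIV \<times> {0..T}) (\<lambda>x (p, t). action_density H x p)"
    by (rule CT_const_time[OF CT_action_density[OF H]])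
  obtain B where B: "\<And>x p t. norm p \<le> C \<Longrightarrow> t \<in> {0..T} \<Longrightarrow> \<bar>action_density H x p\<bar> \<le> B"
    using CT_phase_bounded[OF CT_restrict_ball[OF CTa]] by metis
  have dw: "grad (\<lambda>y. w y t) x = dw x t" if "t \<in> {0<..<T}" for x t
    by (rule C21_with_eq(2)[OF C21 that])
  have "w z T - (LINT x:torus_dom|lborel. w x 0 * \<sigma> x 0)
      = (LINT t:{0<..<T}|lborel. LINT x:torus_dom|lborel. action_density H x (dw x t) * \<sigma> x t)"
  proof (rule adjoint_duality[OF adj T drift_continuous[OF H(1) D(3)] _ C21 CTw])
    show "grad (H x) (grad (\<lambda>y. w y t) x) = grad (H x) (dw x t)" if "t \<in> {0<..<T}" for x t
      by (simp add: dw[OF that])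
    fix x t assume t: "t \<in> {0<..<T}"
    show "action_density H x (dw x t) = wt x t + grad (H x) (dw x t) \<bullet> dw x t - \<epsilon> * (\<Sum>i\<in>UNIV. ddw x t $ i $ i)"
      using D(4)[of t x] t by (simp add: action_density_def)
    show "\<bar>action_density H x (dw x t)\<bar> \<le> B" using B[of "dw x t" t x] D(6)[of t x] t by auto
  qed
  also have "\<dots> = (\<integral>(x, p, t). action_density H x p \<partial>\<mu>)"
    by (rule mu_integral_eq[OF \<mu> \<nu> CTa dw, symmetric])
  finally show ?thesis by (simp add: D(2))
qed

lemma CT_transport_integrand:
  fixes d\<phi> :: "real^'n \<Rightarrow> real \<Rightarrow> real^'n"
  assumes "CT {0..T} \<phi>t" "continuous_on (UNIV \<times> {0..T}) (\<lambda>(x, t). d\<phi> x t)"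
    "\<And>t. t \<in> {0..T} \<Longrightarrow> Zn_periodic (\<lambda>x. d\<phi> x t)"
  shows "CT (UNIV \<times> {0..T}) (\<lambda>x (v, t). \<phi>t x t + v \<bullet> d\<phi> x t)"
  unfolding CT_def
proof
  have ct: "continuous_on (UNIV \<times> {0..T}) (\<lambda>(x, t). \<phi>t x t)" using assms(1) by (simp add: CT_def)
  have "continuous_on (UNIV \<times> UNIV \<times> {0..T}) (\<lambda>q :: (real^'n) \<times> (real^'n) \<times> real. (\<lambda>(x, t). \<phi>t x t) (fst q, snd (snd q)))"
    by (rule continuous_on_compose2[OF ct]) (auto intro!: continuous_intros)
  moreover have "continuous_on (UNIV \<times> UNIV \<times> {0..T}) (\<lambda>q :: (real^'n) \<times> (real^'n) \<times> real. (\<lambda>(x, t). d\<phi> x t) (fst q, snd (snd q)))"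
    by (rule continuous_on_compose2[OF assms(2)]) (auto intro!: continuous_intros)
  ultimately show "continuous_on (UNIV \<times> UNIV \<times> {0..T}) (\<lambda>(x, v, t). \<phi>t x t + v \<bullet> d\<phi> x t)"
    by (auto simp: case_prod_unfold intro!: continuous_intros)
  show "\<forall>y\<in>UNIV \<times> {0..T}. Zn_periodic (\<lambda>x. case y of (v, t) \<Rightarrow> \<phi>t x t + v \<bullet> d\<phi> x t)"
    using assms(1,3) by (auto simp: CT_def Zn_periodic_def)
qed

lemma approximate_transport_identity:
  fixes H :: "real^'n \<Rightarrow> real^'n \<Rightarrow> real"
  assumes H: "C2_on (\<lambda>(x, p). H x p) UNIV" "\<And>p. Zn_periodic (\<lambda>x. H x p)" and T: "T > 0" and "\<epsilon> > 0"
    and sol: "bounded_viscous_solution C \<epsilon> H g w wt dw ddw"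
    and adj: "adjoint_solution \<epsilon> H w z T \<sigma>"
    and \<nu>: "\<And>t. t \<in> {0..<T} \<Longrightarrow> is_nu C w \<sigma> t (\<nu> t)" and \<mu>: "is_mu C T \<nu> \<mu>"
    and \<phi>: "CT {0..T} \<phi>" "CT {0..T} \<phi>t" "continuous_on (UNIV \<times> {0..T}) (\<lambda>(x, t). d\<phi> x t)"
      "\<And>t. t \<in> {0..T} \<Longrightarrow> Zn_periodic (\<lambda>x. d\<phi> x t)"
    and C21\<phi>: "C21_with {0<..<T} \<phi> \<phi>t d\<phi> dd\<phi>"
    and K: "\<And>x t. t \<in> {0..T} \<Longrightarrow> \<bar>\<Sum>i\<in>UNIV. dd\<phi> x t $ i $ i\<bar> \<le> K"
  shows "\<bar>(\<phi> z T - (LINT x:torus_dom|lborel. \<phi> x 0 * \<sigma> x 0))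
      - (\<integral>(x, p, t). \<phi>t x t + grad (H x) p \<bullet> d\<phi> x t \<partial>\<mu>)\<bar> \<le> \<epsilon> * (K * T)"
proof -
  note D = bounded_viscous_solutionD[OF sol]
  have CTt: "CT (UNIV \<times> {0..T}) (\<lambda>x (p, t). \<phi>t x t + grad (H x) p \<bullet> d\<phi> x t)"
    by (rule CT_velocity[OF H CT_transport_integrand[OF \<phi>(2-4)]])
  obtain B where B: "\<And>x p t. norm p \<le> C \<Longrightarrow> t \<in> {0..T} \<Longrightarrow> \<bar>\<phi>t x t + grad (H x) p \<bullet> d\<phi> x t\<bar> \<le> B"
    using CT_phase_bounded[OF CT_restrict_ball[OF CTt]] by metis
  have dw: "grad (\<lambda>y. w y t) x = dw x t" if "t \<in> {0<..<T}" for x t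
    by (rule C21_with_eq(2)[OF D(3)]) (use that in auto)
  define f where "f x t = \<phi>t x t + grad (H x) (dw x t) \<bullet> d\<phi> x t" for x t
  define l where "l x t = (\<Sum>i\<in>UNIV. dd\<phi> x t $ i $ i)" for x t
  have cf: "continuous_on (UNIV \<times> {0<..<T}) (\<lambda>(x, t). f x t)"
    using drift_continuous[OF H(1) D(3), of T] C21_with_cont(1,2)[OF C21\<phi>]
    unfolding f_def split_beta by (intro continuous_intros)
  have cl: "continuous_on (UNIV \<times> {0<..<T}) (\<lambda>(x, t). l x t)"
    using C21_with_cont(3)[OF C21\<phi>] unfolding l_def split_beta by (intro continuous_intros)
  have fB: "\<bar>f x t\<bar> \<le> B" if "t \<in> {0<..<T}" for x t
    unfolding f_def using D(6)[of t x] that by (intro B) auto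
  have lK: "\<bar>l x t\<bar> \<le> K" if "t \<in> {0<..<T}" for x t
    unfolding l_def using K[of t x] that by auto
  have "\<phi> z T - (LINT x:torus_dom|lborel. \<phi> x 0 * \<sigma> x 0)
      = (LINT t:{0<..<T}|lborel. LINT x:torus_dom|lborel. (f x t - \<epsilon> * l x t) * \<sigma> x t)"
  proof (rule adjoint_duality[OF adj T drift_continuous[OF H(1) D(3)] _ C21\<phi> \<phi>(1)])
    show "grad (H x) (grad (\<lambda>y. w y t) x) = grad (H x) (dw x t)" if "t \<in> {0<..<T}" for x t
      by (simp add: dw[OF that])
    fix x t assume t: "t \<in> {0<..<T}"
    show "f x t - \<epsilon> * l x t = \<phi>t x t + grad (H x) (dw x t) \<bullet> d\<phi> x t - \<epsilon> * (\<Sum>i\<in>UNIV. dd\<phi> x t $ i $ i)"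
      by (simp add: f_def l_def)
    have "\<bar>\<epsilon> * l x t\<bar> \<le> \<epsilon> * K" using \<open>\<epsilon> > 0\<close> lK[OF t, of x] by (simp add: abs_mult)
    then show "\<bar>f x t - \<epsilon> * l x t\<bar> \<le> B + \<epsilon> * K" using fB[OF t, of x] by linarith
  qed
  moreover have "(\<integral>(x, p, t). \<phi>t x t + grad (H x) p \<bullet> d\<phi> x t \<partial>\<mu>)
      = (LINT t:{0<..<T}|lborel. LINT x:torus_dom|lborel. f x t * \<sigma> x t)"
    unfolding f_def by (rule mu_integral_eq[OF \<mu> \<nu> CTt dw])
  ultimately show ?thesis
    using adjoint_time_integral[OF adj T cf fB cl lK, of \<epsilon>] \<open>\<epsilon> > 0\<close> by simp
qed

text \<open>
  The measure \<open>\<gamma>\<close> is used to see that the velocities \<open>D\<^sub>pH(x,p)\<close> lie in the ball of radius \<open>C\<close> for almost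
  every point with respect to \<open>\<mu>\<close>: the integral of the excess of \<open>\<bar>v\<bar>\<close> over \<open>C\<close> vanishes for \<open>\<gamma>\<close>. Hence
  the image of \<open>\<mu>\<close> is a measure on the same space.
\<close>

lemma velocity_pushforward:
  fixes H :: "real^'n \<Rightarrow> real^'n \<Rightarrow> real"
  assumes H: "C2_on (\<lambda>(x, p). H x p) UNIV" "\<And>p. Zn_periodic (\<lambda>x. H x p)" and "C \<ge> 0"
    and \<mu>: "\<mu> \<in> radon_measures (phase C T)" and \<gamma>: "\<gamma> \<in> radon_measures (phase C T)"
    and push: "\<And>\<psi>. CT UNIV \<psi> \<Longrightarrow> (\<integral>(x, p, t). \<psi> x (grad (H x) p) \<partial>\<mu>) = (\<integral>(x, v, t). \<psi> x v \<partial>\<gamma>)"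
  obtains \<gamma>' where "\<gamma>' \<in> radon_measures (phase C T)"
    "\<forall>\<psi>. CT (UNIV \<times> {0..T}) (\<lambda>x (v, t). \<psi> x v t) \<longrightarrow>
       (\<integral>(x, p, t). \<psi> x (grad (H x) p) t \<partial>\<mu>) = (\<integral>(x, v, t). \<psi> x v t \<partial>\<gamma>')"
proof -
  note space = radon_measures_space[OF \<mu>] radon_measures_space[OF \<gamma>]
  define V where "V q = grad (H (fst q)) (fst (snd q))" for q :: "(real^'n) \<times> (real^'n) \<times> real"
  have cV: "continuous_on (phase C T) V"
  proof -
    have "continuous_on (phase C T) (\<lambda>q. (\<lambda>(x, p). grad (H x) p) (fst q, fst (snd q)))"
      by (rule continuous_on_compose2[OF C2_on_hamiltonian_grad_continuous[OF H(1)]]) (auto intro!: continuous_intros)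
    then show ?thesis by (simp add: V_def[abs_def])
  qed
  have V_meas: "V \<in> borel_measurable \<mu>" by (rule radon_measures_measurable[OF \<mu> cV])
  \<comment> \<open>Integrate the function \<open>max 0 (\<bar>v\<bar> - C)\<close>, which vanishes on the phase space.\<close>
  have AE_V: "AE q in \<mu>. norm (V q) \<le> C"
  proof -
    have CT: "CT UNIV (\<lambda>(x::real^'n) v::real^'n. max 0 (norm v - C))"
      by (auto simp: CT_def Zn_periodic_def split_beta intro!: continuous_intros)
    have "(\<integral>q. max 0 (norm (V q) - C) \<partial>\<mu>) = (\<integral>(x, v, t). max 0 (norm v - C) \<partial>\<gamma>)"
      using push[OF CT] by (simp add: V_def case_prod_unfold)
    also have "\<dots> = (\<integral>q. 0 \<partial>\<gamma>)"
      by (intro Bochner_Integration.integral_cong) (auto simp: space phase_def)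
    finally have "(\<integral>q. max 0 (norm (V q) - C) \<partial>\<mu>) = 0" by simp
    moreover have "integrable \<mu> (\<lambda>q. max 0 (norm (V q) - C))"
      using CT_phase_integrable[OF \<mu> CT_restrict_ball[OF CT_velocity[OF H CT_const_time[OF CT]]]]
      by (simp add: V_def case_prod_unfold)
    ultimately have "AE q in \<mu>. max 0 (norm (V q) - C) = 0"
      by (subst (asm) integral_nonneg_eq_0_iff_AE) auto
    then show ?thesis by eventually_elim auto
  qed
  \<comment> \<open>The value 0 off the ball is arbitrary; it keeps the image in the phase space everywhere.\<close>
  define F where "F q = (fst q, if norm (V q) \<le> C then V q else 0, snd (snd q))" for q
  have F: "F \<in> measurable \<mu> (restrict_space borel (phase C T))"
  proof (rule measurable_restrict_space2)
    show "F \<in> space \<mu> \<rightarrow> phase C T"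
      using \<open>C \<ge> 0\<close> by (auto simp: F_def space phase_def)
    have "(\<lambda>q. if norm (V q) \<le> C then V q else 0) \<in> borel_measurable \<mu>"
      using V_meas by measurable
    moreover have "fst \<in> borel_measurable \<mu>" "(\<lambda>q. snd (snd q)) \<in> borel_measurable \<mu>"
      by (auto intro!: radon_measures_measurable[OF \<mu>] continuous_intros)
    ultimately show "F \<in> borel_measurable \<mu>"
      unfolding F_def[abs_def] by (intro borel_measurable_Pair)
  qed
  define \<gamma>' where "\<gamma>' = distr \<mu> (restrict_space borel (phase C T)) F"
  have r: "\<gamma>' \<in> radon_measures (phase C T)"
    using \<mu> finite_measure.finite_measure_distr[OF _ F] unfolding radon_measures_def \<gamma>'_def by auto
  moreover have "(\<integral>(x, p, t). \<psi> x (grad (H x) p) t \<partial>\<mu>) = (\<integral>(x, v, t). \<psi> x v t \<partial>\<gamma>')"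
    if \<psi>: "CT (UNIV \<times> {0..T}) (\<lambda>x (v, t). \<psi> x v t)" for \<psi>
  proof -
    have m: "(\<lambda>(x, v, t). \<psi> x v t) \<in> borel_measurable (restrict_space borel (phase C T))"
      by (rule borel_measurable_continuous_on_restrict[OF CT_phase_continuous[OF CT_restrict_ball[OF \<psi>]]])
    have "(\<integral>(x, v, t). \<psi> x v t \<partial>\<gamma>') = (\<integral>q. (\<lambda>(x, v, t). \<psi> x v t) (F q) \<partial>\<mu>)"
      unfolding \<gamma>'_def by (rule integral_distr[OF F m])
    also have "\<dots> = (\<integral>(x, p, t). \<psi> x (grad (H x) p) t \<partial>\<mu>)"
    proof (rule integral_cong_AE)
      show "(\<lambda>q. (\<lambda>(x, v, t). \<psi> x v t) (F q)) \<in> borel_measurable \<mu>"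
        by (rule measurable_compose[OF F m])
      show "(\<lambda>(x, p, t). \<psi> x (grad (H x) p) t) \<in> borel_measurable \<mu>"
        by (rule borel_measurable_integrable[OF CT_phase_integrable[OF \<mu> CT_restrict_ball[OF CT_velocity[OF H \<psi>]]]])
      show "AE q in \<mu>. (\<lambda>(x, v, t). \<psi> x v t) (F q) = (\<lambda>(x, p, t). \<psi> x (grad (H x) p) t) q"
        using AE_V by eventually_elim (simp add: F_def V_def case_prod_unfold)
    qed
    finally show ?thesis by simp
  qed
  ultimately show ?thesis using that by blast
qed

section \<open>The representation formula and the minimizer\<close>

theorem theorem1p2:
  fixes H :: "real^'n \<Rightarrow> real^'n \<Rightarrow> real"
    and g :: "real^'n \<Rightarrow> real"
    and u :: "real^'n \<Rightarrow> real \<Rightarrow> real"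
    and u\<epsilon> :: "real \<Rightarrow> real^'n \<Rightarrow> real \<Rightarrow> real"
    and C T :: real
    and z :: "real^'n"
    and \<sigma>\<epsilon> :: "real \<Rightarrow> real^'n \<Rightarrow> real \<Rightarrow> real"
    and \<nu>\<epsilon> :: "real \<Rightarrow> real \<Rightarrow> ((real^'n) \<times> (real^'n)) measure"
    and \<mu>\<epsilon> :: "real \<Rightarrow> ((real^'n) \<times> (real^'n) \<times> real) measure"
    and e :: "nat \<Rightarrow> real"
    and \<sigma>z :: "(real^'n) measure"
    and \<mu>z \<gamma>z :: "((real^'n) \<times> (real^'n) \<times> real) measure"
  assumes H_C2: "C2_on (\<lambda>(x, p). H x p) UNIV"
    and H_periodic: "\<And>p. Zn_periodic (\<lambda>x. H x p)"
    and g_C2: "C2_on g UNIV"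
    and g_periodic: "Zn_periodic g"
    and H_A1: "A1 H"
    and H_convex: "\<And>x. convex_on UNIV (H x)"
    and T_pos: "T > 0"
    and u_sol: "viscosity_solution H g u"
    and u\<epsilon>_sol: "\<And>\<epsilon>. \<epsilon> \<in> {0<..<1} \<Longrightarrow> viscous_solution \<epsilon> H g (u\<epsilon> \<epsilon>)"
    and C_pos: "C > 0"
    and C_u\<epsilon>: "\<And>\<epsilon>. \<epsilon> \<in> {0<..<1} \<Longrightarrow> derivative_bound C (u\<epsilon> \<epsilon>)"
    and C_u: "derivative_bound C u"
    and \<sigma>\<epsilon>_sol: "\<And>\<epsilon>. \<epsilon> \<in> {0<..<1} \<Longrightarrow> adjoint_solution \<epsilon> H (u\<epsilon> \<epsilon>) z T (\<sigma>\<epsilon> \<epsilon>)"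
    and \<nu>\<epsilon>: "\<And>\<epsilon> t. \<epsilon> \<in> {0<..<1} \<Longrightarrow> t \<in> {0..<T} \<Longrightarrow> is_nu C (u\<epsilon> \<epsilon>) (\<sigma>\<epsilon> \<epsilon>) t (\<nu>\<epsilon> \<epsilon> t)"
    and \<mu>\<epsilon>: "\<And>\<epsilon>. \<epsilon> \<in> {0<..<1} \<Longrightarrow> is_mu C T (\<nu>\<epsilon> \<epsilon>) (\<mu>\<epsilon> \<epsilon>)"
    and e_range: "\<And>k. e k \<in> {0<..<1}"
    and e_lim: "e \<longlonglongrightarrow> 0"
    and \<sigma>z_mem: "\<sigma>z \<in> torus_probs"
    and \<sigma>z_lim: "weak_conv_torus (\<lambda>k x. \<sigma>\<epsilon> (e k) x 0) \<sigma>z"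
    and \<mu>z_mem: "\<mu>z \<in> radon_measures (phase C T)"
    and \<mu>z_lim: "weak_conv_phase C T (\<lambda>k. \<mu>\<epsilon> (e k)) \<mu>z"
    and \<gamma>z_mem: "\<gamma>z \<in> radon_measures (phase C T)"
    and \<gamma>z: "\<And>\<psi>. CT UNIV \<psi> \<Longrightarrow>
          (\<integral>(x, p, t). \<psi> x (grad (H x) p) \<partial>\<mu>z) = (\<integral>(x, v, t). \<psi> x v \<partial>\<gamma>z)"
  shows "ereal (u z T)
           = ereal (\<integral>x. g x \<partial>\<sigma>z) + ereal_integral \<gamma>z (\<lambda>(x, v, t). legendre H x v)
      \<and> ((\<forall>\<psi>. CT (UNIV \<times> {0..T}) (\<lambda>x (v, t). \<psi> x v t) \<longrightarrow>
             (\<integral>(x, p, t). \<psi> x (grad (H x) p) t \<partial>\<mu>z) = (\<integral>(x, v, t). \<psi> x v t \<partial>\<gamma>z)) \<longrightarrow>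
           \<gamma>z \<in> transport_from C T z \<sigma>z \<and>
           is_arg_min (cost H g C T z) (\<lambda>\<gamma>. \<gamma> \<in> transport C T z) \<gamma>z)
      \<and> ereal (u z T) = (INF \<gamma>\<in>transport C T z. cost H g C T z \<gamma>)"
proof -
  note cH = C2_on_hamiltonian_continuous[OF H_C2]
  have C0: "C \<ge> 0" using C_pos by simp
  have approx: "\<exists>\<epsilon>0>0. \<forall>\<epsilon>. 0 < \<epsilon> \<longrightarrow> \<epsilon> < \<epsilon>0 \<longrightarrow> \<epsilon> \<in> {0<..<1} \<and>
      (\<exists>wt dw ddw. bounded_viscous_solution C \<epsilon> H g (u\<epsilon> \<epsilon>) wt dw ddw) \<and> \<bar>u\<epsilon> \<epsilon> z T - u z T\<bar> \<le> \<kappa>"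
    if \<kappa>: "\<kappa> > 0" for \<kappa>
  proof -
    obtain e0 where e0: "e0 > 0" "\<And>\<epsilon> w wt dw ddw z. 0 < \<epsilon> \<Longrightarrow> \<epsilon> < e0 \<Longrightarrow>
        bounded_viscous_solution C \<epsilon> H g w wt dw ddw \<Longrightarrow> \<bar>w z T - u z T\<bar> \<le> \<kappa>"
      using vanishing_viscosity_estimate[OF cH H_periodic u_sol T_pos C0 \<kappa>] by blast
    show ?thesis
    proof (intro exI[of _ "min e0 1"] conjI allI impI)
      fix \<epsilon> :: real assume \<epsilon>: "0 < \<epsilon>" "\<epsilon> < min e0 1"
      then show I: "\<epsilon> \<in> {0<..<1}" by simp
      obtain wt dw ddw where sol: "bounded_viscous_solution C \<epsilon> H g (u\<epsilon> \<epsilon>) wt dw ddw"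
        using viscous_solution_bounded[OF u\<epsilon>_sol[OF I] C_u\<epsilon>[OF I]] .
      then show "\<exists>wt dw ddw. bounded_viscous_solution C \<epsilon> H g (u\<epsilon> \<epsilon>) wt dw ddw" by blast
      show "\<bar>u\<epsilon> \<epsilon> z T - u z T\<bar> \<le> \<kappa>" using e0(2)[OF _ _ sol] \<epsilon> by simp
    qed (use e0(1) in auto)
  qed
  have conv: "(\<lambda>k. u\<epsilon> (e k) z T) \<longlonglongrightarrow> u z T"
  proof (rule tendstoI)
    fix r :: real assume "r > 0"
    then obtain e0 where e0: "e0 > 0" "\<And>\<epsilon>. 0 < \<epsilon> \<Longrightarrow> \<epsilon> < e0 \<Longrightarrow> \<bar>u\<epsilon> \<epsilon> z T - u z T\<bar> \<le> r / 2"
      using approx[of "r / 2"] by (metis half_gt_zero)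
    have "\<forall>\<^sub>F k in sequentially. e k < e0" using order_tendstoD(2)[OF e_lim e0(1)] .
    then show "\<forall>\<^sub>F k in sequentially. dist (u\<epsilon> (e k) z T) (u z T) < r"
    proof eventually_elim
      case (elim k)
      then show ?case using e0(2)[of "e k"] e_range[of k] \<open>r > 0\<close> by (simp add: dist_real_def)
    qed
  qed
  have CTa: "CT (UNIV \<times> {0..T}) (\<lambda>x (p, t). action_density H x p)"
    by (rule CT_const_time[OF CT_action_density[OF H_C2 H_periodic]])
  have cg: "continuous_on UNIV g"
  proof -
    obtain g' where "\<And>x. (g has_derivative blinfun_apply (g' x)) (at x within UNIV)"
      using g_C2 unfolding C2_on_def by blast
    then show ?thesis by (rule has_derivative_continuous_on)
  qed
  have u_eq: "u z T = (\<integral>x. g x \<partial>\<sigma>z) + (\<integral>(x, p, t). action_density H x p \<partial>\<mu>z)"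
  proof (rule LIMSEQ_unique[OF conv])
    have "u\<epsilon> (e k) z T = (LINT x:torus_dom|lborel. g x * \<sigma>\<epsilon> (e k) x 0) + (\<integral>(x, p, t). action_density H x p \<partial>\<mu>\<epsilon> (e k))" for k
    proof -
      note I = e_range[of k]
      obtain wt dw ddw where sol: "bounded_viscous_solution C (e k) H g (u\<epsilon> (e k)) wt dw ddw"
        using viscous_solution_bounded[OF u\<epsilon>_sol[OF I] C_u\<epsilon>[OF I]] .
      show ?thesis
        using action_identity[OF H_C2 H_periodic T_pos sol \<sigma>\<epsilon>_sol[OF I] \<nu>\<epsilon>[OF I] \<mu>\<epsilon>[OF I]] by simp
    qed
    moreover have "(\<lambda>k. LINT x:torus_dom|lborel. g x * \<sigma>\<epsilon> (e k) x 0) \<longlonglongrightarrow> (\<integral>x. g x \<partial>\<sigma>z)"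
      using \<sigma>z_lim cg g_periodic unfolding weak_conv_torus_def by blast
    moreover have "(\<lambda>k. \<integral>(x, p, t). action_density H x p \<partial>\<mu>\<epsilon> (e k)) \<longlonglongrightarrow> (\<integral>(x, p, t). action_density H x p \<partial>\<mu>z)"
      by (rule \<mu>z_lim[unfolded weak_conv_phase_def, rule_format, OF CT_restrict_ball[OF CTa]])
    ultimately show "(\<lambda>k. u\<epsilon> (e k) z T) \<longlonglongrightarrow> (\<integral>x. g x \<partial>\<sigma>z) + (\<integral>(x, p, t). action_density H x p \<partial>\<mu>z)"
      using tendsto_add by simp
  qed
  have representation: "ereal (u z T) = ereal (\<integral>x. g x \<partial>\<sigma>z) + ereal_integral \<gamma> (\<lambda>(x, v, t). legendre H x v)"
    if "\<gamma> \<in> radon_measures (phase C T)"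
      "\<And>\<psi>. CT UNIV \<psi> \<Longrightarrow> (\<integral>(x, p, t). \<psi> x (grad (H x) p) \<partial>\<mu>z) = (\<integral>(x, v, t). \<psi> x v \<partial>\<gamma>)" for \<gamma>
    using legendre_integral[OF H_C2 H_periodic H_convex \<mu>z_mem that] u_eq by simp
  have admissible: "\<gamma> \<in> transport_from C T z \<sigma>z"
    if \<gamma>: "\<gamma> \<in> radon_measures (phase C T)"
      and push: "\<And>\<psi>. CT (UNIV \<times> {0..T}) (\<lambda>x (v, t). \<psi> x v t) \<Longrightarrow>
             (\<integral>(x, p, t). \<psi> x (grad (H x) p) t \<partial>\<mu>z) = (\<integral>(x, v, t). \<psi> x v t \<partial>\<gamma>)" for \<gamma>
    unfolding transport_from_def
  proof (intro CollectI conjI allI impI \<gamma>)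
    fix \<phi> :: "real^'n \<Rightarrow> real \<Rightarrow> real"
    assume "C2_on (\<lambda>(x, t). \<phi> x t) (UNIV \<times> {0..T})" "\<forall>t\<in>{0..T}. Zn_periodic (\<lambda>x. \<phi> x t)"
    then obtain \<phi>t d\<phi> L where \<phi>: "CT {0..T} \<phi>" "CT {0..T} \<phi>t" "continuous_on (UNIV \<times> {0..T}) (\<lambda>(x, t). d\<phi> x t)"
      "\<And>t. t \<in> {0..T} \<Longrightarrow> Zn_periodic (\<lambda>x. d\<phi> x t)" and L: "CT {0..T} L"
      and vd: "\<And>x t. t \<in> {0..T} \<Longrightarrow> vector_derivative (\<phi> x) (at t within {0..T}) = \<phi>t x t"
      and gr: "\<And>x t. t \<in> {0..T} \<Longrightarrow> grad (\<lambda>y. \<phi> y t) x = d\<phi> x t"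
      and ex: "\<exists>dd\<phi>. C21_with {0<..<T} \<phi> \<phi>t d\<phi> dd\<phi> \<and> (\<forall>x t. L x t = (\<Sum>i\<in>UNIV. dd\<phi> x t $ i $ i))"
      using C2_on_strip[of \<phi> T] T_pos by blast
    obtain dd\<phi> where dd: "C21_with {0<..<T} \<phi> \<phi>t d\<phi> dd\<phi>" "\<And>x t. L x t = (\<Sum>i\<in>UNIV. dd\<phi> x t $ i $ i)"
      using ex by blast
    have cL: "continuous_on (UNIV \<times> {0..T}) (\<lambda>(x, t). L x t)" and pL: "Zn_periodic (\<lambda>x. L x t)" if "t \<in> {0..T}" for t
      using L that by (auto simp: CT_def)
    have "continuous_on (UNIV \<times> {0..T}) (\<lambda>(x, t). L x t)" using cL[of 0] T_pos by simp
    from periodic_bounded[OF this compact_Icc pL] obtain K where K: "\<And>x t. t \<in> {0..T} \<Longrightarrow> norm (L x t) \<le> K"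
      by metis
    have CTt: "CT (UNIV \<times> {0..T}) (\<lambda>x (p, t). \<phi>t x t + grad (H x) p \<bullet> d\<phi> x t)"
      by (rule CT_velocity[OF H_C2 H_periodic CT_transport_integrand[OF \<phi>(2-4)]])
    \<comment> \<open>The two sides of the transport identity before the limit; they differ by \<open>O(\<epsilon>)\<close>.\<close>
    let ?l = "\<lambda>k. \<phi> z T - (LINT x:torus_dom|lborel. \<phi> x 0 * \<sigma>\<epsilon> (e k) x 0)"
    let ?r = "\<lambda>k. \<integral>(x, p, t). \<phi>t x t + grad (H x) p \<bullet> d\<phi> x t \<partial>\<mu>\<epsilon> (e k)"
    have est: "norm (?l k - ?r k) \<le> e k * (K * T)" for k
    proof -
      note I = e_range[of k]
      obtain wt dw ddw where sol: "bounded_viscous_solution C (e k) H g (u\<epsilon> (e k)) wt dw ddw"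
        using viscous_solution_bounded[OF u\<epsilon>_sol[OF I] C_u\<epsilon>[OF I]] .
      show ?thesis
        unfolding real_norm_def
      proof (rule approximate_transport_identity[OF H_C2 H_periodic T_pos _ sol \<sigma>\<epsilon>_sol[OF I] \<nu>\<epsilon>[OF I] \<mu>\<epsilon>[OF I] \<phi> dd(1)])
        show "\<bar>\<Sum>i\<in>UNIV. dd\<phi> x t $ i $ i\<bar> \<le> K" if "t \<in> {0..T}" for x t
          using K[OF that, of x] by (simp add: dd(2))
      qed (use I in auto)
    qed
    have small: "(\<lambda>k. e k * (K * T)) \<longlonglongrightarrow> 0" using e_lim by (rule tendsto_mult_left_zero)
    have "\<forall>\<^sub>F k in sequentially. norm (?l k - ?r k) \<le> e k * (K * T)"
      by (rule always_eventually) (rule allI, rule est)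
    from Lim_null_comparison[OF this small] have diff: "(\<lambda>k. ?l k - ?r k) \<longlonglongrightarrow> 0" .
    have c\<phi>: "continuous_on (UNIV \<times> {0..T}) (\<lambda>(x, t). \<phi> x t)" using \<phi>(1) by (simp add: CT_def)
    have c0: "continuous_on UNIV (\<lambda>x. \<phi> x 0)"
      by (rule continuous_on_slice[OF c\<phi>]) (use T_pos in simp)
    have p0: "Zn_periodic (\<lambda>x. \<phi> x 0)" using \<phi>(1) T_pos by (auto simp: CT_def)
    have "(\<lambda>k. LINT x:torus_dom|lborel. \<phi> x 0 * \<sigma>\<epsilon> (e k) x 0) \<longlonglongrightarrow> (\<integral>x. \<phi> x 0 \<partial>\<sigma>z)"
      using \<sigma>z_lim c0 p0 unfolding weak_conv_torus_def by blast
    then have l: "?l \<longlonglongrightarrow> \<phi> z T - (\<integral>x. \<phi> x 0 \<partial>\<sigma>z)" by (intro tendsto_intros)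
    have r: "?r \<longlonglongrightarrow> (\<integral>(x, p, t). \<phi>t x t + grad (H x) p \<bullet> d\<phi> x t \<partial>\<mu>z)"
      by (rule \<mu>z_lim[unfolded weak_conv_phase_def, rule_format, OF CT_restrict_ball[OF CTt]])
    have "\<phi> z T - (\<integral>x. \<phi> x 0 \<partial>\<sigma>z) - (\<integral>(x, p, t). \<phi>t x t + grad (H x) p \<bullet> d\<phi> x t \<partial>\<mu>z) = 0"
      by (rule LIMSEQ_unique[OF tendsto_diff[OF l r] diff])
    moreover have "(\<integral>(x, p, t). \<phi>t x t + grad (H x) p \<bullet> d\<phi> x t \<partial>\<mu>z) = (\<integral>(x, v, t). \<phi>t x t + v \<bullet> d\<phi> x t \<partial>\<gamma>)"
      by (rule push[OF CT_transport_integrand[OF \<phi>(2-4)]])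
    moreover have "(\<integral>(x, v, t). vector_derivative (\<phi> x) (at t within {0..T}) + v \<bullet> grad (\<lambda>y. \<phi> y t) x \<partial>\<gamma>)
        = (\<integral>(x, v, t). \<phi>t x t + v \<bullet> d\<phi> x t \<partial>\<gamma>)"
      by (intro Bochner_Integration.integral_cong) (auto simp: radon_measures_space[OF \<gamma>] phase_def vd gr)
    ultimately show "(\<integral>(x, v, t). vector_derivative (\<phi> x) (at t within {0..T}) + v \<bullet> grad (\<lambda>y. \<phi> y t) x \<partial>\<gamma>)
        = \<phi> z T - (\<integral>x. \<phi> x 0 \<partial>\<sigma>z)" by simp
  qed
  have lower: "ereal (u z T) \<le> cost H g C T z \<gamma>" if \<gamma>: "\<gamma> \<in> transport C T z" for \<gamma>
  proof -
    obtain \<sigma>\<^sub>0 where \<sigma>\<^sub>0: "\<sigma>\<^sub>0 \<in> torus_probs" "\<gamma> \<in> transport_from C T z \<sigma>\<^sub>0"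
      using \<gamma> unfolding transport_def by blast
    have "ereal (u z T) \<le> ereal (\<integral>x. g x \<partial>\<sigma>\<^sub>0) + ereal_integral \<gamma> (\<lambda>(x, v, t). legendre H x v)"
    proof (rule transport_lower_bound[OF cH H_periodic \<sigma>\<^sub>0(2,1) T_pos C0])
      fix \<kappa> :: real assume "\<kappa> > 0"
      then show "\<exists>\<epsilon>0>0. \<forall>\<epsilon>. 0 < \<epsilon> \<longrightarrow> \<epsilon> < \<epsilon>0 \<longrightarrow>
          (\<exists>w wt dw ddw. bounded_viscous_solution C \<epsilon> H g w wt dw ddw \<and> \<bar>w z T - u z T\<bar> \<le> \<kappa>)"
        using approx by meson
    qed
    then show ?thesis unfolding cost_def initial_marginal_eq[OF \<sigma>\<^sub>0(2,1) T_pos] .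
  qed
  have optimal: "\<gamma> \<in> transport_from C T z \<sigma>z \<and> \<gamma> \<in> transport C T z \<and> cost H g C T z \<gamma> = ereal (u z T)"
    if \<gamma>: "\<gamma> \<in> radon_measures (phase C T)"
      and push: "\<And>\<psi>. CT (UNIV \<times> {0..T}) (\<lambda>x (v, t). \<psi> x v t) \<Longrightarrow>
             (\<integral>(x, p, t). \<psi> x (grad (H x) p) t \<partial>\<mu>z) = (\<integral>(x, v, t). \<psi> x v t \<partial>\<gamma>)" for \<gamma>
  proof -
    have t: "\<gamma> \<in> transport_from C T z \<sigma>z" by (rule admissible[OF \<gamma> push])
    have "(\<integral>(x, p, t). \<psi> x (grad (H x) p) \<partial>\<mu>z) = (\<integral>(x, v, t). \<psi> x v \<partial>\<gamma>)" if "CT UNIV \<psi>" for \<psi>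
      by (rule push[OF CT_const_time[OF that]])
    then have "cost H g C T z \<gamma> = ereal (u z T)"
      unfolding cost_def initial_marginal_eq[OF t \<sigma>z_mem T_pos] by (rule representation[OF \<gamma>, symmetric])
    then show ?thesis using t \<sigma>z_mem unfolding transport_def by blast
  qed
  obtain \<gamma>' where \<gamma>': "\<gamma>' \<in> radon_measures (phase C T)"
    "\<forall>\<psi>. CT (UNIV \<times> {0..T}) (\<lambda>x (v, t). \<psi> x v t) \<longrightarrow>
       (\<integral>(x, p, t). \<psi> x (grad (H x) p) t \<partial>\<mu>z) = (\<integral>(x, v, t). \<psi> x v t \<partial>\<gamma>')"
    using velocity_pushforward[OF H_C2 H_periodic C0 \<mu>z_mem \<gamma>z_mem \<gamma>z] by blast
  have "ereal (u z T) = (INF \<gamma>\<in>transport C T z. cost H g C T z \<gamma>)"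
  proof (rule antisym)
    show "ereal (u z T) \<le> (INF \<gamma>\<in>transport C T z. cost H g C T z \<gamma>)" by (rule INF_greatest[OF lower])
    show "(INF \<gamma>\<in>transport C T z. cost H g C T z \<gamma>) \<le> ereal (u z T)"
      using optimal[OF \<gamma>'(1) \<gamma>'(2)[rule_format]] by (intro INF_lower2[of \<gamma>']) auto
  qed
  moreover have "\<gamma>z \<in> transport_from C T z \<sigma>z \<and> is_arg_min (cost H g C T z) (\<lambda>\<gamma>. \<gamma> \<in> transport C T z) \<gamma>z"
    if "\<forall>\<psi>. CT (UNIV \<times> {0..T}) (\<lambda>x (v, t). \<psi> x v t) \<longrightarrow>
             (\<integral>(x, p, t). \<psi> x (grad (H x) p) t \<partial>\<mu>z) = (\<integral>(x, v, t). \<psi> x v t \<partial>\<gamma>z)"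
    using optimal[OF \<gamma>z_mem that[rule_format]] lower unfolding is_arg_min_def by (auto simp: not_less)
  ultimately show ?thesis using representation[OF \<gamma>z_mem \<gamma>z] by blast
qed

end
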